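(* Let $n>1$, let $2<p_1<\dots<p_n$ be integers, and let $\xi(x)=\sum_{i=1}^n\lambda_i x^{p_i}$ with $\lambda_i\in[0,1]$ and $\sum_{i=1}^n\lambda_i=1$. Let $\nu_P$ be the Parisi measure at zero temperature for $\xi$. Then $\nu_P$ is at most $n$-RSB or $n$-FRSB, that is, there is $k\le n$ such that $\nu_P$ is $k$-RSB or $k$-FRSB; i.e., the support of $\nu_P$ contains at most $n+1$ isolated points.
   Context: Parisi measure at zero temperature. Let $\mathcal K$ be the set of measures on $[0,1]$ of the form $\nu(dx)=\mathbf 1_{[0,1)}(x)\gamma(x)\,dx+\Delta\,\delta_{\{1\}}(dx)$, where $\gamma$ is nonnegative, right-continuous and nondecreasing on $[0,1)$ and $\Delta>0$. For $\nu\in\mathcal K$ put $$\mathcal Q(\nu)=\frac12\Big(\int_0^1\xi'(x)\,\nu(dx)+\int_0^1\frac{dx}{\nu((x,1])}\Big).$$ The functional $\mathcal Q$ is strictly convex on $\mathcal K$ and has a unique minimizer $\nu_P(dx)=\gamma_P(x)\mathbf 1_{[0,1)}(x)dx+\Delta_P\delta_{\{1\}}(dx)$, called the Parisi measure at zero temperature. Let $\rho_P$ be the measure on $[0,1)$ with $\rho_P([0,x])=\gamma_P(x)$ for all $x\in[0,1)$. The "support of $\nu_P$" is used in the sense of the support of $\rho_P$ together with the point $1$. $k$-RSB. For $k\ge1$, $\nu_P$ is $k$-RSB if its support (in the sense of the support of $\rho_P$ together with the point $1$) is discrete with exactly $k+1$ points, i.e. there are $0=q_0<q_1<\dots<q_k=1$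 and $0<m_1<\dots<m_k$ and $\Delta>0$ with $\nu_P(dx)=\sum_{i=1}^k m_i\mathbf 1_{[q_{i-1},q_i)}(x)dx+\Delta\,\delta_{\{1\}}(dx)$. It is $0$-RSB (replica symmetric) if $\nu_P=\Delta\,\delta_{\{1\}}$. $k$-FRSB. For $k>0$, $\nu_P$ is $k$-FRSB if there exist an integer $t$ with $1\le t\le k+1$, integers $s_1,\dots,s_t\ge0$ with $s_1+\dots+s_t=k$ (put $w_0=0$ and $w_j=\sum_{i=1}^j s_i$), numbers $q^j_l\in[0,1]$ for $1\le j\le t$, $w_{j-1}\le l\le w_j$, with $q^j_{w_{j-1}}<q^j_{w_{j-1}+1}<\dots<q^j_{w_j}$ for each $j$, $q^{j-1}_{w_{j-1}}<q^j_{w_{j-1}}$ for $2\le j\le t$, $q^1_0=0$ and $q^t_{w_t}=1$, numbers $0<m_1<\dots<m_k$, a strictly increasing function $\omega$, and $\Delta>0$, such that $$\nu_P(dx)=\sum_{j=1}^t\sum_{l=w_{j-1}+1}^{w_j}m_l\mathbf 1_{[q^j_{l-1},q^j_l)}(x)dx+\sum_{j=1}^{t-1}\omega(x)\mathbf 1_{[q^j_{w_j},q^{j+1}_{w_j})}(x)dx+\Delta\,\delta_{\{1\}}(dx).$$ *)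

theory Defs
  imports "HOL-Analysis.Analysis"
begin

section \<open>Measures \<open>\<nu>(dx) = 1\<^bsub>[0,1)\<^esub>(x) \<gamma>(x) dx + \<Delta> \<delta>\<^bsub>1\<^esub>(dx)\<close>\<close>

text \<open>Measures on \<open>[0,1]\<close> are represented as Borel measures on the real line that are
  concentrated on \<open>[0,1]\<close>. The values of \<open>\<gamma>\<close> outside \<open>[0,1)\<close> are irrelevant.\<close>

definition nu_measure :: "(real \<Rightarrow> real) \<Rightarrow> real \<Rightarrow> real measure" where
  "nu_measure \<gamma> \<Delta> = measure_of UNIV (sets borel)
     (\<lambda>A. emeasure (density lborel (\<lambda>x. ennreal (\<gamma> x) * indicator {0..<1} x)) A
          + ennreal \<Delta> * indicator A 1)"

definition parisi_densities :: "(real \<Rightarrow> real) set" where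
  "parisi_densities = {\<gamma>. (\<forall>x\<in>{0..<1}. 0 \<le> \<gamma> x) \<and> mono_on {0..<1} \<gamma> \<and>
     (\<forall>x\<in>{0..<1}. continuous (at_right x) \<gamma>)}"

definition parisi_class :: "real measure set" where
  "parisi_class = {nu_measure \<gamma> \<Delta> |\<gamma> \<Delta>. \<gamma> \<in> parisi_densities \<and> 0 < \<Delta>}"

lemma space_nu_measure [simp]: "space (nu_measure \<gamma> \<Delta>) = UNIV"
  by (simp add: nu_measure_def space_measure_of_conv)

lemma sets_nu_measure [simp, measurable_cong]: "sets (nu_measure \<gamma> \<Delta>) = sets borel"
  unfolding nu_measure_def using sets.sigma_sets_eq[of "borel :: real measure"]
  by (simp add: sets_measure_of_conv)

lemma emeasure_nu_measure_density:
  assumes "A \<in> sets borel"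
  shows "emeasure (nu_measure \<gamma> \<Delta>) A =
    emeasure (density lborel (\<lambda>x. ennreal (\<gamma> x) * indicator {0..<1} x)) A + ennreal \<Delta> * indicator A 1"
proof (rule emeasure_measure_of[OF nu_measure_def])
  let ?D = "density lborel (\<lambda>x. ennreal (\<gamma> x) * indicator {0..<1} x)"
  let ?m = "\<lambda>A. emeasure ?D A + ennreal \<Delta> * indicator A (1::real)"
  show "sets borel \<subseteq> Pow (UNIV :: real set)" by simp
  show "A \<in> sets (nu_measure \<gamma> \<Delta>)" using assms by simp
  show "positive (sets (nu_measure \<gamma> \<Delta>)) ?m" by (simp add: positive_def)
  show "countably_additive (sets (nu_measure \<gamma> \<Delta>)) ?m"
  proof (rule countably_additiveI)
    fix B :: "nat \<Rightarrow> real set"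
    assume B: "range B \<subseteq> sets (nu_measure \<gamma> \<Delta>)" "disjoint_family B"
    have "(\<Sum>i. emeasure ?D (B i)) = emeasure ?D (\<Union>i. B i)"
      using B by (intro suminf_emeasure) auto
    moreover have "(\<Sum>i. ennreal \<Delta> * indicator (B i) (1::real)) = ennreal \<Delta> * indicator (\<Union>i. B i) 1"
      using B(2) by (simp add: suminf_indicator)
    ultimately show "(\<Sum>i. ?m (B i)) = ?m (\<Union>i. B i)"
      by (simp add: suminf_add[symmetric])
  qed
qed

lemma parisi_densities_measurable:
  assumes "\<gamma> \<in> parisi_densities"
  shows "(\<lambda>x. ennreal (\<gamma> x) * indicator {0..<1} x) \<in> borel_measurable borel"
proof -
  have "\<gamma> \<in> borel_measurable (restrict_space borel {0..<1})"
    using assms by (intro borel_measurable_mono_on_fnc) (simp add: parisi_densities_def)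
  then have "(\<lambda>x. ennreal (\<gamma> x)) \<in> borel_measurable (restrict_space borel {0..<1})"
    by measurable
  then show ?thesis
    by (subst (asm) borel_measurable_restrict_space_iff_ennreal) (auto simp: mult.commute)
qed

lemma emeasure_nu_measure:
  assumes "\<gamma> \<in> parisi_densities" "A \<in> sets borel"
  shows "emeasure (nu_measure \<gamma> \<Delta>) A =
    (\<integral>\<^sup>+x\<in>A \<inter> {0..<1}. ennreal (\<gamma> x) \<partial>lborel) + ennreal \<Delta> * indicator A 1"
  using assms(2) parisi_densities_measurable[OF assms(1)]
  by (subst emeasure_nu_measure_density)
     (auto simp: emeasure_density indicator_inter_arith ac_simps intro!: nn_integral_cong)


section \<open>The functional \<open>Q\<close> and the Parisi measure at zero temperature\<close>

text \<open>The functional takes values in \<open>[0,\<infinity>]\<close>, since \<open>\<gamma>\<close> need not be integrable near \<open>1\<close>;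
  in that case \<open>\<nu>((x,1]) = \<infinity>\<close> and \<open>1 / \<nu>((x,1]) = 0\<close>. The coercion \<^const>\<open>ennreal\<close> truncates
  negative values, which is harmless because \<open>\<xi>' \<ge> 0\<close> on \<open>[0,1]\<close> for the mixtures considered.\<close>

definition parisi_functional :: "(real \<Rightarrow> real) \<Rightarrow> real measure \<Rightarrow> ennreal" where
  "parisi_functional \<xi> \<nu> =
     ((\<integral>\<^sup>+x\<in>{0..1}. ennreal (deriv \<xi> x) \<partial>\<nu>) +
      (\<integral>\<^sup>+x\<in>{0..<1}. 1 / emeasure \<nu> {x<..1} \<partial>lborel)) / 2"

definition is_parisi_measure :: "(real \<Rightarrow> real) \<Rightarrow> real measure \<Rightarrow> bool" where
  "is_parisi_measure \<xi> \<nu> \<longleftrightarrow> is_arg_min (parisi_functional \<xi>) (\<lambda>\<mu>. \<mu> \<in> parisi_class) \<nu>"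


section \<open>Support\<close>

definition is_rho :: "(real \<Rightarrow> real) \<Rightarrow> real measure \<Rightarrow> bool" where
  "is_rho \<gamma> \<rho> \<longleftrightarrow> sets \<rho> = sets (restrict_space borel {0..<1}) \<and>
     (\<forall>x\<in>{0..<1}. emeasure \<rho> {0..x} = ennreal (\<gamma> x))"

definition measure_support :: "'a::topological_space measure \<Rightarrow> 'a set" where
  "measure_support M =
     {x\<in>space M. \<forall>U. open U \<longrightarrow> x \<in> U \<longrightarrow> 0 < emeasure M (U \<inter> space M)}"

text \<open>The support of \<open>\<nu>\<close> is taken in the sense of the support of \<open>\<rho>\<close> together with the point \<open>1\<close>;
  it is well defined by \<open>is_rho_exists\<close> and \<open>parisi_support_nu_measure\<close> below.\<close>

definition parisi_support :: "real measure \<Rightarrow> real set" where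
  "parisi_support \<nu> = {x. \<exists>\<gamma> \<Delta> \<rho>. \<gamma> \<in> parisi_densities \<and> 0 < \<Delta> \<and> \<nu> = nu_measure \<gamma> \<Delta> \<and>
      is_rho \<gamma> \<rho> \<and> x \<in> measure_support \<rho>} \<union> {1}"

lemma parisi_densities_le:
  assumes "\<gamma> \<in> parisi_densities" "\<gamma>' \<in> parisi_densities"
    and eq: "nu_measure \<gamma> \<Delta> = nu_measure \<gamma>' \<Delta>'" and x: "x \<in> {0..<1}"
  shows "\<gamma> x \<le> \<gamma>' x"
proof -
  have *: "\<gamma> x \<le> \<gamma>' y" if y: "x < y" "y < 1" for y
  proof -
    have nn: "0 \<le> \<gamma>' y" using assms(2) x y by (auto simp: parisi_densities_def)
    have "ennreal (\<gamma> x) * ennreal (y - x) = (\<integral>\<^sup>+t\<in>{x<..<y}. ennreal (\<gamma> x) \<partial>lborel)"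
      using y by (simp add: nn_integral_cmult_indicator)
    also have "\<dots> \<le> (\<integral>\<^sup>+t\<in>{x<..<y} \<inter> {0..<1}. ennreal (\<gamma> t) \<partial>lborel)"
      using assms(1) x y
      by (intro nn_integral_mono)
         (auto simp: parisi_densities_def indicator_def mono_on_def intro!: ennreal_leI)
    also have "\<dots> = emeasure (nu_measure \<gamma> \<Delta>) {x<..<y}"
      using assms(1) y by (simp add: emeasure_nu_measure)
    also have "\<dots> = (\<integral>\<^sup>+t\<in>{x<..<y} \<inter> {0..<1}. ennreal (\<gamma>' t) \<partial>lborel)"
      using assms(2) y by (simp add: eq emeasure_nu_measure)
    also have "\<dots> \<le> (\<integral>\<^sup>+t\<in>{x<..<y}. ennreal (\<gamma>' y) \<partial>lborel)"
      using assms(2) x y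
      by (intro nn_integral_mono)
         (auto simp: parisi_densities_def indicator_def mono_on_def intro!: ennreal_leI)
    also have "\<dots> = ennreal (\<gamma>' y) * ennreal (y - x)"
      using y by (simp add: nn_integral_cmult_indicator)
    finally have "ennreal (\<gamma> x * (y - x)) \<le> ennreal (\<gamma>' y * (y - x))"
      using y by (simp add: ennreal_mult'')
    then show ?thesis using y nn by (simp add: ennreal_le_iff)
  qed
  have "(\<gamma>' \<longlongrightarrow> \<gamma>' x) (at_right x)"
    using assms(2) x by (auto simp: parisi_densities_def continuous_within)
  moreover have "\<forall>\<^sub>F y in at_right x. \<gamma> x \<le> \<gamma>' y"
    using x * by (auto simp: eventually_at_right intro!: exI[of _ 1])
  ultimately show ?thesis
    by (rule tendsto_lowerbound) simp
qed

lemma parisi_densities_unique: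
  assumes "\<gamma> \<in> parisi_densities" "\<gamma>' \<in> parisi_densities"
    and "nu_measure \<gamma> \<Delta> = nu_measure \<gamma>' \<Delta>'" and "x \<in> {0..<1}"
  shows "\<gamma> x = \<gamma>' x"
  using assms parisi_densities_le[of \<gamma> \<gamma>' \<Delta> \<Delta>' x] parisi_densities_le[of \<gamma>' \<gamma> \<Delta>' \<Delta> x]
  by auto

lemma is_rho_unique:
  assumes \<rho>: "is_rho \<gamma> \<rho>" and \<rho>': "is_rho \<gamma>' \<rho>'" and eq: "\<And>x. x \<in> {0..<1} \<Longrightarrow> \<gamma> x = \<gamma>' x"
  shows "\<rho> = \<rho>'"
proof -
  let ?\<Omega> = "{0..<1} :: real set"
  let ?E = "insert {} ((\<lambda>x. {0..x}) ` ?\<Omega>)"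
  let ?F = "\<lambda>n::nat. {0..1 - 1 / real (Suc n)}"
  have F: "(\<Union>n. ?F n) = ?\<Omega>"
  proof (intro set_eqI iffI)
    fix x :: real assume x: "x \<in> ?\<Omega>"
    then obtain n where "inverse (real (Suc n)) < 1 - x"
      using reals_Archimedean[of "1 - x"] by auto
    with x show "x \<in> (\<Union>n. ?F n)" by (auto simp: field_simps intro!: exI[of _ n])
  next
    fix x assume "x \<in> (\<Union>n. ?F n)"
    then obtain n where "0 \<le> x" "x \<le> 1 - 1 / real (Suc n)" by auto
    moreover have "0 < 1 / real (Suc n)" by simp
    ultimately have "0 \<le> x" "x < 1" by linarith+
    then show "x \<in> ?\<Omega>" by simp
  qed
  have Om: "?\<Omega> \<in> sigma_sets ?\<Omega> ?E" by (rule sigma_sets_top)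
  have B: "sets borel = sigma_sets UNIV (range (\<lambda>a::real. {..a}))"
    by (simp add: borel_eq_atMost)
  have "?\<Omega> \<in> sets borel" by simp
  then have "(\<inter>) ?\<Omega> ` sets borel = sigma_sets ?\<Omega> ((\<inter>) ?\<Omega> ` range (\<lambda>a::real. {..a}))"
    unfolding B by (intro sigma_sets_Int) auto
  then have "sets (restrict_space borel ?\<Omega>) = sigma_sets ?\<Omega> ((\<inter>) ?\<Omega> ` range (\<lambda>a::real. {..a}))"
    by (simp add: sets_restrict_space)
  also have "\<dots> = sigma_sets ?\<Omega> ?E"
  proof (rule sigma_sets_eqI)
    fix A assume "A \<in> (\<inter>) ?\<Omega> ` range (\<lambda>a::real. {..a})"
    then obtain a where A: "A = ?\<Omega> \<inter> {..a}" by auto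
    consider "a < 0" | "0 \<le> a" "a < 1" | "1 \<le> a" by linarith
    then show "A \<in> sigma_sets ?\<Omega> ?E"
    proof cases
      case 1
      then have "A = {}" using A by auto
      then show ?thesis by (simp add: sigma_sets.Empty)
    next
      case 2
      then have "A = {0..a}" using A by auto
      then show ?thesis using 2 by (auto intro!: sigma_sets.Basic)
    next
      case 3
      then have "A = ?\<Omega>" using A by auto
      then show ?thesis using Om by simp
    qed
  next
    fix A assume "A \<in> ?E"
    then consider "A = {}" | a where "a \<in> ?\<Omega>" "A = {0..a}" by auto
    then show "A \<in> sigma_sets ?\<Omega> ((\<inter>) ?\<Omega> ` range (\<lambda>a::real. {..a}))"
    proof cases
      case 1
      then show ?thesis by (simp add: sigma_sets.Empty)
    next
      case (2 a)
      then have "A = ?\<Omega> \<inter> {..a}" by auto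
      then show ?thesis by (auto intro!: sigma_sets.Basic)
    qed
  qed
  finally have S: "sets (restrict_space borel ?\<Omega>) = sigma_sets ?\<Omega> ?E" .
  show ?thesis
  proof (rule measure_eqI_generator_eq[where E = ?E and \<Omega> = ?\<Omega> and A = ?F])
    show "Int_stable ?E"
    proof (rule Int_stableI)
      fix A B assume "A \<in> ?E" "B \<in> ?E"
      then consider "A \<inter> B = {}" | a b where "a \<in> ?\<Omega>" "b \<in> ?\<Omega>" "A \<inter> B = {0..min a b}"
        by auto
      then show "A \<inter> B \<in> ?E"
      proof cases
        case (2 a b)
        then have "min a b \<in> ?\<Omega>" by (auto simp: min_def)
        then show ?thesis using 2(3) by blast
      qed simp
    qed
    show "?E \<subseteq> Pow ?\<Omega>" by auto
    show "emeasure \<rho> X = emeasure \<rho>' X" if "X \<in> ?E" for X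
      using that \<rho> \<rho>' eq by (auto simp: is_rho_def)
    show "sets \<rho> = sigma_sets ?\<Omega> ?E" "sets \<rho>' = sigma_sets ?\<Omega> ?E"
      using \<rho> \<rho>' S by (simp_all add: is_rho_def)
    show "range ?F \<subseteq> ?E" by (auto simp: field_simps)
    show "(\<Union>n. ?F n) = ?\<Omega>" by (rule F)
    show "emeasure \<rho> (?F n) \<noteq> \<infinity>" for n
      using \<rho> by (simp add: is_rho_def field_simps)
  qed
qed

text \<open>\<open>\<rho>\<close> is the image of Lebesgue measure under the generalized inverse of \<open>\<gamma>\<close>.\<close>

lemma is_rho_exists:
  assumes \<gamma>: "\<gamma> \<in> parisi_densities"
  shows "\<exists>\<rho>. is_rho \<gamma> \<rho>"
proof -
  define T where "T = {t. 0 < t \<and> (\<exists>x\<in>{0..<1}. t \<le> \<gamma> x)}"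
  define S where "S t = {x\<in>{0..<1}. t \<le> \<gamma> x}" for t
  define h where "h t = Inf (S t)" for t
  have mono: "\<gamma> x \<le> \<gamma> y" if "0 \<le> x" "x \<le> y" "y < 1" for x y
    using \<gamma> that by (auto simp: parisi_densities_def mono_on_def)
  have bdd: "bdd_below (S t)" for t by (rule bdd_belowI[of _ 0]) (auto simp: S_def)
  have h01: "h t \<in> {0..<1}" if "t \<in> T" for t
  proof -
    from that obtain x where x: "x \<in> S t" by (auto simp: T_def S_def)
    have "0 \<le> h t" unfolding h_def using x by (intro cInf_greatest) (auto simp: S_def)
    moreover have "h t \<le> x" unfolding h_def by (rule cInf_lower[OF x bdd])
    ultimately show ?thesis using x by (auto simp: S_def)
  qed
  have h\<gamma>: "t \<le> \<gamma> (h t)" if t: "t \<in> T" for t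
  proof -
    have ev: "t \<le> \<gamma> y" if y: "h t < y" "y < 1" for y
    proof -
      have "S t \<noteq> {}" using t by (auto simp: T_def S_def)
      then obtain s where "s \<in> S t" "s < y"
        using y bdd by (auto simp: h_def cInf_less_iff)
      then show ?thesis using mono[of s y] y by (auto simp: S_def)
    qed
    have "(\<gamma> \<longlongrightarrow> \<gamma> (h t)) (at_right (h t))"
      using \<gamma> h01[OF t] by (auto simp: parisi_densities_def continuous_within)
    moreover have "\<forall>\<^sub>F y in at_right (h t). t \<le> \<gamma> y"
      using h01[OF t] ev by (auto simp: eventually_at_right intro!: exI[of _ 1])
    ultimately show ?thesis by (rule tendsto_lowerbound) simp
  qed
  have h_le: "h t \<le> x \<longleftrightarrow> t \<le> \<gamma> x" if "t \<in> T" "x \<in> {0..<1}" for t x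
  proof
    assume "h t \<le> x"
    then show "t \<le> \<gamma> x" using h\<gamma>[OF that(1)] mono[of "h t" x] h01[OF that(1)] that(2) by auto
  next
    assume "t \<le> \<gamma> x"
    then show "h t \<le> x" unfolding h_def using that(2) bdd
      by (intro cInf_lower) (auto simp: S_def)
  qed
  have "is_interval T"
    unfolding is_interval_1 T_def by (auto intro: order_trans)
  then have T [measurable]: "T \<in> sets borel"
    by (simp add: is_interval_convex real_interval_borel_measurable)
  have "mono_on T h"
  proof (rule mono_onI)
    fix s t assume st: "s \<in> T" "t \<in> T" "s \<le> t"
    then have "s \<le> \<gamma> (h t)" using h\<gamma>[of t] by simp
    then show "h s \<le> h t" using h_le[of s "h t"] h01 st by auto
  qed
  then have "h \<in> borel_measurable (restrict_space borel T)"
    by (rule borel_measurable_mono_on_fnc)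
  then have h: "h \<in> measurable (restrict_space lborel T) (restrict_space borel {0..<1})"
    using h01
    by (intro measurable_restrict_space2)
       (auto simp: space_restrict_space cong: measurable_cong_sets sets_restrict_space_cong)
  let ?\<rho> = "distr (restrict_space lborel T) (restrict_space borel {0..<1}) h"
  have "emeasure ?\<rho> {0..x} = ennreal (\<gamma> x)" if x: "x \<in> {0..<1}" for x
  proof -
    have "emeasure ?\<rho> {0..x} = emeasure (restrict_space lborel T) (h -` {0..x} \<inter> T)"
      using h x by (subst emeasure_distr) (auto simp: sets_restrict_space_iff space_restrict_space)
    also have "h -` {0..x} \<inter> T = {0<..\<gamma> x}"
    proof -
      have "t \<in> T" if "0 < t" "t \<le> \<gamma> x" for t
        using that x by (auto simp: T_def)
      moreover have "0 < t" if "t \<in> T" for t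
        using that by (simp add: T_def)
      ultimately show ?thesis
        using h01 h_le[OF _ x] by auto
    qed
    also have "emeasure (restrict_space lborel T) \<dots> = emeasure lborel {0<..\<gamma> x}"
      using x T by (intro emeasure_restrict_space) (auto simp: T_def)
    also have "\<dots> = ennreal (\<gamma> x)"
      using \<gamma> x by (simp add: parisi_densities_def)
    finally show ?thesis .
  qed
  then have "is_rho \<gamma> ?\<rho>" by (simp add: is_rho_def)
  then show ?thesis ..
qed

lemma parisi_support_nu_measure:
  assumes "\<gamma> \<in> parisi_densities" "0 < \<Delta>" "is_rho \<gamma> \<rho>"
  shows "parisi_support (nu_measure \<gamma> \<Delta>) = measure_support \<rho> \<union> {1}"
proof -
  have "\<rho>' = \<rho>" if "\<gamma>' \<in> parisi_densities" "nu_measure \<gamma> \<Delta> = nu_measure \<gamma>' \<Delta>'" "is_rho \<gamma>' \<rho>'"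
    for \<gamma>' \<Delta>' \<rho>'
    using is_rho_unique[OF that(3) assms(3)] parisi_densities_unique[OF assms(1) that(1,2)] by metis
  then show ?thesis
    unfolding parisi_support_def using assms by blast
qed


section \<open>\<open>k\<close>-RSB and \<open>k\<close>-FRSB\<close>

definition k_RSB :: "nat \<Rightarrow> real measure \<Rightarrow> bool" where
  "k_RSB k \<nu> \<longleftrightarrow>
     (if k = 0 then \<exists>\<Delta>>0. \<nu> = nu_measure (\<lambda>x. 0) \<Delta>
      else \<exists>q m \<Delta>. q 0 = 0 \<and> q k = 1 \<and> strict_mono_on {0..k} q \<and>
             0 < m 1 \<and> strict_mono_on {1..k} m \<and> 0 < \<Delta> \<and>
             \<nu> = nu_measure (\<lambda>x. \<Sum>i=1..k. m i * indicator {q (i - 1)..<q i} x) \<Delta>)"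

text \<open>The function \<open>\<omega>\<close> only enters through its values on the intervals
  \<open>[q\<^sup>j\<^bsub>w\<^sub>j\<^esub>, q\<^sup>j\<^sup>+\<^sup>1\<^bsub>w\<^sub>j\<^esub>)\<close>, so the condition that it is strictly increasing is imposed on
  their union. It is nonnegative there because \<open>\<nu>\<close> is a (nonnegative) measure; this has to be said
  since \<^const>\<open>nu_measure\<close> would replace negative density values by zero.\<close>

definition k_FRSB :: "nat \<Rightarrow> real measure \<Rightarrow> bool" where
  "k_FRSB k \<nu> \<longleftrightarrow> 0 < k \<and>
     (\<exists>(t::nat) (s::nat \<Rightarrow> nat) (w::nat \<Rightarrow> nat) (q::nat \<Rightarrow> nat \<Rightarrow> real) (m::nat \<Rightarrow> real)
        (\<omega>::real \<Rightarrow> real) (\<Delta>::real) (I::real set).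
        1 \<le> t \<and> t \<le> k + 1 \<and> (\<Sum>i=1..t. s i) = k \<and> (\<forall>j. w j = (\<Sum>i=1..j. s i)) \<and>
        (\<forall>j\<in>{1..t}. \<forall>l\<in>{w (j - 1)..w j}. q j l \<in> {0..1}) \<and>
        (\<forall>j\<in>{1..t}. strict_mono_on {w (j - 1)..w j} (q j)) \<and>
        (\<forall>j\<in>{2..t}. q (j - 1) (w (j - 1)) < q j (w (j - 1))) \<and>
        q 1 0 = 0 \<and> q t (w t) = 1 \<and>
        0 < m 1 \<and> strict_mono_on {1..k} m \<and>
        I = (\<Union>j\<in>{1..<t}. {q j (w j)..<q (j + 1) (w j)}) \<and>
        strict_mono_on I \<omega> \<and> (\<forall>x\<in>I. 0 \<le> \<omega> x) \<and> 0 < \<Delta> \<and>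
        \<nu> = nu_measure (\<lambda>x.
              (\<Sum>j=1..t. \<Sum>l=w (j - 1) + 1..w j. m l * indicator {q j (l - 1)..<q j l} x) +
              (\<Sum>j=1..<t. \<omega> x * indicator {q j (w j)..<q (j + 1) (w j)} x)) \<Delta>)"

end

theory Submission
  imports Defs "HOL-Computational_Algebra.Polynomial"
begin

text \<open>Write \<open>\<nu>\<close> as \<open>\<gamma> dx + \<Delta> \<delta>\<^sub>1\<close> and put \<open>N(x) = \<nu>((x,1])\<close>. The functional is convex, so a minimizer is
described by first-order conditions (\<open>first_order_condition\<close>). With
\<open>g(u) = \<xi>'(u) - \<integral>\<^sub>0\<^sup>u N\<^sup>-\<^sup>2\<close> and \<open>G(u) = \<integral>\<^sub>u\<^sup>1 g\<close> they say: \<open>G \<ge> 0\<close>, \<open>g(1) = 0\<close>, and \<open>G = 0\<close> wherever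
\<open>\<gamma>\<close> grows. As \<open>G' = -g\<close> and \<open>G\<close> is minimal at these points, also \<open>g = 0\<close> there.

Consider a plateau \<open>[a,b)\<close> of \<open>\<gamma>\<close>, at height \<open>m\<close>. There \<open>N\<close> is affine with slope \<open>-m\<close>, and \<open>G\<close> is
nonnegative and vanishes together with \<open>G'\<close> at both ends. As \<open>G'' = N\<^sup>-\<^sup>2 - \<xi>''\<close>, the function
\<open>f = (\<xi>'')\<^sup>-\<^sup>1\<^sup>/\<^sup>2\<close> is above, below and again above \<open>N\<close> on the plateau, so \<open>f'\<close> takes a value below
\<open>-m\<close> and later a value above \<open>-m\<close> (\<open>plateau_slopes\<close>). The heights increase from one plateau to the
next, so \<open>k\<close> plateaus force \<open>f''\<close> to be alternately positive and negative at \<open>2k - 1\<close> points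
(\<open>plateau_count\<close>).

Up to a positive factor, \<open>f''\<close> is \<open>-(Z Z'' - 3/2 Z'\<^sup>2)\<close> with \<open>Z = \<xi>''\<close>, a polynomial that has at
most \<open>n\<close> monomials, all with positive coefficients and positive exponents. Such an expression
alternates at no more than \<open>2n - 1\<close> points (\<open>alternates_curvature_bound\<close>): dividing it by \<open>Z''\<close>
and differentiating gives an expression of the same kind for \<open>Z'\<close>, and Rolle's theorem loses a
sign change only when the exponent of a monomial drops from \<open>1\<close> to \<open>0\<close> or when the constant term
disappears, hence at most twice for each monomial except the last. Descartes' rule of signs, applied
to the expanded product, would only give a bound quadratic in \<open>n\<close>.

Hence \<open>\<gamma>\<close> has at most \<open>n\<close> plateaus. It is strictly increasing between them, and it starts with a
plateau, because \<open>\<xi>''(0) = 0\<close> makes \<open>G\<close> positive immediately to the right of \<open>0\<close>; a height \<open>0\<close> of this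
plateau is excluded by the convexity of \<open>\<xi>'\<close> (\<open>initial_level_pos\<close>). Grouping adjacent plateaus
gives the \<open>k\<close>-FRSB form. An isolated point of the support other than \<open>1\<close> is the left end of a plateau.\<close>

section \<open>Sign changes of \<open>Z Z'' - (1 + r) Z'\<^sup>2\<close>\<close>

text \<open>Sign changes are counted by chains of points at which the function is strictly positive and strictly
negative in turn, as such chains pass to derivatives by the mean value theorem without any discussion
of zeros. The factor \<open>s\<close> fixes the first sign.\<close>

definition alternates :: "(real \<Rightarrow> real) \<Rightarrow> nat \<Rightarrow> bool" where
  "alternates F l \<longleftrightarrow> (\<exists>z s. (0 < l \<longrightarrow> 0 < z 0) \<and> (\<forall>j. Suc j < l \<longrightarrow> z j < z (Suc j)) \<and>
     (\<forall>j<l. 0 < s * (- 1) ^ j * F (z j)))"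

text \<open>Up to a negative factor this is the second derivative of \<open>Z\<^sup>-\<^sup>r\<close>.\<close>

definition curvature :: "real \<Rightarrow> real poly \<Rightarrow> real \<Rightarrow> real" where
  "curvature r Z x = poly Z x * poly (pderiv (pderiv Z)) x - (1 + r) * (poly (pderiv Z) x)\<^sup>2"

definition exponents :: "real poly \<Rightarrow> nat set" where
  "exponents Z = {i. coeff Z i \<noteq> 0}"

lemma finite_exponents: "finite (exponents Z)"
proof -
  have "exponents Z \<subseteq> {..degree Z}" by (auto simp: exponents_def le_degree)
  then show ?thesis by (rule finite_subset) simp
qed

lemma exponents_pderiv: "Suc ` exponents (pderiv Z) = exponents Z - {0}"
  by (auto simp: exponents_def coeff_pderiv image_iff) (metis not0_implies_Suc)

lemma card_exponents_pderiv:
  "card (exponents Z) = card (exponents (pderiv Z)) + (if coeff Z 0 = 0 then 0 else 1)"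
proof -
  have "card (exponents (pderiv Z)) = card (exponents Z - {0})"
    unfolding exponents_pderiv[symmetric] by (simp add: card_image)
  moreover have "card (exponents Z) = Suc (card (exponents Z - {0}))" if "0 \<in> exponents Z"
    using finite_exponents that by (rule card.remove)
  ultimately show ?thesis by (auto simp: exponents_def)
qed

lemma poly_nonneg_coeff_mono:
  fixes P Q :: "real poly"
  assumes "\<And>i. coeff P i \<le> coeff Q i" "0 \<le> x"
  shows "poly P x \<le> poly Q x"
proof -
  let ?d = "max (degree P) (degree Q)"
  have "poly P x = (\<Sum>i\<le>?d. coeff P i * x ^ i)" "poly Q x = (\<Sum>i\<le>?d. coeff Q i * x ^ i)"
    unfolding poly_altdef by (intro sum.mono_neutral_left; auto simp: coeff_eq_0)+
  then show ?thesis using assms by (auto intro!: sum_mono mult_right_mono)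
qed

lemma poly_pos:
  fixes P :: "real poly"
  assumes nn: "\<And>i. 0 \<le> coeff P i" and "P \<noteq> 0" "0 < x"
  shows "0 < poly P x"
proof -
  have "0 < lead_coeff P * x ^ degree P"
    using nn[of "degree P"] assms(2,3) leading_coeff_0_iff[of P] by (intro mult_pos_pos zero_less_power) linarith+
  also have "\<dots> \<le> (\<Sum>i\<le>degree P. coeff P i * x ^ i)"
    using assms by (intro member_le_sum[of "degree P" _ "\<lambda>i. coeff P i * x ^ i"]) auto
  finally show ?thesis by (simp add: poly_altdef)
qed

lemma sign_chain_mvt:
  fixes K K' :: "real \<Rightarrow> real"
  assumes K: "\<And>x. 0 < x \<Longrightarrow> (K has_real_derivative K' x) (at x)"
    and xy: "0 < x" "x < y" and s: "s * K x < s * K y"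
  shows "\<exists>z. x < z \<and> z < y \<and> 0 < s * K' z"
proof -
  obtain z where z: "x < z" "z < y" "K y - K x = (y - x) * K' z"
    using MVT2[of x y K K'] K xy by auto
  have "0 < (y - x) * (s * K' z)"
    using z(3) s by (metis diff_gt_0_iff_gt mult.left_commute right_diff_distrib)
  then have "0 < s * K' z"
    using xy by (simp add: zero_less_mult_iff)
  then show ?thesis using z by blast
qed

text \<open>Between two consecutive points of the chain the mean value theorem yields a point for \<open>K'\<close>, with the
sign of \<open>K\<close> at the right one. If \<open>K\<close> tends to \<open>0\<close> at the left end of the half-line, then \<open>0\<close> serves as one more point,
and nothing is lost.\<close>

lemma alternates_derivative:
  fixes K K' :: "real \<Rightarrow> real"
  assumes K: "\<And>x. 0 < x \<Longrightarrow> (K has_real_derivative K' x) (at x)"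
    and "alternates K l"
  shows "alternates K' (l - 1)"
    and "(K \<longlongrightarrow> 0) (at_right 0) \<Longrightarrow> alternates K' l"
proof -
  obtain z s where z0: "0 < l \<Longrightarrow> 0 < z 0" and z: "\<And>j. Suc j < l \<Longrightarrow> z j < z (Suc j)"
    and s: "\<And>j. j < l \<Longrightarrow> 0 < s * (- 1) ^ j * K (z j)"
    using assms(2) unfolding alternates_def by auto
  have zpos: "0 < z j" if "j < l" for j
    using that by (induction j) (use z0 z in \<open>auto intro: less_trans\<close>)
  have "\<exists>y. z j < y \<and> y < z (Suc j) \<and> 0 < (s * (- 1) ^ Suc j) * K' y" if j: "j < l - 1" for j
  proof (rule sign_chain_mvt[OF K])
    have *: "0 < s * (- 1) ^ j * K (z j)" "0 < s * (- 1) ^ Suc j * K (z (Suc j))"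
      using s[of j] s[of "Suc j"] j by auto
    then show "s * (- 1) ^ Suc j * K (z j) < s * (- 1) ^ Suc j * K (z (Suc j))"
      by simp
    show "0 < z j" "z j < z (Suc j)" using zpos z j by auto
  qed
  then obtain y where y: "\<And>j. j < l - 1 \<Longrightarrow> z j < y j \<and> y j < z (Suc j) \<and> 0 < (s * (- 1) ^ Suc j) * K' (y j)"
    by metis
  have ymono: "y j < y (Suc j)" if "Suc j < l - 1" for j
    using y[of j] y[of "Suc j"] that by auto
  show "alternates K' (l - 1)"
    unfolding alternates_def
  proof (intro exI conjI allI impI)
    show "0 < y 0" if "0 < l - 1" using y[OF that] z0 that by auto
    show "y j < y (Suc j)" if "Suc j < l - 1" for j using ymono that .
    show "0 < (- s) * (- 1) ^ j * K' (y j)" if "j < l - 1" for j using y[OF that] by simp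
  qed
  show "alternates K' l" if lim: "(K \<longlongrightarrow> 0) (at_right 0)"
  proof (cases "l = 0")
    case True
    then show ?thesis by (simp add: alternates_def)
  next
    case False
    have K0: "0 < s * K (z 0)" using s[of 0] False by simp
    have "((\<lambda>x. s * K x) \<longlongrightarrow> s * 0) (at_right 0)" by (intro tendsto_intros lim)
    then have "\<forall>\<^sub>F x in at_right 0. s * K x < s * K (z 0)"
      using K0 by (intro order_tendstoD(2)) auto
    moreover have "\<forall>\<^sub>F x in at_right 0. x < z 0"
      using z0 False by (auto simp: eventually_at_right)
    moreover have "\<forall>\<^sub>F x in at_right (0::real). 0 < x" by (simp add: eventually_at_right_less)
    ultimately have "\<forall>\<^sub>F x in at_right 0. s * K x < s * K (z 0) \<and> x < z 0 \<and> 0 < x"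
      by eventually_elim auto
    then obtain x where "s * K x < s * K (z 0)" "x < z 0" "0 < x"
      using eventually_happens'[OF trivial_limit_at_right_real] by blast
    then obtain w where w: "0 < w" "w < z 0" "0 < s * K' w"
      using sign_chain_mvt[of K K' x "z 0" s] K by (meson less_trans)
    \<comment> \<open>The additional point to the left of all the others.\<close>
    define y' where "y' j = (case j of 0 \<Rightarrow> w | Suc i \<Rightarrow> y i)" for j
    show ?thesis
      unfolding alternates_def
    proof (intro exI conjI allI impI)
      show "0 < y' 0" using w by (simp add: y'_def)
      show "y' j < y' (Suc j)" if "Suc j < l" for j
        using that w y[of 0] ymono by (cases j) (auto simp: y'_def)
      show "0 < s * (- 1) ^ j * K' (y' j)" if "j < l" for j
        using that w y by (cases j) (auto simp: y'_def)
    qed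
  qed
qed

lemma alternates_cong_neg:
  assumes "alternates F l" and "\<And>x. 0 < x \<Longrightarrow> sgn (G x) = - sgn (F x)"
  shows "alternates G l"
proof -
  obtain z s where z0: "0 < l \<Longrightarrow> 0 < z 0" and z: "\<And>j. Suc j < l \<Longrightarrow> z j < z (Suc j)"
    and s: "\<And>j. j < l \<Longrightarrow> 0 < s * (- 1) ^ j * F (z j)"
    using assms(1) unfolding alternates_def by auto
  have zpos: "0 < z j" if "j < l" for j
    using that by (induction j) (use z0 z in \<open>auto intro: less_trans\<close>)
  have "0 < (- s) * (- 1) ^ j * G (z j)" if "j < l" for j
  proof -
    have "sgn ((- s) * (- 1) ^ j * G (z j)) = sgn (s * (- 1) ^ j * F (z j))"
      using assms(2)[OF zpos[OF that]] by (simp add: sgn_mult)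
    then show ?thesis using s[OF that] by (metis sgn_greater)
  qed
  then show ?thesis unfolding alternates_def using z0 z by blast
qed

text \<open>The identity behind the induction: for \<open>K = (1 + r) Z'\<^sup>2 / Z'' - Z\<close>, which has the sign of
\<open>- curvature r Z\<close>, the derivative \<open>K'\<close> is a negative multiple of \<open>curvature r' Z'\<close> with
\<open>r' = r / (1 + r)\<close>. If \<open>Z\<close> has neither a constant nor a linear term, then \<open>K(x)\<close> tends to \<open>0\<close> as
\<open>x\<close> does, so that \<open>Z\<close> has no longer chains than \<open>Z'\<close>. Otherwise one sign change may be lost. This
happens once while the lowest monomial is linear and once while it is constant, after which it
disappears; thus each monomial below the last one costs two.\<close>

lemma alternates_curvature_bound:
  assumes "\<And>i. 0 \<le> coeff Z i" "Z \<noteq> 0" "0 < r" "alternates (curvature r Z) l"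
  shows "l + (if coeff Z 0 = 0 then 1 else 2) \<le> 2 * card (exponents Z)"
  using assms
proof (induction "degree Z" arbitrary: Z r l)
  case 0
  then obtain c where c: "Z = [:c:]" by (metis degree_eq_zeroE)
  then have "curvature r Z x = 0" for x by (simp add: curvature_def pderiv_pCons)
  then have "l = 0" using "0.prems"(4) by (auto simp: alternates_def)
  moreover have "c \<noteq> 0" "exponents Z = {0}"
    using "0.prems"(2) c by (auto simp: exponents_def coeff_pCons split: nat.splits) (metis not0_implies_Suc)
  ultimately show ?case using c by simp
next
  case (Suc d)
  define Y where "Y = pderiv Z"
  have Ynn: "0 \<le> coeff Y i" for i using Suc.prems(1) by (simp add: Y_def coeff_pderiv)
  have degY: "degree Y = d" using Suc.hyps(2) by (simp add: Y_def degree_pderiv)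
  have Y0: "Y \<noteq> 0" using Suc.hyps(2) by (metis Y_def pderiv_eq_0_iff nat.distinct(1))
  have cY: "card (exponents Z) = card (exponents Y) + (if coeff Z 0 = 0 then 0 else 1)"
    unfolding Y_def by (rule card_exponents_pderiv)
  have Ypos: "0 < poly Y x" if "0 < x" for x using poly_pos[OF Ynn Y0 that] .
  have cY1: "0 < card (exponents Y)"
    using leading_coeff_0_iff[of Y] Y0 finite_exponents[of Y] unfolding card_gt_0_iff exponents_def by blast
  show ?case
  proof (cases "d = 0")
    case True
    then obtain c where c: "Y = [:c:]" by (metis degY degree_eq_zeroE)
    have neg: "curvature r Z x < 0" if "0 < x" for x
    proof -
      have "curvature r Z x = - ((1 + r) * (poly Y x)\<^sup>2)"
        unfolding curvature_def Y_def[symmetric] by (simp add: c pderiv_pCons)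
      moreover have "0 < (1 + r) * (poly Y x)\<^sup>2"
        using Ypos[OF that] Suc.prems(3) by (intro mult_pos_pos zero_less_power) linarith+
      ultimately show ?thesis by linarith
    qed
    have "l \<le> 1"
    proof (rule ccontr)
      assume l: "\<not> l \<le> 1"
      obtain z s where "0 < l \<longrightarrow> 0 < z 0" "\<forall>j. Suc j < l \<longrightarrow> z j < z (Suc j)"
        and s: "\<And>j. j < l \<Longrightarrow> 0 < s * (- 1) ^ j * curvature r Z (z j)"
        using Suc.prems(4) unfolding alternates_def by auto
      then have z: "0 < z 0" "z 0 < z (Suc 0)" using l by auto
      have "curvature r Z (z 0) < 0" "curvature r Z (z (Suc 0)) < 0" using neg z by auto
      then show False using s[of 0] s[of "Suc 0"] l
        by (simp add: zero_less_mult_iff mult_less_0_iff)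
    qed
    then show ?thesis using cY1 cY by auto
  next
    case False
    define U where "U = pderiv Y"
    have Unn: "0 \<le> coeff U i" for i using Ynn by (simp add: U_def coeff_pderiv)
    have U0: "U \<noteq> 0" using False degY by (simp add: U_def pderiv_eq_0_iff)
    have Upos: "0 < poly U x" if "0 < x" for x using poly_pos[OF Unn U0 that] .
    define r' where "r' = r / (1 + r)"
    have r': "0 < r'" using Suc.prems(3) by (simp add: r'_def)
    define K where "K x = (1 + r) * (poly Y x)\<^sup>2 / poly U x - poly Z x" for x
    define K' where "K' x = - (1 + r) * (poly Y x / (poly U x)\<^sup>2) * curvature r' Y x" for x
    have dK: "(K has_real_derivative K' x) (at x)" if "0 < x" for x
    proof -
      have U: "poly U x \<noteq> 0" using Upos[OF that] by simp
      have rr: "(1 + r) * (1 + r') = 1 + 2 * r" using Suc.prems(3) by (simp add: r'_def field_simps)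
      have "(K has_real_derivative ((1 + r) * (2 * poly Y x * poly U x) * poly U x -
          (1 + r) * (poly Y x)\<^sup>2 * poly (pderiv U) x) / (poly U x * poly U x) - poly Y x) (at x)"
        unfolding K_def using U
        by (auto intro!: derivative_eq_intros simp: U_def Y_def power2_eq_square)
      also have "((1 + r) * (2 * poly Y x * poly U x) * poly U x -
          (1 + r) * (poly Y x)\<^sup>2 * poly (pderiv U) x) / (poly U x * poly U x) - poly Y x =
          (poly Y x / (poly U x)\<^sup>2) * ((1 + 2 * r) * (poly U x)\<^sup>2 - (1 + r) * (poly Y x * poly (pderiv U) x))"
        using U by (simp add: field_simps power2_eq_square)
      also have "\<dots> = K' x"
      proof -
        have "A * ((1 + r) * (1 + r') * u - (1 + r) * v) = - (1 + r) * A * (v - (1 + r') * u)" for A u v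
          by (simp add: algebra_simps)
        then show ?thesis unfolding K'_def curvature_def U_def[symmetric] rr[symmetric] .
      qed
      finally show ?thesis .
    qed
    have "sgn (K x) = - sgn (curvature r Z x)" if "0 < x" for x
    proof -
      have "curvature r Z x = - (poly U x * K x)"
        using Upos[OF that] by (simp add: curvature_def K_def field_simps flip: Y_def U_def)
      then show ?thesis using Upos[OF that] by (simp add: sgn_mult)
    qed
    then have altK: "alternates K l" using Suc.prems(4) alternates_cong_neg by blast
    have sK': "sgn (curvature r' Y x) = - sgn (K' x)" if "0 < x" for x
      using Upos[OF that] Ypos[OF that] Suc.prems(3) by (simp add: K'_def sgn_mult sgn_divide)
    note IH = Suc.hyps(1)[OF degY[symmetric] Ynn Y0 r']
    have 1: "l - 1 + (if coeff Y 0 = 0 then 1 else 2) \<le> 2 * card (exponents Y)"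
      by (intro IH alternates_cong_neg[OF alternates_derivative(1)[OF dK altK] sK'])
    show ?thesis
    proof (cases "coeff Z 0 = 0")
      case Z0: False
      then have "card (exponents Z) = Suc (card (exponents Y))"
        using cY by simp
      then show ?thesis using 1 Z0 by (auto split: if_splits)
    next
      case Z0: True
      then have eq: "card (exponents Z) = card (exponents Y)" using cY by simp
      show ?thesis
      proof (cases "coeff Y 0 = 0")
        case False
        then show ?thesis using 1 Z0 eq by (auto split: if_splits)
      next
        case Y00: True
        have le: "poly Y x \<le> x * poly U x" if "0 < x" for x
        proof -
          have "poly Y x \<le> poly (pCons 0 U) x"
          proof (rule poly_nonneg_coeff_mono)
            \<comment> \<open>The coefficients of \<open>x Y'(x)\<close> are \<open>i\<close> times those of \<open>Y\<close>, and \<open>Y\<close> has no constant term.\<close>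
            show "coeff Y i \<le> coeff (pCons 0 U) i" for i
            proof (cases i)
              case (Suc j)
              have "coeff Y (Suc j) \<le> real (Suc j) * coeff Y (Suc j)"
                using Ynn[of "Suc j"] by (simp add: mult_le_cancel_right1)
              then show ?thesis using Suc by (simp add: U_def coeff_pderiv)
            qed (use Y00 in simp)
          qed (use that in simp)
          then show ?thesis by simp
        qed
        have "(K \<longlongrightarrow> 0) (at_right 0)"
        proof (rule tendsto_sandwich)
          show "\<forall>\<^sub>F x in at_right 0. - poly Z x \<le> K x"
          proof (rule eventually_mono[OF eventually_at_right_less])
            fix x :: real assume x: "0 < x"
            have "0 \<le> (1 + r) * (poly Y x)\<^sup>2 / poly U x"
              using Upos[OF x] Suc.prems(3) by (intro divide_nonneg_pos mult_nonneg_nonneg) simp_all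
            then show "- poly Z x \<le> K x" by (simp add: K_def)
          qed
          show "\<forall>\<^sub>F x in at_right 0. K x \<le> (1 + r) * (x * poly Y x) - poly Z x"
          proof (rule eventually_mono[OF eventually_at_right_less])
            fix x :: real assume x: "0 < x"
            have "(poly Y x)\<^sup>2 \<le> (x * poly U x) * poly Y x"
              unfolding power2_eq_square using le[OF x] Ypos[OF x] by (intro mult_right_mono) auto
            then have "(poly Y x)\<^sup>2 / poly U x \<le> x * poly Y x"
              using Upos[OF x] by (simp add: field_simps)
            then show "K x \<le> (1 + r) * (x * poly Y x) - poly Z x"
              using mult_left_mono[of "(poly Y x)\<^sup>2 / poly U x" "x * poly Y x" "1 + r"] Suc.prems(3)
              by (simp add: K_def)
          qed
          have P: "(poly P \<longlongrightarrow> poly P 0) (at_right 0)" for P :: "real poly"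
            by (intro tendsto_intros)
          have "((\<lambda>x. - poly Z x) \<longlongrightarrow> - poly Z 0) (at_right 0)"
            by (intro tendsto_intros)
          then show "((\<lambda>x. - poly Z x) \<longlongrightarrow> 0) (at_right 0)" using Z0 by (simp add: poly_0_coeff_0)
          have "((\<lambda>x. (1 + r) * (x * poly Y x) - poly Z x) \<longlongrightarrow> (1 + r) * (0 * poly Y 0) - poly Z 0) (at_right 0)"
            by (intro tendsto_intros)
          then show "((\<lambda>x. (1 + r) * (x * poly Y x) - poly Z x) \<longlongrightarrow> 0) (at_right 0)"
            using Z0 by (simp add: poly_0_coeff_0)
        qed
        then have "l + (if coeff Y 0 = 0 then 1 else 2) \<le> 2 * card (exponents Y)"
          by (intro IH alternates_cong_neg[OF alternates_derivative(2)[OF dK altK] sK'])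
        then show ?thesis using Y00 Z0 eq by simp
      qed
    qed
  qed
qed

section \<open>The functional in terms of real integrals\<close>

lemma nn_integral_nu_measure:
  assumes \<gamma>: "\<gamma> \<in> parisi_densities" and h: "h \<in> borel_measurable borel"
  shows "(\<integral>\<^sup>+x. h x \<partial>nu_measure \<gamma> \<Delta>) =
    (\<integral>\<^sup>+x\<in>{0..<1}. ennreal (\<gamma> x) * h x \<partial>lborel) + ennreal \<Delta> * h 1"
proof -
  let ?d = "\<lambda>x. ennreal (\<gamma> x) * indicator {0..<1} x"
  let ?D = "density lborel ?d"
  note d = parisi_densities_measurable[OF \<gamma>]
  have "(\<integral>\<^sup>+x. h x \<partial>nu_measure \<gamma> \<Delta>) = (\<integral>\<^sup>+x. h x \<partial>?D) + ennreal \<Delta> * h 1"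
    using h
  proof (induction rule: borel_measurable_induct)
    case (cong f g)
    then show ?case by (simp cong: nn_integral_cong)
  next
    case (set A)
    then show ?case by (simp add: emeasure_nu_measure_density)
  next
    case (mult u c)
    then have "u \<in> borel_measurable (nu_measure \<gamma> \<Delta>)" "u \<in> borel_measurable ?D"
      by (simp_all cong: measurable_cong_sets)
    with mult show ?case by (simp add: nn_integral_cmult distrib_left ac_simps)
  next
    case (add u v)
    then have "u \<in> borel_measurable (nu_measure \<gamma> \<Delta>)" "u \<in> borel_measurable ?D"
       "v \<in> borel_measurable (nu_measure \<gamma> \<Delta>)" "v \<in> borel_measurable ?D"
      by (simp_all cong: measurable_cong_sets)
    with add show ?case by (simp add: nn_integral_add distrib_left ac_simps)
  next
    case (seq U)
    then have "\<And>i. U i \<in> borel_measurable (nu_measure \<gamma> \<Delta>)" "\<And>i. U i \<in> borel_measurable ?D"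
      by (simp_all cong: measurable_cong_sets)
    moreover have "incseq (\<lambda>i. \<integral>\<^sup>+x. U i x \<partial>?D)" "incseq (\<lambda>i. ennreal \<Delta> * U i 1)"
      using \<open>incseq U\<close> by (auto simp: incseq_def le_fun_def intro!: nn_integral_mono mult_left_mono)
    moreover have "ennreal \<Delta> * (SUP i. U i 1) = (SUP i. ennreal \<Delta> * U i 1)"
      by (simp add: SUP_mult_left_ennreal)
    ultimately show ?case using seq
      by (simp add: nn_integral_monotone_convergence_SUP image_comp ennreal_SUP_add cong: nn_integral_cong)
  qed
  also have "(\<integral>\<^sup>+x. h x \<partial>?D) = (\<integral>\<^sup>+x. ?d x * h x \<partial>lborel)"
    using h d by (simp add: nn_integral_density)
  also have "\<dots> = (\<integral>\<^sup>+x\<in>{0..<1}. ennreal (\<gamma> x) * h x \<partial>lborel)"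
    by (simp add: ac_simps)
  finally show ?thesis .
qed

text \<open>Endpoints of the interval are free, because the density is only specified on \<open>[0,1)\<close> and its
value at \<open>1\<close> may be negative.\<close>

lemma nn_integral_eq_integral_upto_endpoints:
  fixes f :: "real \<Rightarrow> real"
  assumes S: "{a<..<b} \<subseteq> S" "S \<subseteq> {a..b}" and nn: "\<And>x. x \<in> S \<Longrightarrow> 0 \<le> f x"
    and f: "f integrable_on {a..b}"
  shows "(\<integral>\<^sup>+x\<in>S. ennreal (f x) \<partial>lborel) = ennreal (integral {a..b} f)" "0 \<le> integral {a..b} f"
proof -
  have "{a..b} - S \<subseteq> {a, b}" "S - {a..b} = {}" using S by (auto simp: subset_iff) (metis less_le)
  then have fin: "finite ({a..b} - S)" "finite (S - {a..b})"
    by (auto intro: finite_subset)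
  have "(f has_integral integral {a..b} f) S"
    using f fin
    by (subst has_integral_spike_set_eq[of _ "{a..b}"])
       (auto intro: negligible_subset[OF negligible_finite[OF fin(1)]] negligible_subset[OF negligible_finite[OF fin(2)]])
  from nn_integral_has_integral_lebesgue'[OF nn this] has_integral_nonneg[OF this nn]
  show "(\<integral>\<^sup>+x\<in>S. ennreal (f x) \<partial>lborel) = ennreal (integral {a..b} f)" "0 \<le> integral {a..b} f"
    by auto
qed

text \<open>This is \<open>\<nu>((x,1])\<close> for integrable \<open>\<gamma>\<close>, see \<open>emeasure_nu_measure_tail\<close>.\<close>

definition tail :: "(real \<Rightarrow> real) \<Rightarrow> real \<Rightarrow> real \<Rightarrow> real" where
  "tail \<gamma> \<Delta> x = \<Delta> + integral {x..1} \<gamma>"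

lemma parisi_densities_nonneg: "\<gamma> \<in> parisi_densities \<Longrightarrow> 0 \<le> x \<Longrightarrow> x < 1 \<Longrightarrow> 0 \<le> \<gamma> x"
  by (simp add: parisi_densities_def)

lemma parisi_densities_mono:
  "\<gamma> \<in> parisi_densities \<Longrightarrow> 0 \<le> x \<Longrightarrow> x \<le> y \<Longrightarrow> y < 1 \<Longrightarrow> \<gamma> x \<le> \<gamma> y"
  by (simp add: parisi_densities_def mono_on_def)

lemma continuous_on_tail:
  assumes "\<gamma> integrable_on {0..1}"
  shows "continuous_on {0..1} (tail \<gamma> \<Delta>)"
  unfolding tail_def by (intro continuous_intros indefinite_integral_continuous_1' assms)

lemma integral_density_nonneg:
  assumes "\<gamma> \<in> parisi_densities" "\<gamma> integrable_on {0..1}" "0 \<le> x" "x \<le> 1"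
  shows "0 \<le> integral {x..1} \<gamma>"
proof (rule nn_integral_eq_integral_upto_endpoints(2)[where S = "{x<..<1}"])
  show "\<gamma> integrable_on {x..1}" using assms(2) by (rule integrable_on_subinterval) (use assms(3) in auto)
  show "0 \<le> \<gamma> y" if "y \<in> {x<..<1}" for y
    using that assms(3) by (intro parisi_densities_nonneg[OF assms(1)]) auto
qed auto

lemma tail_ge:
  assumes "\<gamma> \<in> parisi_densities" "\<gamma> integrable_on {0..1}" "x \<in> {0..1}"
  shows "\<Delta> \<le> tail \<gamma> \<Delta> x"
  using integral_density_nonneg[of \<gamma> x] assms by (auto simp: tail_def)

lemma emeasure_nu_measure_tail:
  assumes "\<gamma> \<in> parisi_densities" "\<gamma> integrable_on {0..1}" "x \<in> {0..<1}" "0 < \<Delta>"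
  shows "emeasure (nu_measure \<gamma> \<Delta>) {x<..1} = ennreal (tail \<gamma> \<Delta> x)"
proof -
  have "{x<..1} \<inter> {0..<1} = {x<..<1}" using assms by auto
  moreover have "(\<integral>\<^sup>+y\<in>{x<..<1}. ennreal (\<gamma> y) \<partial>lborel) = ennreal (integral {x..1} \<gamma>)"
  proof (rule nn_integral_eq_integral_upto_endpoints(1))
    show "\<gamma> integrable_on {x..1}"
      using assms(2) by (rule integrable_on_subinterval) (use assms(3) in auto)
    show "0 \<le> \<gamma> y" if "y \<in> {x<..<1}" for y
      using that assms(3) by (intro parisi_densities_nonneg[OF assms(1)]) auto
  qed auto
  ultimately show ?thesis
    using assms integral_density_nonneg[of \<gamma> x]
    by (simp add: emeasure_nu_measure tail_def add.commute ennreal_plus[symmetric] del: ennreal_plus)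
qed

lemma density_absolutely_integrable:
  assumes \<gamma>: "\<gamma> \<in> parisi_densities" "\<gamma> integrable_on {0..1}"
  shows "\<gamma>(1 := 0) absolutely_integrable_on {0..1}"
proof (rule nonnegative_absolutely_integrable_1)
  show "\<gamma>(1 := 0) integrable_on {0..1}"
    by (rule integrable_spike_finite[OF _ _ \<gamma>(2), of "{1}"]) auto
  show "0 \<le> (\<gamma>(1 := 0)) x" if "x \<in> {0..1}" for x
    using that parisi_densities_nonneg[OF \<gamma>(1), of x] by auto
qed

lemma continuous_times_density_integrable:
  assumes \<gamma>: "\<gamma> \<in> parisi_densities" "\<gamma> integrable_on {0..1}"
    and \<phi>: "continuous_on {0..1} \<phi>"
  shows "(\<lambda>x. \<phi> x * \<gamma> x :: real) integrable_on {0..1}"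
proof -
  define \<gamma>0 where "\<gamma>0 = \<gamma>(1 := 0)"
  have "\<gamma>0 absolutely_integrable_on {0..1}"
    unfolding \<gamma>0_def by (rule density_absolutely_integrable[OF \<gamma>])
  then have "(\<lambda>x. \<phi> x * \<gamma>0 x) absolutely_integrable_on {0..1}"
    using \<phi> by (intro absolutely_integrable_bounded_measurable_product_real)
       (auto intro: compact_imp_bounded compact_continuous_image continuous_imp_measurable_on_sets_lebesgue)
  then have "(\<lambda>x. \<phi> x * \<gamma>0 x) integrable_on {0..1}"
    by (simp add: absolutely_integrable_on_def)
  then show ?thesis
    by (rule integrable_spike_finite[of "{1}", rotated 2]) (auto simp: \<gamma>0_def)
qed

lemma deriv_poly [simp]: "deriv (poly X) = poly (pderiv X)"
  by (rule ext) (rule DERIV_imp_deriv, rule poly_DERIV)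

text \<open>Twice the functional, as a real number.\<close>

definition zero_temp_cost :: "real poly \<Rightarrow> (real \<Rightarrow> real) \<Rightarrow> real \<Rightarrow> real" where
  "zero_temp_cost X \<gamma> \<Delta> = integral {0..1} (\<lambda>x. poly (pderiv X) x * \<gamma> x) + poly (pderiv X) 1 * \<Delta> +
     integral {0..1} (\<lambda>x. 1 / tail \<gamma> \<Delta> x)"

lemma continuous_on_inverse_tail:
  assumes "\<gamma> \<in> parisi_densities" "\<gamma> integrable_on {0..1}" "0 < \<Delta>"
  shows "continuous_on {0..1} (\<lambda>x. 1 / tail \<gamma> \<Delta> x)"
proof -
  have "0 < tail \<gamma> \<Delta> x" if "x \<in> {0..1}" for x
    using tail_ge[OF assms(1,2) that, of \<Delta>] assms(3) by linarith
  then show ?thesis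
    by (intro continuous_intros continuous_on_tail assms) force
qed

lemma parisi_functional_poly:
  fixes X :: "real poly"
  assumes \<gamma>: "\<gamma> \<in> parisi_densities" and \<Delta>: "0 < \<Delta>"
  shows "parisi_functional (poly X) (nu_measure \<gamma> \<Delta>) =
    ((\<integral>\<^sup>+x\<in>{0..<1}. ennreal (\<gamma> x) * ennreal (poly (pderiv X) x) \<partial>lborel) +
      ennreal \<Delta> * ennreal (poly (pderiv X) 1) +
      (\<integral>\<^sup>+x\<in>{0..<1}. 1 / emeasure (nu_measure \<gamma> \<Delta>) {x<..1} \<partial>lborel)) / 2"
proof -
  have "poly (pderiv X) \<in> borel_measurable borel"
    by (intro borel_measurable_continuous_onI continuous_intros)
  then have "(\<integral>\<^sup>+x\<in>{0..1}. ennreal (poly (pderiv X) x) \<partial>nu_measure \<gamma> \<Delta>) =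
    (\<integral>\<^sup>+x\<in>{0..<1}. ennreal (\<gamma> x) * (ennreal (poly (pderiv X) x) * indicator {0..1} x) \<partial>lborel) +
    ennreal \<Delta> * (ennreal (poly (pderiv X) 1) * indicator {0..1} (1::real))"
    by (intro nn_integral_nu_measure \<gamma> borel_measurable_times borel_measurable_indicator) simp_all
  also have "(\<integral>\<^sup>+x\<in>{0..<1}. ennreal (\<gamma> x) * (ennreal (poly (pderiv X) x) * indicator {0..1} x) \<partial>lborel) =
      (\<integral>\<^sup>+x\<in>{0..<1}. ennreal (\<gamma> x) * ennreal (poly (pderiv X) x) \<partial>lborel)"
    by (intro nn_integral_cong) (auto simp: indicator_def)
  finally show ?thesis
    by (simp add: parisi_functional_def)
qed

lemma parisi_functional_eq_cost:
  assumes \<gamma>: "\<gamma> \<in> parisi_densities" "\<gamma> integrable_on {0..1}" and \<Delta>: "0 < \<Delta>"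
    and X: "\<And>x. x \<in> {0..1} \<Longrightarrow> 0 \<le> poly (pderiv X) x"
  shows "parisi_functional (poly X) (nu_measure \<gamma> \<Delta>) = ennreal (zero_temp_cost X \<gamma> \<Delta> / 2)"
    and "0 \<le> zero_temp_cost X \<gamma> \<Delta>"
proof -
  let ?I = "integral {0..1} (\<lambda>x. poly (pderiv X) x * \<gamma> x)"
  let ?J = "integral {0..1} (\<lambda>x. 1 / tail \<gamma> \<Delta> x)"
  have "(\<lambda>x. poly (pderiv X) x * \<gamma> x) integrable_on {0..1}"
    by (intro continuous_times_density_integrable \<gamma> continuous_intros)
  note 1 = nn_integral_eq_integral_upto_endpoints[OF _ _ _ this, of "{0..<1}"]
  have 1: "(\<integral>\<^sup>+x\<in>{0..<1}. ennreal (poly (pderiv X) x * \<gamma> x) \<partial>lborel) = ennreal ?I" "0 \<le> ?I"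
    using X parisi_densities_nonneg[OF \<gamma>(1)] by (intro 1; force)+
  have tp: "0 < tail \<gamma> \<Delta> x" if "x \<in> {0..1}" for x
    using tail_ge[OF \<gamma> that, of \<Delta>] \<Delta> by linarith
  have "(\<lambda>x. 1 / tail \<gamma> \<Delta> x) integrable_on {0..1}"
    by (intro integrable_continuous_real continuous_on_inverse_tail \<gamma> \<Delta>)
  note 2 = nn_integral_eq_integral_upto_endpoints[OF _ _ _ this, of "{0..<1}"]
  have 2: "(\<integral>\<^sup>+x\<in>{0..<1}. ennreal (1 / tail \<gamma> \<Delta> x) \<partial>lborel) = ennreal ?J" "0 \<le> ?J"
    using tp by (intro 2; force simp: less_imp_le)+
  have "(\<integral>\<^sup>+x\<in>{0..<1}. ennreal (\<gamma> x) * ennreal (poly (pderiv X) x) \<partial>lborel) =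
      (\<integral>\<^sup>+x\<in>{0..<1}. ennreal (poly (pderiv X) x * \<gamma> x) \<partial>lborel)"
    using X parisi_densities_nonneg[OF \<gamma>(1)]
    by (intro nn_integral_cong) (auto simp: indicator_def ennreal_mult mult.commute)
  moreover have "(\<integral>\<^sup>+x\<in>{0..<1}. 1 / emeasure (nu_measure \<gamma> \<Delta>) {x<..1} \<partial>lborel) =
      (\<integral>\<^sup>+x\<in>{0..<1}. ennreal (1 / tail \<gamma> \<Delta> x) \<partial>lborel)"
  proof (intro nn_integral_cong)
    fix x :: real
    have "1 / ennreal (tail \<gamma> \<Delta> x) = ennreal (1 / tail \<gamma> \<Delta> x)" if "x \<in> {0..<1}"
      using tp[of x] that by (simp add: divide_ennreal[symmetric])
    then show "1 / emeasure (nu_measure \<gamma> \<Delta>) {x<..1} * indicator {0..<1} x =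
        ennreal (1 / tail \<gamma> \<Delta> x) * indicator {0..<1} x"
      using emeasure_nu_measure_tail[OF \<gamma> _ \<Delta>, of x] by (auto simp: indicator_def)
  qed
  moreover have X1: "0 \<le> poly (pderiv X) 1 * \<Delta>" using X[of 1] \<Delta> by simp
  ultimately have "parisi_functional (poly X) (nu_measure \<gamma> \<Delta>) =
      (ennreal ?I + ennreal (poly (pderiv X) 1 * \<Delta>) + ennreal ?J) / 2"
    using 1 2 \<Delta> X[of 1] by (simp add: parisi_functional_poly \<gamma> ennreal_mult mult.commute)
  also have "\<dots> = ennreal (?I + poly (pderiv X) 1 * \<Delta> + ?J) / ennreal 2"
    using 1 2 X1 by (simp add: ennreal_plus)
  also have "\<dots> = ennreal (zero_temp_cost X \<gamma> \<Delta> / 2)"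
    using 1 2 X1 unfolding zero_temp_cost_def by (intro divide_ennreal) auto
  finally show "parisi_functional (poly X) (nu_measure \<gamma> \<Delta>) = ennreal (zero_temp_cost X \<gamma> \<Delta> / 2)" .
  show "0 \<le> zero_temp_cost X \<gamma> \<Delta>" unfolding zero_temp_cost_def using 1 2 X1 by simp
qed

text \<open>A density can fail to be integrable only near \<open>1\<close>, where \<open>\<xi>'\<close> is bounded away from \<open>0\<close>; so the
linear term of the functional controls its integral.\<close>

lemma density_integrable_if_finite_functional:
  assumes \<gamma>: "\<gamma> \<in> parisi_densities" and \<Delta>: "0 < \<Delta>"
    and X: "mono_on {0..1} (poly (pderiv X))" "0 < poly (pderiv X) (1/2)" "0 \<le> poly (pderiv X) 0"
    and fin: "parisi_functional (poly X) (nu_measure \<gamma> \<Delta>) < \<infinity>"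
  shows "\<gamma> integrable_on {0..1}"
proof -
  let ?p = "poly (pderiv X)"
  have p: "?p x \<le> ?p y" if "0 \<le> x" "x \<le> y" "y \<le> 1" for x y
    using X(1) that by (auto simp: mono_on_def)
  define c where "c = ?p (1/2)"
  have c: "0 < c" using X by (simp add: c_def)
  define k where "k x = \<gamma> x * indicator {0..<1} x" for x
  have nn: "0 \<le> k x" for x
    using parisi_densities_nonneg[OF \<gamma>, of x] by (auto simp: k_def indicator_def)
  have "(\<lambda>x. enn2real (ennreal (\<gamma> x) * indicator {0..<1} x)) \<in> borel_measurable borel"
    using parisi_densities_measurable[OF \<gamma>] by measurable
  also have "(\<lambda>x. enn2real (ennreal (\<gamma> x) * indicator {0..<1} x)) = k"
    using parisi_densities_nonneg[OF \<gamma>] by (auto simp: k_def indicator_def)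
  finally have km: "k \<in> borel_measurable borel" .
  have F: "(\<integral>\<^sup>+x\<in>{0..<1}. ennreal (\<gamma> x) * ennreal (?p x) \<partial>lborel) < \<infinity>" (is "?F < _")
  proof (rule ccontr)
    assume "\<not> ?F < \<infinity>"
    then have "?F = \<infinity>" using less_top[of ?F] by auto
    then show False using fin
      unfolding parisi_functional_poly[OF \<gamma> \<Delta>] by (simp add: ennreal_top_divide)
  qed
  have "(\<integral>\<^sup>+x. k x \<partial>lborel) \<le>
     (\<integral>\<^sup>+x. ennreal (\<gamma> (1/2)) * indicator {0..<1} x + ennreal (1 / c) * (ennreal (\<gamma> x) * ennreal (?p x) * indicator {0..<1} x) \<partial>lborel)"
  proof (intro nn_integral_mono)
    fix x :: real
    show "ennreal (k x) \<le> ennreal (\<gamma> (1/2)) * indicator {0..<1} x + ennreal (1 / c) * (ennreal (\<gamma> x) * ennreal (?p x) * indicator {0..<1} x)"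
    proof (cases "x \<in> {0..<1}")
      case True
      have g: "0 \<le> \<gamma> x" "0 \<le> \<gamma> (1/2)" using parisi_densities_nonneg[OF \<gamma>] True by auto
      have px: "0 \<le> ?p x" using p[of 0 x] X(3) True by auto
      have "\<gamma> x \<le> \<gamma> (1/2) + 1 / c * (\<gamma> x * ?p x)"
      proof (cases "x \<le> 1/2")
        case True': True
        then have "\<gamma> x \<le> \<gamma> (1/2)" using True by (intro parisi_densities_mono[OF \<gamma>]) auto
        moreover have "0 \<le> 1 / c * (\<gamma> x * ?p x)" using g px c by simp
        ultimately show ?thesis by linarith
      next
        case False
        then have "c \<le> ?p x" unfolding c_def using True by (intro p) auto
        then have "\<gamma> x * c \<le> \<gamma> x * ?p x" using g by (intro mult_left_mono)
        then have "\<gamma> x \<le> 1 / c * (\<gamma> x * ?p x)" using c by (simp add: field_simps)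
        then show ?thesis using g by linarith
      qed
      then have "ennreal (\<gamma> x) \<le> ennreal (\<gamma> (1/2) + 1 / c * (\<gamma> x * ?p x))"
        by (rule ennreal_leI)
      also have "\<dots> = ennreal (\<gamma> (1/2)) + ennreal (1 / c) * (ennreal (\<gamma> x) * ennreal (?p x))"
        using g px c by (simp add: ennreal_plus ennreal_mult[symmetric] del: ennreal_1 one_ennreal_def)
      finally show ?thesis using True by (simp add: k_def)
    qed (simp add: k_def)
  qed
  also have "\<dots> = ennreal (\<gamma> (1/2)) + ennreal (1 / c) * ?F"
  proof -
    have m1: "?p \<in> borel_measurable borel"
      by (intro borel_measurable_continuous_onI continuous_intros)
    have "(\<lambda>x. (ennreal (\<gamma> x) * indicator {0..<1} x) * ennreal (?p x)) \<in> borel_measurable borel"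
      using parisi_densities_measurable[OF \<gamma>] m1 by measurable
    then have "(\<lambda>x. ennreal (\<gamma> x) * ennreal (?p x) * indicator {0..<1} x) \<in> borel_measurable lborel"
      by (simp add: ac_simps)
    then show ?thesis
      by (subst nn_integral_add) (auto simp: nn_integral_cmult nn_integral_cmult_indicator)
  qed
  also have "\<dots> < \<infinity>" using F by (simp add: ennreal_mult_less_top)
  finally have "k integrable_on UNIV" by (rule nn_integral_integrable_on[OF km nn])
  then have "k integrable_on {0..1}" by (rule integrable_on_subinterval) auto
  then show ?thesis
    by (rule integrable_spike_finite[of "{1}", rotated 2]) (auto simp: k_def indicator_def)
qed

section \<open>First-order conditions for a minimizer\<close>

lemma parisi_densities_step:
  assumes "\<gamma> \<in> parisi_densities"
  shows "(\<lambda>x. \<gamma> x + (if u \<le> x then 1 else 0)) \<in> parisi_densities"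
proof -
  have "continuous (at_right x) (\<lambda>x. if u \<le> x then 1 else 0 :: real)" for x
  proof (cases "u \<le> x")
    case True
    have "((\<lambda>y. if u \<le> y then 1 else 0 :: real) \<longlongrightarrow> 1) (at_right x)"
      by (rule tendsto_eventually, rule eventually_mono[OF eventually_at_right_less[of x]])
         (use True in auto)
    then show ?thesis using True by (simp add: continuous_within)
  next
    case False
    have "\<forall>\<^sub>F y in at_right x. y < u"
      using False by (auto simp: eventually_at_right[of x u] intro!: exI[of _ u])
    then have "((\<lambda>y. if u \<le> y then 1 else 0 :: real) \<longlongrightarrow> 0) (at_right x)"
      by (intro tendsto_eventually) (auto elim: eventually_mono)
    then show ?thesis using False by (simp add: continuous_within)
  qed
  moreover have "mono_on {0..<1} (\<lambda>x. \<gamma> x + (if u \<le> x then 1 else 0))"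
    by (intro mono_onI add_mono) (use assms in \<open>auto simp: parisi_densities_def mono_on_def\<close>)
  ultimately show ?thesis using assms
    by (auto simp: parisi_densities_def intro!: continuous_intros)
qed

lemma parisi_densities_convex_combination:
  assumes "\<gamma>0 \<in> parisi_densities" "\<gamma>1 \<in> parisi_densities" "0 \<le> t" "t \<le> 1"
  shows "(\<lambda>x. \<gamma>0 x + t * (\<gamma>1 x - \<gamma>0 x)) \<in> parisi_densities"
proof -
  have "(\<lambda>x. (1 - t) * \<gamma>0 x + t * \<gamma>1 x) \<in> parisi_densities"
    using assms
    by (auto simp: parisi_densities_def mono_on_def intro!: continuous_intros add_mono mult_left_mono)
  moreover have "(\<lambda>x. (1 - t) * \<gamma>0 x + t * \<gamma>1 x) = (\<lambda>x. \<gamma>0 x + t * (\<gamma>1 x - \<gamma>0 x))"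
    by (simp add: algebra_simps)
  ultimately show ?thesis by simp
qed

text \<open>Subtracting the clamped density removes from \<open>\<rho>\<close> the part that lifts \<open>\<gamma>\<close> from \<open>c1\<close> to \<open>c2\<close>. What
remains is again nondecreasing and nonnegative, so this is an admissible perturbation even
where \<open>\<rho>\<close> is singular.\<close>

lemma parisi_densities_minus_clamp:
  assumes \<gamma>: "\<gamma> \<in> parisi_densities" and c: "0 \<le> c1" "c1 \<le> c2"
  shows "(\<lambda>x. \<gamma> x - (max c1 (min c2 (\<gamma> x)) - c1)) \<in> parisi_densities"
proof -
  have "\<gamma> x - (max c1 (min c2 (\<gamma> x)) - c1) \<le> \<gamma> y - (max c1 (min c2 (\<gamma> y)) - c1)"
    if "\<gamma> x \<le> \<gamma> y" for x y using that c by (auto simp: max_def min_def)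
  moreover have "0 \<le> \<gamma> x - (max c1 (min c2 (\<gamma> x)) - c1)" if "0 \<le> \<gamma> x" for x
    using that c by (auto simp: max_def min_def)
  ultimately show ?thesis
    using \<gamma> by (auto simp: parisi_densities_def mono_on_def
        intro!: continuous_intros continuous_max continuous_min)
qed

lemma integrable_clamp:
  fixes \<gamma> :: "real \<Rightarrow> real"
  assumes \<gamma>: "\<gamma> \<in> parisi_densities" "\<gamma> integrable_on {0..1}" and c: "0 \<le> c1" "c1 \<le> c2"
  shows "(\<lambda>x. max c1 (min c2 (\<gamma> x)) - c1) integrable_on {0..1}"
proof -
  define \<gamma>0 where "\<gamma>0 = \<gamma>(1 := 0)"
  have "\<gamma>0 absolutely_integrable_on {0..1}"
    unfolding \<gamma>0_def by (rule density_absolutely_integrable[OF \<gamma>])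
  then have "(\<lambda>x. max c1 (min c2 (\<gamma>0 x)) - c1) absolutely_integrable_on {0..1}"
    by (intro set_integral_diff absolutely_integrable_max_1 absolutely_integrable_min_1)
       (auto intro: absolutely_integrable_continuous_real)
  then have "(\<lambda>x. max c1 (min c2 (\<gamma>0 x)) - c1) integrable_on {0..1}"
    by (simp add: absolutely_integrable_on_def)
  then show ?thesis
    by (rule integrable_spike_finite[of "{1}", rotated 2]) (auto simp: \<gamma>0_def)
qed

lemma integral_step:
  fixes \<phi> :: "real \<Rightarrow> real"
  assumes "continuous_on {0..1} \<phi>" "0 \<le> u" "u \<le> 1" "0 \<le> x" "x \<le> 1"
  shows "((\<lambda>y. if u \<le> y then \<phi> y else 0) has_integral integral {max x u..1} \<phi>) {x..1}"
proof -
  have eq: "{u..} \<inter> {x..1} = {max x u..1}" by auto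
  have "(\<phi> has_integral integral {max x u..1} \<phi>) {max x u..1}"
    by (intro integrable_integral integrable_continuous_real continuous_on_subset[OF assms(1)])
       (use assms(2-5) in auto)
  then have "((\<lambda>y. if y \<in> {u..} then \<phi> y else 0) has_integral integral {max x u..1} \<phi>) {x..1}"
    unfolding has_integral_restrict_Int eq .
  then show ?thesis by (simp only: atLeast_iff)
qed

lemma tail_add:
  assumes "\<gamma> integrable_on {0..1}" "(\<eta> has_integral E) {x..1}" "x \<in> {0..1}"
  shows "tail (\<lambda>y. \<gamma> y + \<eta> y) \<Delta> x = tail \<gamma> \<Delta> x + E"
proof -
  have "\<gamma> integrable_on {x..1}"
    using assms(3) by (intro integrable_on_subinterval[OF assms(1)]) auto
  then have "((\<lambda>y. \<gamma> y + \<eta> y) has_integral integral {x..1} \<gamma> + E) {x..1}"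
    by (intro has_integral_add assms(2) integrable_integral)
  then show ?thesis by (simp add: tail_def integral_unique)
qed

locale parisi_minimizer =
  fixes X :: "real poly" and \<gamma> :: "real \<Rightarrow> real" and \<Delta> :: real
  assumes coeff_nonneg: "\<And>i. 0 \<le> coeff X i"
    and no_low_order: "coeff X 1 = 0" "coeff X 2 = 0" and degree_gt: "2 < degree X"
    and density: "\<gamma> \<in> parisi_densities" and mass_pos: "0 < \<Delta>"
    and minimal: "\<And>\<gamma>1 \<Delta>1. \<gamma>1 \<in> parisi_densities \<Longrightarrow> 0 < \<Delta>1 \<Longrightarrow>
      parisi_functional (poly X) (nu_measure \<gamma> \<Delta>) \<le> parisi_functional (poly X) (nu_measure \<gamma>1 \<Delta>1)"
begin

abbreviation "X1 \<equiv> pderiv X"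
abbreviation "X2 \<equiv> pderiv X1"

lemma coeff_X1_nonneg: "0 \<le> coeff X1 i"
  unfolding coeff_pderiv by (intro mult_nonneg_nonneg coeff_nonneg) simp

lemma coeff_X2_nonneg: "0 \<le> coeff X2 i"
  unfolding coeff_pderiv[of X1] by (intro mult_nonneg_nonneg coeff_X1_nonneg) simp

lemma X_nonzero: "X1 \<noteq> 0" "X2 \<noteq> 0"
  using degree_gt by (auto simp: pderiv_eq_0_iff degree_pderiv)

lemma X1_0 [simp]: "poly X1 0 = 0" and X2_0 [simp]: "poly X2 0 = 0"
  using no_low_order by (simp_all add: poly_0_coeff_0 coeff_pderiv numeral_2_eq_2)

lemma X1_pos: "0 < x \<Longrightarrow> 0 < poly X1 x" and X2_pos: "0 < x \<Longrightarrow> 0 < poly X2 x"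
  using poly_pos coeff_X1_nonneg coeff_X2_nonneg X_nonzero by blast+

lemma X1_nonneg: "0 \<le> x \<Longrightarrow> 0 \<le> poly X1 x"
  using X1_pos[of x] by (cases "x = 0") auto

lemma X1_mono: "mono_on {0..1} (poly X1)"
proof (rule mono_onI)
  fix x y :: real assume xy: "x \<in> {0..1}" "y \<in> {0..1}" "x \<le> y"
  show "poly X1 x \<le> poly X1 y"
    unfolding poly_altdef using xy coeff_X1_nonneg
    by (intro sum_mono mult_left_mono power_mono) auto
qed

lemma integrable: "\<gamma> integrable_on {0..1}"
proof (rule density_integrable_if_finite_functional[OF density mass_pos X1_mono])
  have z: "(\<lambda>x. 0) \<in> parisi_densities" by (simp add: parisi_densities_def mono_on_def)
  have "parisi_functional (poly X) (nu_measure (\<lambda>x. 0) 1) = ennreal (zero_temp_cost X (\<lambda>x. 0) 1 / 2)"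
    by (rule parisi_functional_eq_cost) (use z X1_nonneg in auto)
  then have "parisi_functional (poly X) (nu_measure (\<lambda>x. 0) 1) < \<infinity>" by simp
  then show "parisi_functional (poly X) (nu_measure \<gamma> \<Delta>) < \<infinity>"
    using minimal[OF z zero_less_one] by (rule le_less_trans[rotated])
qed (use X1_pos in auto)

abbreviation "N \<equiv> tail \<gamma> \<Delta>"

lemma N_ge: "x \<in> {0..1} \<Longrightarrow> \<Delta> \<le> N x"
  by (rule tail_ge[OF density integrable])

lemma N_pos: "x \<in> {0..1} \<Longrightarrow> 0 < N x"
  using N_ge[of x] mass_pos by linarith

lemma cont_N: "continuous_on {0..1} N"
  by (rule continuous_on_tail[OF integrable])

lemma minimal_cost:
  assumes "\<gamma>1 \<in> parisi_densities" "\<gamma>1 integrable_on {0..1}" "0 < \<Delta>1"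
  shows "zero_temp_cost X \<gamma> \<Delta> \<le> zero_temp_cost X \<gamma>1 \<Delta>1"
proof -
  note eq = parisi_functional_eq_cost[of _ _ X]
  have "ennreal (zero_temp_cost X \<gamma> \<Delta> / 2) \<le> ennreal (zero_temp_cost X \<gamma>1 \<Delta>1 / 2)"
    using minimal[OF assms(1,3)] eq(1)[OF density integrable mass_pos] eq(1)[OF assms] X1_nonneg by simp
  moreover have "0 \<le> zero_temp_cost X \<gamma>1 \<Delta>1" using eq(2)[OF assms] X1_nonneg by simp
  ultimately show ?thesis by (simp add: ennreal_le_iff)
qed

text \<open>This is the nonnegativity of the directional derivative of the functional towards a competitor. On
the segment between the two measures the tails stay above \<open>min \<Delta> \<Delta>1\<close>, so the second-order term is
bounded by a multiple of \<open>t\<^sup>2\<close>; dividing the cost difference by \<open>t\<close> and letting \<open>t\<close> tend to \<open>0\<close>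
gives the claim.\<close>

lemma first_order_condition:
  assumes \<gamma>1: "\<gamma>1 \<in> parisi_densities" "\<gamma>1 integrable_on {0..1}" "0 < \<Delta>1"
  shows "integral {0..1} (\<lambda>x. (tail \<gamma>1 \<Delta>1 x - N x) / (N x)\<^sup>2) \<le>
    integral {0..1} (\<lambda>x. poly X1 x * (\<gamma>1 x - \<gamma> x)) + poly X1 1 * (\<Delta>1 - \<Delta>)"
proof -
  define E where "E x = tail \<gamma>1 \<Delta>1 x - N x" for x
  define c where "c = min \<Delta> \<Delta>1"
  have c: "0 < c" using mass_pos \<gamma>1 by (simp add: c_def)
  define J where "J = integral {0..1} (\<lambda>x. E x / (N x)\<^sup>2)"
  define L where "L = integral {0..1} (\<lambda>x. (E x)\<^sup>2 / ((N x)\<^sup>2 * c))"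
  define I where "I = integral {0..1} (\<lambda>x. poly X1 x * (\<gamma>1 x - \<gamma> x))"
  have Np: "N x \<noteq> 0" if "x \<in> {0..1}" for x using N_pos[OF that] by simp
  have contE: "continuous_on {0..1} E"
    unfolding E_def by (intro continuous_intros continuous_on_tail integrable \<gamma>1)
  have Jint: "(\<lambda>x. E x / (N x)\<^sup>2) integrable_on {0..1}"
    using Np by (intro integrable_continuous_real continuous_intros contE cont_N) auto
  have Lint: "(\<lambda>x. (E x)\<^sup>2 / ((N x)\<^sup>2 * c)) integrable_on {0..1}"
    using Np c by (intro integrable_continuous_real continuous_intros contE cont_N) auto
  have Iint: "(\<lambda>x. poly X1 x * (\<gamma>1 x - \<gamma> x)) integrable_on {0..1}"
    using integrable_diff[OF continuous_times_density_integrable[OF \<gamma>1(1,2), of "poly X1"]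
        continuous_times_density_integrable[OF density integrable, of "poly X1"]]
    by (simp add: right_diff_distrib continuous_intros)
  have main: "J \<le> I + poly X1 1 * (\<Delta>1 - \<Delta>) + t * L" if t: "0 < t" "t < 1" for t
  proof -
    define \<gamma>t where "\<gamma>t x = \<gamma> x + t * (\<gamma>1 x - \<gamma> x)" for x
    define \<Delta>t where "\<Delta>t = \<Delta> + t * (\<Delta>1 - \<Delta>)"
    have \<gamma>t: "\<gamma>t \<in> parisi_densities"
      unfolding \<gamma>t_def using t by (intro parisi_densities_convex_combination density \<gamma>1) auto
    have iD: "(\<lambda>x. t * (\<gamma>1 x - \<gamma> x)) integrable_on {0..1}"
      by (intro integrable_on_mult_right integrable_diff \<gamma>1 integrable)
    have \<gamma>ti: "\<gamma>t integrable_on {0..1}"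
      unfolding \<gamma>t_def by (intro integrable_add integrable iD)
    have "\<Delta>t = (1 - t) * \<Delta> + t * \<Delta>1" by (simp add: \<Delta>t_def algebra_simps)
    then have \<Delta>t: "0 < \<Delta>t" using t mass_pos \<gamma>1 by (simp add: add_pos_pos)
    have tt: "tail \<gamma>t \<Delta>t x = N x + t * E x" if x: "x \<in> {0..1}" for x
    proof -
      have i: "\<gamma> integrable_on {x..1}" "\<gamma>1 integrable_on {x..1}"
        using x by (auto intro: integrable_on_subinterval[OF integrable] integrable_on_subinterval[OF \<gamma>1(2)])
      have "((\<lambda>y. t * (\<gamma>1 y - \<gamma> y)) has_integral t * (integral {x..1} \<gamma>1 - integral {x..1} \<gamma>)) {x..1}"
        by (intro has_integral_mult_right has_integral_diff integrable_integral i)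
      from tail_add[OF integrable this x, of \<Delta>t]
      show ?thesis by (simp add: \<gamma>t_def[abs_def] E_def tail_def \<Delta>t_def algebra_simps)
    qed
    \<comment> \<open>Taylor expansion of \<open>1 / (N + t E)\<close> with its remainder estimated by \<open>c\<close>.\<close>
    have ineq: "1 / tail \<gamma>t \<Delta>t x \<le> 1 / N x + (t\<^sup>2 * ((E x)\<^sup>2 / ((N x)\<^sup>2 * c)) - t * (E x / (N x)\<^sup>2))"
      if x: "x \<in> {0..1}" for x
    proof -
      define M where "M = N x + t * E x"
      have cM: "c \<le> M"
      proof -
        have "M = (1 - t) * N x + t * tail \<gamma>1 \<Delta>1 x" by (simp add: M_def E_def algebra_simps)
        moreover have "(1 - t) * c \<le> (1 - t) * N x" "t * c \<le> t * tail \<gamma>1 \<Delta>1 x"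
          using N_ge[OF x] tail_ge[OF \<gamma>1(1,2) x, of \<Delta>1] t by (auto simp: c_def intro!: mult_left_mono)
        ultimately show ?thesis by (simp add: algebra_simps)
      qed
      then have M: "0 < M" using c by linarith
      have "1 / M = 1 / N x + (t\<^sup>2 * ((E x)\<^sup>2 / ((N x)\<^sup>2 * M)) - t * (E x / (N x)\<^sup>2))"
        using M N_pos[OF x] by (simp add: M_def divide_simps) (simp add: algebra_simps power2_eq_square)
      also have "(E x)\<^sup>2 / ((N x)\<^sup>2 * M) \<le> (E x)\<^sup>2 / ((N x)\<^sup>2 * c)"
        using cM c N_pos[OF x] by (intro divide_left_mono mult_left_mono mult_pos_pos) auto
      then have "t\<^sup>2 * ((E x)\<^sup>2 / ((N x)\<^sup>2 * M)) \<le> t\<^sup>2 * ((E x)\<^sup>2 / ((N x)\<^sup>2 * c))"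
        by (intro mult_left_mono) auto
      finally show ?thesis using tt[OF x] by (simp add: M_def)
    qed
    have iN: "(\<lambda>x. 1 / N x) integrable_on {0..1}"
      by (intro integrable_continuous_real continuous_on_inverse_tail density integrable mass_pos)
    have "integral {0..1} (\<lambda>x. 1 / tail \<gamma>t \<Delta>t x) \<le>
        integral {0..1} (\<lambda>x. 1 / N x + (t\<^sup>2 * ((E x)\<^sup>2 / ((N x)\<^sup>2 * c)) - t * (E x / (N x)\<^sup>2)))"
      using ineq
      by (intro integral_le integrable_continuous_real[OF continuous_on_inverse_tail[OF \<gamma>t \<gamma>ti \<Delta>t]]
          integrable_add integrable_diff integrable_on_mult_right iN Jint Lint) auto
    also have "\<dots> = integral {0..1} (\<lambda>x. 1 / N x) + (t\<^sup>2 * L - t * J)"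
      unfolding L_def J_def
      by (intro integral_unique has_integral_add has_integral_diff has_integral_mult_right
          integrable_integral iN Jint Lint)
    finally have A: "integral {0..1} (\<lambda>x. 1 / tail \<gamma>t \<Delta>t x) \<le>
        integral {0..1} (\<lambda>x. 1 / N x) + (t\<^sup>2 * L - t * J)" .
    have "integral {0..1} (\<lambda>x. poly X1 x * \<gamma>t x) =
        integral {0..1} (\<lambda>x. poly X1 x * \<gamma> x + t * (poly X1 x * (\<gamma>1 x - \<gamma> x)))"
      by (simp add: \<gamma>t_def algebra_simps)
    also have "\<dots> = integral {0..1} (\<lambda>x. poly X1 x * \<gamma> x) + t * I"
      using continuous_times_density_integrable[OF density integrable, of "poly X1"] Iint
      by (simp add: integral_add integrable_on_mult_right I_def continuous_intros)
    finally have B: "integral {0..1} (\<lambda>x. poly X1 x * \<gamma>t x) = integral {0..1} (\<lambda>x. poly X1 x * \<gamma> x) + t * I" .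
    have "zero_temp_cost X \<gamma> \<Delta> \<le> zero_temp_cost X \<gamma>t \<Delta>t"
      by (rule minimal_cost[OF \<gamma>t \<gamma>ti \<Delta>t])
    then have "0 \<le> t * I + poly X1 1 * (t * (\<Delta>1 - \<Delta>)) + (t\<^sup>2 * L - t * J)"
      using A B unfolding zero_temp_cost_def \<Delta>t_def by (simp add: distrib_left)
    also have "\<dots> = t * (I + poly X1 1 * (\<Delta>1 - \<Delta>) + t * L - J)"
      by (simp add: algebra_simps power2_eq_square)
    finally have "0 \<le> t * (I + poly X1 1 * (\<Delta>1 - \<Delta>) + t * L - J)" .
    then show ?thesis using t by (simp add: zero_le_mult_iff)
  qed
  have "((\<lambda>t. I + poly X1 1 * (\<Delta>1 - \<Delta>) + t * L) \<longlongrightarrow> I + poly X1 1 * (\<Delta>1 - \<Delta>) + 0 * L) (at_right 0)"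
    by (intro tendsto_intros)
  moreover have "\<forall>\<^sub>F t in at_right 0. J \<le> I + poly X1 1 * (\<Delta>1 - \<Delta>) + t * L"
    using main by (auto simp: eventually_at_right[of 0 "1::real"] intro!: exI[of _ 1])
  ultimately have "J \<le> I + poly X1 1 * (\<Delta>1 - \<Delta>) + 0 * L"
    by (rule tendsto_lowerbound) simp
  then show ?thesis by (simp add: J_def I_def E_def)
qed

abbreviation "W x \<equiv> 1 / (N x)\<^sup>2"

definition "H u = integral {0..u} W"

text \<open>This is \<open>\<integral>\<^sub>u\<^sup>1 H\<close>, written as the first-order condition produces it for the competitor
\<open>\<gamma> + 1\<^bsub>[u,1)\<^esub>\<close>, whose tail exceeds that of \<open>\<gamma>\<close> by \<open>1 - max x u\<close>.\<close>

definition "\<Phi> u = integral {0..1} (\<lambda>x. (1 - max x u) * W x)"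

definition "g u = poly X1 u - H u"

definition "G u = poly X 1 - poly X u - \<Phi> u"

lemma cont_W: "continuous_on {0..1} W"
  using N_pos by (intro continuous_intros cont_N) force

lemma DERIV_H: "u \<in> {0..1} \<Longrightarrow> (H has_real_derivative W u) (at u within {0..1})"
  unfolding H_def by (rule integral_has_real_derivative[OF cont_W])

lemma \<Phi>_split:
  assumes u: "u \<in> {0..1}"
  shows "\<Phi> u = (1 - u) * H u + integral {u..1} (\<lambda>x. (1 - x) * W x)"
proof -
  have "(\<lambda>x. (1 - max x u) * W x) integrable_on {0..1}"
    by (intro integrable_continuous_real continuous_intros continuous_on_max cont_W)
  from Henstock_Kurzweil_Integration.integral_combine[OF _ _ this, of u] u
  have "\<Phi> u = integral {0..u} (\<lambda>x. (1 - max x u) * W x) + integral {u..1} (\<lambda>x. (1 - max x u) * W x)"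
    unfolding \<Phi>_def by simp
  also have "integral {0..u} (\<lambda>x. (1 - max x u) * W x) = integral {0..u} (\<lambda>x. (1 - u) * W x)"
    by (intro Henstock_Kurzweil_Integration.integral_cong) auto
  also have "\<dots> = (1 - u) * H u" unfolding H_def by (rule integral_mult_right)
  also have "integral {u..1} (\<lambda>x. (1 - max x u) * W x) = integral {u..1} (\<lambda>x. (1 - x) * W x)"
    by (intro Henstock_Kurzweil_Integration.integral_cong) auto
  finally show ?thesis .
qed

lemma DERIV_\<Phi>:
  assumes u: "u \<in> {0..1}"
  shows "(\<Phi> has_real_derivative - H u) (at u within {0..1})"
proof -
  have "((\<lambda>u. integral {u..1} (\<lambda>x. (1 - x) * W x)) has_real_derivative - ((1 - u) * W u)) (at u within {0..1})"
    by (intro integral_has_real_derivative' u continuous_intros cont_W)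
  then have "((\<lambda>u. (1 - u) * H u + integral {u..1} (\<lambda>x. (1 - x) * W x)) has_real_derivative - H u) (at u within {0..1})"
    by (auto intro!: derivative_eq_intros DERIV_H u)
  then show ?thesis
    by (rule has_field_derivative_transform_within[OF _ zero_less_one u]) (simp add: \<Phi>_split)
qed

lemma DERIV_G: "u \<in> {0..1} \<Longrightarrow> (G has_real_derivative - g u) (at u within {0..1})"
  unfolding G_def g_def
  by (auto intro!: derivative_eq_intros DERIV_\<Phi> DERIV_subset[OF poly_DERIV])

lemma DERIV_g: "u \<in> {0..1} \<Longrightarrow> (g has_real_derivative poly X2 u - W u) (at u within {0..1})"
  unfolding g_def by (auto intro!: derivative_eq_intros DERIV_H DERIV_subset[OF poly_DERIV])

lemma DERIV_G': "0 < u \<Longrightarrow> u < 1 \<Longrightarrow> (G has_real_derivative - g u) (at u)"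
  using DERIV_G[of u] by (simp add: at_within_Icc_at)

lemma DERIV_g': "0 < u \<Longrightarrow> u < 1 \<Longrightarrow> (g has_real_derivative poly X2 u - W u) (at u)"
  using DERIV_g[of u] by (simp add: at_within_Icc_at)

lemma cont_G: "continuous_on {0..1} G" and cont_g: "continuous_on {0..1} g"
  by (rule DERIV_continuous_on[OF DERIV_G], assumption) (rule DERIV_continuous_on[OF DERIV_g])

lemma G_1 [simp]: "G 1 = 0"
proof -
  have "\<Phi> 1 = integral {0..1} (\<lambda>x::real. 0)"
    unfolding \<Phi>_def by (intro Henstock_Kurzweil_Integration.integral_cong) auto
  then show ?thesis by (simp add: G_def)
qed

lemma g_0 [simp]: "g 0 = 0"
  by (simp add: g_def H_def)

lemma integral_X1: "a \<le> b \<Longrightarrow> (poly X1 has_integral (poly X b - poly X a)) {a..b}"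
  by (intro fundamental_theorem_of_calculus)
     (auto simp flip: has_real_derivative_iff_has_vector_derivative intro: DERIV_subset[OF poly_DERIV])

text \<open>Competitor: raise the density by \<open>1\<close> on \<open>[u,1)\<close>.\<close>

lemma G_nonneg:
  assumes u: "0 \<le> u" "u \<le> 1"
  shows "0 \<le> G u"
proof -
  let ?s = "\<lambda>x::real. if u \<le> x then 1 else 0 :: real"
  define \<gamma>1 where "\<gamma>1 x = \<gamma> x + ?s x" for x
  have s: "(?s has_integral (1 - max x u)) {x..1}" if "x \<in> {0..1}" for x
    using integral_step[of "\<lambda>x. 1" u x] u that by simp
  have \<gamma>1: "\<gamma>1 \<in> parisi_densities"
    unfolding \<gamma>1_def by (rule parisi_densities_step[OF density])
  have \<gamma>1i: "\<gamma>1 integrable_on {0..1}"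
    unfolding \<gamma>1_def using s[of 0] by (intro integrable_add integrable) auto
  have "tail \<gamma>1 \<Delta> x - N x = 1 - max x u" if "x \<in> {0..1}" for x
    using tail_add[OF integrable s[OF that] that, of \<Delta>] by (simp add: \<gamma>1_def[abs_def])
  then have "integral {0..1} (\<lambda>x. (tail \<gamma>1 \<Delta> x - N x) / (N x)\<^sup>2) = \<Phi> u"
    unfolding \<Phi>_def by (intro Henstock_Kurzweil_Integration.integral_cong) auto
  moreover have "integral {0..1} (\<lambda>x. poly X1 x * (\<gamma>1 x - \<gamma> x)) = poly X 1 - poly X u"
  proof -
    have "((\<lambda>y. if u \<le> y then poly X1 y else 0) has_integral integral {u..1} (poly X1)) {0..1}"
      using integral_step[of "poly X1" u 0] u by (simp add: max_def continuous_intros)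
    moreover have "(\<lambda>y. if u \<le> y then poly X1 y else 0) = (\<lambda>x. poly X1 x * (\<gamma>1 x - \<gamma> x))"
      by (auto simp: \<gamma>1_def)
    ultimately show ?thesis using integral_X1[OF u(2)] by (simp add: integral_unique)
  qed
  ultimately show ?thesis
    using first_order_condition[OF \<gamma>1 \<gamma>1i mass_pos] by (simp add: G_def)
qed

text \<open>Competitors: change the atom at \<open>1\<close> in both directions, which is possible since \<open>\<Delta> > 0\<close>.\<close>

lemma g_1 [simp]: "g 1 = 0"
proof -
  have *: "d * H 1 \<le> d * poly X1 1" if d: "0 < \<Delta> + d" for d
  proof -
    have "integral {0..1} (\<lambda>x. (tail \<gamma> (\<Delta> + d) x - N x) / (N x)\<^sup>2) = integral {0..1} (\<lambda>x. d * W x)"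
      by (simp add: tail_def)
    also have "\<dots> = d * H 1" unfolding H_def by (rule integral_mult_right)
    finally show ?thesis
      using first_order_condition[OF density integrable d] by (simp add: mult.commute)
  qed
  from *[of \<Delta>] *[of "- \<Delta> / 2"] mass_pos show ?thesis by (simp add: g_def field_simps)
qed

text \<open>The points \<open>u\<close> at which \<open>\<gamma>\<close> grows, that is, the support of \<open>\<rho>\<close>. The value \<open>c\<close> stands for the
height to the left of \<open>u\<close>; at \<open>u = 0\<close> it can be chosen as \<open>0\<close> and the condition becomes
\<open>0 < \<gamma> y2\<close>, which accounts for the mass \<open>\<gamma> 0\<close> that \<open>\<rho>\<close> has at \<open>0\<close>.\<close>

definition growth_point :: "real \<Rightarrow> bool" where
  "growth_point u \<longleftrightarrow> u \<in> {0..<1} \<and> (\<forall>\<delta>>0. \<exists>y1 y2 c. 0 \<le> c \<and> 0 \<le> y1 \<and> y1 \<le> u \<and> u \<le> y2 \<and>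
     u - \<delta> < y1 \<and> y2 < u + \<delta> \<and> y2 < 1 \<and> (\<forall>x\<in>{0..<y1}. \<gamma> x \<le> c) \<and> c < \<gamma> y2)"

text \<open>The competitor removes the growth of \<open>\<gamma>\<close> between \<open>y1\<close> and \<open>y2\<close>. The function \<open>\<psi>\<close> that is
subtracted is not known explicitly, but it lies between \<open>k 1\<^bsub>[y2,1)\<^esub>\<close> and \<open>k 1\<^bsub>[y1,1)\<^esub>\<close>, where
\<open>k\<close> is its total growth. The first bound is used in the linear term and the second in the tail.\<close>

lemma lower_perturbation:
  assumes y: "0 \<le> y1" "y1 \<le> y2" "y2 < 1" and c: "0 \<le> c" "\<And>x. x \<in> {0..<y1} \<Longrightarrow> \<gamma> x \<le> c" "c < \<gamma> y2"
  shows "poly X 1 - poly X y2 \<le> \<Phi> y1"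
proof -
  define k where "k = \<gamma> y2 - c"
  have k: "0 < k" using c by (simp add: k_def)
  define \<psi> where "\<psi> x = max c (min (\<gamma> y2) (\<gamma> x)) - c" for x
  define \<gamma>1 where "\<gamma>1 x = \<gamma> x - \<psi> x" for x
  have \<gamma>1: "\<gamma>1 \<in> parisi_densities"
    unfolding \<gamma>1_def \<psi>_def using c by (intro parisi_densities_minus_clamp density) auto
  have \<psi>i: "\<psi> integrable_on {0..1}"
    unfolding \<psi>_def using c by (intro integrable_clamp density integrable) auto
  have \<gamma>1i: "\<gamma>1 integrable_on {0..1}"
    unfolding \<gamma>1_def by (intro integrable_diff integrable \<psi>i)
  have \<psi>_le: "\<psi> x \<le> (if y1 \<le> x then k else 0)" if "x \<in> {0..1}" for x
  proof (cases "y1 \<le> x")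
    case False
    then have "\<gamma> x \<le> c" using c(2)[of x] that by auto
    then show ?thesis using False c(3) by (auto simp: \<psi>_def max_def min_def)
  qed (use c(3) in \<open>auto simp: \<psi>_def k_def max_def min_def\<close>)
  have \<psi>_ge: "(if y2 \<le> x then k else 0) \<le> \<psi> x" if "x \<in> {0..<1}" for x
    using c that parisi_densities_mono[OF density, of y2 x] y by (auto simp: \<psi>_def k_def max_def min_def)
  have \<psi>_nn: "0 \<le> \<psi> x" for x using c by (auto simp: \<psi>_def max_def min_def)
  have tl: "N x - tail \<gamma>1 \<Delta> x \<le> k * (1 - max x y1)" if x: "x \<in> {0..1}" for x
  proof -
    have i: "\<psi> integrable_on {x..1}" by (rule integrable_on_subinterval[OF \<psi>i]) (use x in auto)
    have "((\<lambda>y. - \<psi> y) has_integral - integral {x..1} \<psi>) {x..1}"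
      by (intro has_integral_neg integrable_integral i)
    from tail_add[OF integrable this x, of \<Delta>]
    have "N x - tail \<gamma>1 \<Delta> x = integral {x..1} \<psi>" by (simp add: \<gamma>1_def[abs_def])
    also have "\<dots> \<le> k * (1 - max x y1)"
    proof -
      have "((\<lambda>y. if y1 \<le> y then k else 0) has_integral integral {max x y1..1} (\<lambda>y. k)) {x..1}"
        by (rule integral_step) (use y x in auto)
      then have "((\<lambda>y. if y1 \<le> y then k else 0) has_integral k * (1 - max x y1)) {x..1}"
        using x y by (simp add: mult.commute)
      then show ?thesis
        by (rule has_integral_le[OF integrable_integral[OF i]]) (use \<psi>_le x in auto)
    qed
    finally show ?thesis .
  qed
  have i1: "(\<lambda>x. (tail \<gamma>1 \<Delta> x - N x) / (N x)\<^sup>2) integrable_on {0..1}"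
    using N_pos by (intro integrable_continuous_real continuous_intros continuous_on_tail \<gamma>1i integrable) force
  have "- (k * \<Phi> y1) = integral {0..1} (\<lambda>x. - k * ((1 - max x y1) * W x))"
    unfolding \<Phi>_def by (simp only: integral_mult_right)
  also have "\<dots> \<le> integral {0..1} (\<lambda>x. (tail \<gamma>1 \<Delta> x - N x) / (N x)\<^sup>2)"
  proof (intro integral_le i1)
    show "(\<lambda>x. - k * ((1 - max x y1) * W x)) integrable_on {0..1}"
      by (intro integrable_continuous_real continuous_intros continuous_on_max cont_W)
    fix x :: real assume x: "x \<in> {0..1}"
    have "- k * ((1 - max x y1) * W x) = - (k * (1 - max x y1)) / (N x)\<^sup>2" by simp
    also have "\<dots> \<le> (tail \<gamma>1 \<Delta> x - N x) / (N x)\<^sup>2"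
      using tl[OF x] by (intro divide_right_mono) auto
    finally show "- k * ((1 - max x y1) * W x) \<le> (tail \<gamma>1 \<Delta> x - N x) / (N x)\<^sup>2" .
  qed
  also have "\<dots> \<le> integral {0..1} (\<lambda>x. poly X1 x * (\<gamma>1 x - \<gamma> x))"
    using first_order_condition[OF \<gamma>1 \<gamma>1i mass_pos] by simp
  also have "\<dots> \<le> - (k * (poly X 1 - poly X y2))"
  proof -
    have "((\<lambda>y. if y2 \<le> y then poly X1 y else 0) has_integral integral {max 0 y2..1} (poly X1)) {0..1}"
      by (rule integral_step) (use y in \<open>auto intro: continuous_intros\<close>)
    then have "((\<lambda>y. if y2 \<le> y then poly X1 y else 0) has_integral poly X 1 - poly X y2) {0..1}"
      using integral_X1[of y2 1] y by (simp add: integral_unique max_def)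
    then have h: "((\<lambda>x. - k * (if y2 \<le> x then poly X1 x else 0)) has_integral - k * (poly X 1 - poly X y2)) {0..1}"
      by (rule has_integral_mult_right)
    have "((\<lambda>x. poly X1 x * (\<gamma>1 x - \<gamma> x)) has_integral integral {0..1} (\<lambda>x. poly X1 x * (\<gamma>1 x - \<gamma> x))) {0..1}"
      using integrable_diff[OF continuous_times_density_integrable[OF \<gamma>1 \<gamma>1i, of "poly X1"]
        continuous_times_density_integrable[OF density integrable, of "poly X1"]]
      by (intro integrable_integral) (simp add: right_diff_distrib continuous_intros)
    \<comment> \<open>The value of \<open>\<gamma>\<close> at \<open>1\<close> is arbitrary, so the integrand is adjusted at that point.\<close>
    then have "((\<lambda>x. if x = 1 then - k * poly X1 1 else poly X1 x * (\<gamma>1 x - \<gamma> x)) has_integral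
        integral {0..1} (\<lambda>x. poly X1 x * (\<gamma>1 x - \<gamma> x))) {0..1}"
      by (rule has_integral_spike_finite[of "{1}", rotated 2]) auto
    then have "integral {0..1} (\<lambda>x. poly X1 x * (\<gamma>1 x - \<gamma> x)) \<le> - k * (poly X 1 - poly X y2)"
    proof (rule has_integral_le[OF _ h])
      fix x :: real assume x: "x \<in> {0..1}"
      show "(if x = 1 then - k * poly X1 1 else poly X1 x * (\<gamma>1 x - \<gamma> x)) \<le> - k * (if y2 \<le> x then poly X1 x else 0)"
      proof (cases "x = 1")
        case True then show ?thesis using y by simp
      next
        case False
        then have "(if y2 \<le> x then k else 0) * poly X1 x \<le> \<psi> x * poly X1 x"
          using \<psi>_ge[of x] X1_nonneg[of x] x by (intro mult_right_mono) auto
        then show ?thesis using False by (auto simp: \<gamma>1_def algebra_simps split: if_splits)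
      qed
    qed
    then show ?thesis by simp
  qed
  finally show ?thesis using k by simp
qed

text \<open>Let \<open>y1\<close> and \<open>y2\<close> tend to \<open>u\<close> in \<open>lower_perturbation\<close> to obtain \<open>G u \<le> 0\<close>.\<close>

lemma G_growth_point:
  assumes "growth_point u"
  shows "G u = 0"
proof -
  have u: "0 \<le> u" "u < 1" using assms by (auto simp: growth_point_def)
  have "\<forall>n. \<exists>y1 y2. 0 \<le> y1 \<and> y1 \<le> u \<and> u \<le> y2 \<and>
     u - 1 / real (Suc n) < y1 \<and> y2 < u + 1 / real (Suc n) \<and> y2 < 1 \<and> poly X 1 - poly X y2 \<le> \<Phi> y1"
  proof
    fix n
    obtain y1 y2 c where *: "0 \<le> c" "0 \<le> y1" "y1 \<le> u" "u \<le> y2" "u - 1 / real (Suc n) < y1"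
      "y2 < u + 1 / real (Suc n)" "y2 < 1" "\<And>x. x \<in> {0..<y1} \<Longrightarrow> \<gamma> x \<le> c" "c < \<gamma> y2"
      using assms[unfolded growth_point_def, THEN conjunct2, rule_format, of "1 / real (Suc n)"] by auto
    then show "\<exists>y1 y2. 0 \<le> y1 \<and> y1 \<le> u \<and> u \<le> y2 \<and>
     u - 1 / real (Suc n) < y1 \<and> y2 < u + 1 / real (Suc n) \<and> y2 < 1 \<and> poly X 1 - poly X y2 \<le> \<Phi> y1"
      using lower_perturbation[of y1 y2 c] by (intro exI[of _ y1] exI[of _ y2]) auto
  qed
  then obtain y1 y2 where y: "\<And>n. 0 \<le> y1 n" "\<And>n. y1 n \<le> u" "\<And>n. u \<le> y2 n"
     "\<And>n. u - 1 / real (Suc n) < y1 n" "\<And>n. y2 n < u + 1 / real (Suc n)"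
     "\<And>n. poly X 1 - poly X (y2 n) \<le> \<Phi> (y1 n)"
    by metis
  have z: "(\<lambda>n. 1 / real (Suc n)) \<longlonglongrightarrow> 0" by (rule LIMSEQ_Suc[OF lim_1_over_n])
  have "(\<lambda>n. u - 1 / real (Suc n)) \<longlonglongrightarrow> u - 0" by (intro tendsto_intros z)
  then have "(\<lambda>n. u - 1 / real (Suc n)) \<longlonglongrightarrow> u" by simp
  from real_tendsto_sandwich[OF _ _ this tendsto_const[of u], of y1]
  have l1: "y1 \<longlonglongrightarrow> u"
    using y(2,4) by (simp add: always_eventually less_imp_le)
  have "(\<lambda>n. u + 1 / real (Suc n)) \<longlonglongrightarrow> u + 0" by (intro tendsto_intros z)
  then have "(\<lambda>n. u + 1 / real (Suc n)) \<longlonglongrightarrow> u" by simp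
  from real_tendsto_sandwich[OF _ _ tendsto_const[of u] this, of y2]
  have l2: "y2 \<longlonglongrightarrow> u"
    using y(3,5) by (simp add: always_eventually less_imp_le)
  have "continuous_on {0..1} \<Phi>" by (rule DERIV_continuous_on[OF DERIV_\<Phi>])
  then have "(\<lambda>n. \<Phi> (y1 n)) \<longlonglongrightarrow> \<Phi> u"
    by (rule continuous_on_tendsto_compose[OF _ l1]) (use u y in \<open>auto intro!: always_eventually intro: order_trans[of _ u]\<close>)
  moreover have "(\<lambda>n. poly X 1 - poly X (y2 n)) \<longlonglongrightarrow> poly X 1 - poly X u"
    by (intro tendsto_intros l2)
  ultimately have "poly X 1 - poly X u \<le> \<Phi> u"
    using y(6) by (intro tendsto_le[OF sequentially_bot, of _ "\<Phi> u" _ "poly X 1 - poly X u"] always_eventually) auto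
  then show ?thesis using G_nonneg[of u] u by (simp add: G_def)
qed

definition contact :: "real \<Rightarrow> bool" where
  "contact u \<longleftrightarrow> G u = 0 \<and> g u = 0"

lemma contact_1: "contact 1" by (simp add: contact_def)

text \<open>At a zero \<open>u > 0\<close> the nonnegative function \<open>G\<close> has an interior minimum, so its derivative \<open>- g u\<close>
vanishes.\<close>

lemma growth_point_contact:
  assumes "growth_point u"
  shows "contact u"
proof -
  have u: "0 \<le> u" "u < 1" using assms by (auto simp: growth_point_def)
  note G = G_growth_point[OF assms]
  have "g u = 0"
  proof (cases "u = 0")
    case False
    then have "- g u = 0"
      using u G G_nonneg
      by (intro DERIV_local_min[OF DERIV_G', of u "min u (1 - u)"]) (auto simp: abs_if split: if_splits)
    then show ?thesis by simp
  qed simp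
  then show ?thesis using G by (simp add: contact_def)
qed

end

section \<open>Plateaus of the density\<close>

text \<open>The second derivative of \<open>Z\<^sup>-\<^sup>1\<^sup>/\<^sup>2\<close> has the sign of \<open>- curvature (1/2) Z\<close>.\<close>

lemma derivatives_inverse_sqrt:
  assumes "0 < poly Z x"
  defines "f' \<equiv> \<lambda>x. - (1/2) * poly Z x powr (- 3/2) * poly (pderiv Z) x"
  shows "((\<lambda>x. poly Z x powr (- 1/2)) has_real_derivative f' x) (at x)"
    and "(f' has_real_derivative - (1/2) * poly Z x powr (- 5/2) * curvature (1/2) Z x) (at x)"
proof -
  have p: "((\<lambda>x. poly Z x powr a) has_real_derivative a * poly Z x powr (a - 1) * poly (pderiv Z) x) (at x)" for a
    using assms(1) by (auto intro!: derivative_eq_intros has_real_derivative_powr[THEN DERIV_chain2])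
  from p[of "- 1/2"] show "((\<lambda>x. poly Z x powr (- 1/2)) has_real_derivative f' x) (at x)"
    by (simp add: f'_def)
  have e: "poly Z x powr (- 3/2) = poly Z x powr (- 5/2) * poly Z x"
    using assms(1) powr_add[of "poly Z x" "- 5/2" 1] by simp
  have "((\<lambda>x. poly Z x powr (- 3/2) * poly (pderiv Z) x) has_real_derivative
      (- 3/2 * poly Z x powr (- 3/2 - 1) * poly (pderiv Z) x) * poly (pderiv Z) x +
      poly (pderiv (pderiv Z)) x * poly Z x powr (- 3/2)) (at x)"
    by (rule DERIV_mult[OF p poly_DERIV])
  from DERIV_cmult[OF this, of "- (1/2)"]
  have "(f' has_real_derivative - (1/2) * ((- 3/2 * poly Z x powr (- 3/2 - 1) * poly (pderiv Z) x) * poly (pderiv Z) x +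
      poly (pderiv (pderiv Z)) x * poly Z x powr (- 3/2))) (at x)"
    by (simp add: f'_def mult.assoc)
  also have "- (1/2) * ((- 3/2 * poly Z x powr (- 3/2 - 1) * poly (pderiv Z) x) * poly (pderiv Z) x +
      poly (pderiv (pderiv Z)) x * poly Z x powr (- 3/2)) = - (1/2) * poly Z x powr (- 5/2) * curvature (1/2) Z x"
    unfolding e by (simp add: curvature_def power2_eq_square algebra_simps)
  finally show "(f' has_real_derivative - (1/2) * poly Z x powr (- 5/2) * curvature (1/2) Z x) (at x)" .
qed

lemma mean_value_Icc:
  fixes F F' :: "real \<Rightarrow> real"
  assumes "a < b" "continuous_on {a..b} F"
    and F': "\<And>x. a < x \<Longrightarrow> x < b \<Longrightarrow> (F has_real_derivative F' x) (at x)"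
  shows "\<exists>z. a < z \<and> z < b \<and> F b - F a = (b - a) * F' z"
proof -
  obtain l z where z: "a < z" "z < b" "(F has_real_derivative l) (at z)" "F b - F a = (b - a) * l"
    using MVT[OF assms(1,2)] F' real_differentiable_def by metis
  then show ?thesis using DERIV_unique[OF z(3) F'] by blast
qed

context parisi_minimizer begin

definition "f x = poly X2 x powr (- 1/2)"
definition "f' x = - (1/2) * poly X2 x powr (- 3/2) * poly (pderiv X2) x"

lemma DERIV_f: "0 < x \<Longrightarrow> (f has_real_derivative f' x) (at x)"
  using derivatives_inverse_sqrt(1)[OF X2_pos] by (simp add: f_def[abs_def] f'_def)

lemma curvature_sign_of_slopes:
  assumes "0 < x" "x < y"
  shows "f' x < f' y \<Longrightarrow> \<exists>z. x < z \<and> z < y \<and> curvature (1/2) X2 z < 0"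
    and "f' y < f' x \<Longrightarrow> \<exists>z. x < z \<and> z < y \<and> 0 < curvature (1/2) X2 z"
proof -
  define f'' where "f'' z = - (1/2) * poly X2 z powr (- 5/2) * curvature (1/2) X2 z" for z
  have "(f' has_real_derivative f'' z) (at z)" if "0 < z" for z
    using derivatives_inverse_sqrt(2)[OF X2_pos[OF that]] by (simp add: f'_def[abs_def] f''_def)
  then obtain z where z: "x < z" "z < y" "f' y - f' x = (y - x) * f'' z"
    using MVT2[of x y f' f''] assms by auto
  have zp: "0 < poly X2 z powr (- 5/2)" using X2_pos[of z] z assms by simp
  show "\<exists>z. x < z \<and> z < y \<and> curvature (1/2) X2 z < 0" if "f' x < f' y"
  proof -
    have "0 < (y - x) * f'' z" using z that by simp
    then have "0 < f'' z" using assms by (simp add: zero_less_mult_iff)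
    then have "curvature (1/2) X2 z < 0" using zp by (simp add: f''_def mult_less_0_iff)
    then show ?thesis using z by blast
  qed
  show "\<exists>z. x < z \<and> z < y \<and> 0 < curvature (1/2) X2 z" if "f' y < f' x"
  proof -
    have "(y - x) * f'' z < 0" using z that by simp
    then have "f'' z < 0" using assms by (simp add: mult_less_0_iff)
    then have "0 < curvature (1/2) X2 z" using zp by (simp add: f''_def zero_less_mult_iff)
    then show ?thesis using z by blast
  qed
qed

text \<open>Since \<open>f\<^sup>-\<^sup>2 = \<xi>''\<close>, comparing \<open>f\<close> with \<open>N\<close> amounts to the sign of \<open>g' = \<xi>'' - N\<^sup>-\<^sup>2\<close>.\<close>

lemma f_vs_N:
  assumes "0 < x" "x \<le> 1"
  shows "poly X2 x < W x \<Longrightarrow> N x < f x" and "W x < poly X2 x \<Longrightarrow> f x < N x"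
proof -
  have n: "0 < N x" using N_pos assms by simp
  have z: "0 < poly X2 x" using X2_pos assms by simp
  have f: "f x = 1 / sqrt (poly X2 x)"
    using z by (simp add: f_def powr_minus powr_half_sqrt divide_simps)
  have W: "W x = (1 / N x)\<^sup>2" by (simp add: power_divide)
  show "N x < f x" if "poly X2 x < W x"
  proof -
    have "sqrt (poly X2 x) < 1 / N x"
      using that n unfolding W by (metis real_sqrt_less_mono real_sqrt_unique less_imp_le zero_less_divide_1_iff)
    then show ?thesis unfolding f using n z by (simp add: field_simps)
  qed
  show "f x < N x" if "W x < poly X2 x"
  proof -
    have "1 / N x < sqrt (poly X2 x)"
      using that n unfolding W by (metis real_sqrt_less_mono real_sqrt_unique less_imp_le zero_less_divide_1_iff)
    then show ?thesis unfolding f using n z by (simp add: field_simps)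
  qed
qed

lemma N_on_plateau:
  assumes ab: "0 \<le> a" "a < b" "b \<le> 1" and m: "\<And>x. x \<in> {a..<b} \<Longrightarrow> \<gamma> x = m" and x: "x \<in> {a..b}"
  shows "N x = N b + m * (b - x)"
proof -
  have "\<gamma> integrable_on {x..1}" by (rule integrable_on_subinterval[OF integrable]) (use ab x in auto)
  then have "integral {x..b} \<gamma> + integral {b..1} \<gamma> = integral {x..1} \<gamma>"
    using ab x by (intro Henstock_Kurzweil_Integration.integral_combine) auto
  moreover have "integral {x..b} \<gamma> = integral {x..b} (\<lambda>_. m)"
    by (rule integral_spike[of "{b}"]) (use m x in auto)
  ultimately show ?thesis using x by (simp add: tail_def mult.commute)
qed

lemma mean_value_G:
  assumes "0 \<le> s" "s < t" "t \<le> 1"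
  obtains z where "s < z" "z < t" "G t - G s = (t - s) * - g z"
proof -
  have "\<exists>z. s < z \<and> z < t \<and> G t - G s = (t - s) * - g z"
    using assms by (intro mean_value_Icc continuous_on_subset[OF cont_G] DERIV_G') auto
  then show ?thesis using that by blast
qed

lemma mean_value_g:
  assumes "0 \<le> s" "s < t" "t \<le> 1"
  obtains z where "s < z" "z < t" "g t - g s = (t - s) * (poly X2 z - W z)"
proof -
  have "\<exists>z. s < z \<and> z < t \<and> g t - g s = (t - s) * (poly X2 z - W z)"
    using assms by (intro mean_value_Icc continuous_on_subset[OF cont_g] DERIV_g') auto
  then show ?thesis using that by blast
qed

lemma G_increase:
  assumes "0 \<le> s" "s < t" "t \<le> 1" "G s < G t"
  shows "\<exists>z. s < z \<and> z < t \<and> g z < 0"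
proof -
  obtain z where z: "s < z" "z < t" "G t - G s = (t - s) * - g z"
    using mean_value_G[OF assms(1-3)] .
  then have "0 < (t - s) * - g z" using assms(4) by linarith
  then show ?thesis using z assms(2) by (intro exI[of _ z]) (simp add: mult_less_0_iff)
qed

lemma G_decrease:
  assumes "0 \<le> s" "s < t" "t \<le> 1" "G t < G s"
  shows "\<exists>z. s < z \<and> z < t \<and> 0 < g z"
proof -
  obtain z where z: "s < z" "z < t" "G t - G s = (t - s) * - g z"
    using mean_value_G[OF assms(1-3)] .
  then have "(t - s) * - g z < 0" using assms(4) by linarith
  then show ?thesis using z assms(2) by (intro exI[of _ z]) (simp add: zero_less_mult_iff)
qed

lemma g_increase:
  assumes "0 \<le> s" "s < t" "t \<le> 1" "g s < g t"
  shows "\<exists>z. s < z \<and> z < t \<and> W z < poly X2 z"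
proof -
  obtain z where z: "s < z" "z < t" "g t - g s = (t - s) * (poly X2 z - W z)"
    using mean_value_g[OF assms(1-3)] .
  then have "0 < (t - s) * (poly X2 z - W z)" using assms(4) by linarith
  then show ?thesis using z assms(2) by (intro exI[of _ z]) (simp add: zero_less_mult_iff)
qed

lemma g_decrease:
  assumes "0 \<le> s" "s < t" "t \<le> 1" "g t < g s"
  shows "\<exists>z. s < z \<and> z < t \<and> poly X2 z < W z"
proof -
  obtain z where z: "s < z" "z < t" "g t - g s = (t - s) * (poly X2 z - W z)"
    using mean_value_g[OF assms(1-3)] .
  then have "(t - s) * (poly X2 z - W z) < 0" using assms(4) by linarith
  then show ?thesis using z assms(2) by (intro exI[of _ z]) (simp add: mult_less_0_iff)
qed

text \<open>If \<open>G\<close> vanished on the whole plateau, then \<open>\<xi>'' N\<^sup>2 = 1\<close> there. As \<open>N\<close> is affine on the plateau, this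
would be an identity between polynomials, which fails at \<open>0\<close> because \<open>\<xi>''(0) = 0\<close>.\<close>

lemma G_positive_inside_plateau:
  assumes ab: "0 \<le> a" "a < b" "b \<le> 1" and m: "\<And>x. x \<in> {a..<b} \<Longrightarrow> \<gamma> x = m"
  shows "\<exists>u. a < u \<and> u < b \<and> 0 < G u"
proof (rule ccontr)
  assume "\<not> ?thesis"
  then have G0: "G u = 0" if "a < u" "u < b" for u
    using G_nonneg[of u] ab that by force
  have ev: "\<forall>\<^sub>F y in nhds u. y \<in> {a<..<b}" if "a < u" "u < b" for u
    using that by (intro eventually_nhds_in_open) auto
  have g0: "g u = 0" if u: "a < u" "u < b" for u
  proof -
    have "((\<lambda>_. 0) has_real_derivative - g u) (at u)"
      using DERIV_G'[of u] u ab
      by (subst DERIV_cong_ev[OF refl _ refl, of _ G]) (auto intro: eventually_mono[OF ev[OF u]] simp: G0)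
    then have "- g u = 0" using DERIV_unique DERIV_const by blast
    then show ?thesis by simp
  qed
  have "poly X2 u = W u" if u: "a < u" "u < b" for u
  proof -
    have "((\<lambda>_. 0) has_real_derivative poly X2 u - W u) (at u)"
      using DERIV_g'[of u] u ab
      by (subst DERIV_cong_ev[OF refl _ refl, of _ g]) (auto intro: eventually_mono[OF ev[OF u]] simp: g0)
    then have "poly X2 u - W u = 0" using DERIV_unique DERIV_const by blast
    then show ?thesis by simp
  qed
  moreover have "N u = poly [: N b + m * b, - m :] u" if "a < u" "u < b" for u
    using N_on_plateau[OF ab m, of u] that by (simp add: algebra_simps)
  ultimately have "poly (X2 * [: N b + m * b, - m :]\<^sup>2 - 1) u = 0" if "a < u" "u < b" for u
    using N_pos[of u] that ab by (auto simp: poly_power)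
  then have "{a<..<b} \<subseteq> {u. poly (X2 * [: N b + m * b, - m :]\<^sup>2 - 1) u = 0}" by auto
  then have "X2 * [: N b + m * b, - m :]\<^sup>2 - 1 = 0"
    using poly_roots_finite infinite_Ioo[OF ab(2)] finite_subset by blast
  then have "poly (X2 * [: N b + m * b, - m :]\<^sup>2 - 1) 0 = 0" by simp
  then show False by simp
qed

text \<open>Follow \<open>G\<close> from its zero at \<open>a\<close> up to a positive value and back to its zero at \<open>b\<close>: \<open>g\<close> is
\<open>0\<close> at \<open>a\<close>, then negative, then positive, and again \<open>0\<close> at \<open>b\<close>. So \<open>g'\<close> is negative, positive and
negative in this order, and \<open>f - N\<close> is positive, negative and positive. The slope of \<open>f - N\<close>, which is
\<open>f' + m\<close>, is therefore first negative and later positive.\<close>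

lemma plateau_slopes:
  assumes ab: "0 \<le> a" "a < b" "b \<le> 1" and m: "\<And>x. x \<in> {a..<b} \<Longrightarrow> \<gamma> x = m"
    and "contact a" "contact b"
  shows "\<exists>x y. a < x \<and> x < y \<and> y < b \<and> f' x < - m \<and> - m < f' y"
proof -
  have con: "G a = 0" "g a = 0" "G b = 0" "g b = 0" using assms(5,6) by (auto simp: contact_def)
  obtain u where u: "a < u" "u < b" "0 < G u" using G_positive_inside_plateau[OF ab m] by blast
  obtain c1 where c1: "a < c1" "c1 < u" "g c1 < 0"
    using G_increase[of a u] u ab con by auto
  obtain c2 where c2: "u < c2" "c2 < b" "0 < g c2"
    using G_decrease[of u b] u ab con by auto
  obtain x0 where x0: "a < x0" "x0 < c1" "poly X2 x0 < W x0"
    using g_decrease[of a c1] c1 u ab con by auto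
  obtain z0 where z0: "c1 < z0" "z0 < c2" "W z0 < poly X2 z0"
    using g_increase[of c1 c2] c1 c2 u ab con by auto
  obtain y0 where y0: "c2 < y0" "y0 < b" "poly X2 y0 < W y0"
    using g_decrease[of c2 b] c2 u ab con by auto
  define L where "L x = N b + m * (b - x)" for x
  have L: "N x = L x" if "a \<le> x" "x \<le> b" for x
    using N_on_plateau[OF ab m, of x] that by (simp add: L_def)
  have s: "L x0 < f x0" "f z0 < L z0" "L y0 < f y0"
    using f_vs_N[of x0] f_vs_N[of z0] f_vs_N[of y0] x0 y0 z0 c1 c2 u ab L by auto
  have d: "((\<lambda>x. f x - L x) has_real_derivative f' x + m) (at x)" if "0 < x" for x
    unfolding L_def using DERIV_f[OF that] by (auto intro!: derivative_eq_intros)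
  obtain x where x: "x0 < x" "x < z0" "(f z0 - L z0) - (f x0 - L x0) = (z0 - x0) * (f' x + m)"
    using MVT2[of x0 z0 "\<lambda>x. f x - L x" "\<lambda>x. f' x + m"] d x0 z0 ab by auto
  obtain y where y: "z0 < y" "y < y0" "(f y0 - L y0) - (f z0 - L z0) = (y0 - z0) * (f' y + m)"
    using MVT2[of z0 y0 "\<lambda>x. f x - L x" "\<lambda>x. f' x + m"] d x0 y0 z0 c1 c2 ab by auto
  have "(z0 - x0) * (f' x + m) < 0" "0 < (y0 - z0) * (f' y + m)" using x(3) y(3) s by linarith+
  then have "f' x + m < 0" "0 < f' y + m"
    using x0 z0 y0 c1 c2 by (auto simp: mult_less_0_iff zero_less_mult_iff)
  then show ?thesis using x y x0 y0 by (intro exI[of _ x] exI[of _ y]) auto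
qed

text \<open>On each plateau \<open>f'\<close> climbs across \<open>- m l\<close>, and before the next one it has to drop below
\<open>- m (Suc l) \<le> - m l\<close>. This gives \<open>k\<close> points with \<open>f'' > 0\<close>, separated by \<open>k - 1\<close> points with
\<open>f'' < 0\<close>.\<close>

lemma plateau_count:
  assumes ab: "\<And>l. l < k \<Longrightarrow> 0 \<le> a l \<and> a l < b l \<and> b l \<le> 1"
    and m: "\<And>l x. l < k \<Longrightarrow> x \<in> {a l..<b l} \<Longrightarrow> \<gamma> x = m l"
    and con: "\<And>l. l < k \<Longrightarrow> contact (a l) \<and> contact (b l)"
    and ord: "\<And>l. Suc l < k \<Longrightarrow> b l \<le> a (Suc l) \<and> m l \<le> m (Suc l)"
  shows "k \<le> card (exponents X2)"
proof (cases "k = 0")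
  case False
  have "\<forall>l<k. \<exists>x y. a l < x \<and> x < y \<and> y < b l \<and> f' x < - m l \<and> - m l < f' y"
    using plateau_slopes ab m con by blast
  then obtain x y where xy: "\<And>l. l < k \<Longrightarrow> a l < x l \<and> x l < y l \<and> y l < b l \<and> f' (x l) < - m l \<and> - m l < f' (y l)"
    by metis
  have x0: "0 < x l" if "l < k" for l using xy[OF that] ab[OF that] by linarith
  have "\<forall>l<k. \<exists>z. x l < z \<and> z < y l \<and> curvature (1/2) X2 z < 0"
    using curvature_sign_of_slopes(1)[OF x0] xy by (meson less_trans)
  then obtain e where e: "\<And>l. l < k \<Longrightarrow> x l < e l \<and> e l < y l \<and> curvature (1/2) X2 (e l) < 0" by metis
  have "\<exists>z. y l < z \<and> z < x (Suc l) \<and> 0 < curvature (1/2) X2 z" if l: "Suc l < k" for l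
  proof (rule curvature_sign_of_slopes(2))
    show "0 < y l" "y l < x (Suc l)" "f' (x (Suc l)) < f' (y l)"
      using x0[of l] xy[of l] xy[of "Suc l"] ord[OF l] l by linarith+
  qed
  then obtain w where w: "\<And>l. Suc l < k \<Longrightarrow> y l < w l \<and> w l < x (Suc l) \<and> 0 < curvature (1/2) X2 (w l)" by metis
  define z where "z j = (if even j then e (j div 2) else w (j div 2))" for j
  have "alternates (curvature (1/2) X2) (2 * k - 1)"
    unfolding alternates_def
  proof (intro exI conjI allI impI)
    show "0 < z 0" using e[of 0] x0[of 0] False by (simp add: z_def)
    show "z j < z (Suc j)" if "Suc j < 2 * k - 1" for j
    proof (cases "even j")
      case True
      then have "Suc (j div 2) < k" "Suc j div 2 = j div 2" using that by auto
      then show ?thesis using e[of "j div 2"] w[of "j div 2"] True by (auto simp: z_def)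
    next
      case False
      then have "Suc (j div 2) < k" "Suc j div 2 = Suc (j div 2)" using that by (auto elim!: oddE)
      then show ?thesis using e[of "Suc (j div 2)"] w[of "j div 2"] False by (auto simp: z_def)
    qed
    show "0 < (- 1) * (- 1) ^ j * curvature (1/2) X2 (z j)" if "j < 2 * k - 1" for j
    proof (cases "even j")
      case True
      then have "j div 2 < k" using that by auto
      then show ?thesis using e[of "j div 2"] True by (simp add: z_def)
    next
      case False
      then have "Suc (j div 2) < k" using that by (auto elim!: oddE)
      then show ?thesis using w[of "j div 2"] False by (simp add: z_def)
    qed
  qed
  then have "2 * k - 1 + 1 \<le> 2 * card (exponents X2)"
    using alternates_curvature_bound[of X2 "1/2" "2 * k - 1"] coeff_X2_nonneg X_nonzero X2_0
    by (simp add: poly_0_coeff_0)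
  then show ?thesis using False by linarith
qed simp

end

section \<open>Levels that carry a plateau\<close>

definition plateau_set :: "(real \<Rightarrow> real) \<Rightarrow> real \<Rightarrow> real set" where
  "plateau_set \<gamma> v = {x\<in>{0..<1}. \<gamma> x = v}"

text \<open>Plateaus are indexed by their height, which orders them; the ends of the plateau are \<open>lo\<close> and \<open>hi\<close>.\<close>

definition levels :: "(real \<Rightarrow> real) \<Rightarrow> real set" where
  "levels \<gamma> = {v. \<exists>x\<in>plateau_set \<gamma> v. \<exists>y\<in>plateau_set \<gamma> v. x < y}"

definition lo :: "(real \<Rightarrow> real) \<Rightarrow> real \<Rightarrow> real" where "lo \<gamma> v = Inf (plateau_set \<gamma> v)"
definition hi :: "(real \<Rightarrow> real) \<Rightarrow> real \<Rightarrow> real" where "hi \<gamma> v = Sup (plateau_set \<gamma> v)"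

lemma parisi_densities_right_limit:
  assumes "\<gamma> \<in> parisi_densities" "0 \<le> x" "x < 1"
  shows "(\<gamma> \<longlongrightarrow> \<gamma> x) (at_right x)"
  using assms by (auto simp: parisi_densities_def continuous_within)

lemma bdd_plateau_set: "bdd_below (plateau_set \<gamma> v)" "bdd_above (plateau_set \<gamma> v)"
  by (auto simp: plateau_set_def intro!: bdd_belowI[of _ 0] bdd_aboveI[of _ 1])

lemma plateau_set_bounds:
  assumes "x \<in> plateau_set \<gamma> v"
  shows "lo \<gamma> v \<le> x" "x \<le> hi \<gamma> v"
  using assms bdd_plateau_set[of \<gamma> v] by (auto simp: lo_def hi_def intro: cInf_lower cSup_upper)

lemma level_endpoints:
  assumes "v \<in> levels \<gamma>"
  shows "0 \<le> lo \<gamma> v" "lo \<gamma> v < hi \<gamma> v" "hi \<gamma> v \<le> 1"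
proof -
  obtain x y where xy: "x \<in> plateau_set \<gamma> v" "y \<in> plateau_set \<gamma> v" "x < y"
    using assms by (auto simp: levels_def)
  show "0 \<le> lo \<gamma> v"
    unfolding lo_def using xy(1) by (intro cInf_greatest) (auto simp: plateau_set_def)
  show "hi \<gamma> v \<le> 1"
    unfolding hi_def using xy(1) by (intro cSup_least) (auto simp: plateau_set_def)
  show "lo \<gamma> v < hi \<gamma> v"
    using plateau_set_bounds[OF xy(1)] plateau_set_bounds[OF xy(2)] xy(3) by linarith
qed

lemma level_value:
  assumes \<gamma>: "\<gamma> \<in> parisi_densities" and v: "v \<in> levels \<gamma>" and z: "lo \<gamma> v \<le> z" "z < hi \<gamma> v"
  shows "\<gamma> z = v"
proof -
  have ne: "plateau_set \<gamma> v \<noteq> {}" using v by (auto simp: levels_def)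
  have *: "\<gamma> z = v" if z: "lo \<gamma> v < z" "z < hi \<gamma> v" for z
  proof -
    obtain x where x: "x \<in> plateau_set \<gamma> v" "x < z"
      using z(1) cInf_less_iff[OF ne bdd_plateau_set(1)] by (auto simp: lo_def)
    obtain y where y: "y \<in> plateau_set \<gamma> v" "z < y"
      using z(2) less_cSup_iff[OF ne bdd_plateau_set(2)] by (auto simp: hi_def)
    have "\<gamma> x \<le> \<gamma> z" "\<gamma> z \<le> \<gamma> y"
      using x y parisi_densities_mono[OF \<gamma>, of x z] parisi_densities_mono[OF \<gamma>, of z y]
      by (auto simp: plateau_set_def)
    then show ?thesis using x y by (auto simp: plateau_set_def)
  qed
  show ?thesis
  proof (cases "z = lo \<gamma> v")
    case True
    have "\<forall>\<^sub>F y in at_right z. \<gamma> y = v"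
      using * z True eventually_at_right[of z "hi \<gamma> v"] by blast
    then have "(\<gamma> \<longlongrightarrow> v) (at_right z)" by (rule tendsto_eventually)
    then show ?thesis
      using parisi_densities_right_limit[OF \<gamma>, of z] level_endpoints[OF v] z
        tendsto_unique[OF trivial_limit_at_right_real, of \<gamma> "\<gamma> z" z v] by auto
  qed (use * z in auto)
qed

lemma level_below: 
  assumes \<gamma>: "\<gamma> \<in> parisi_densities" and v: "v \<in> levels \<gamma>" and x: "0 \<le> x" "x < lo \<gamma> v"
  shows "\<gamma> x < v"
proof -
  have "\<gamma> x \<le> \<gamma> (lo \<gamma> v)"
    using x level_endpoints[OF v] by (intro parisi_densities_mono[OF \<gamma>]) auto
  also have "\<dots> = v" using level_value[OF \<gamma> v, of "lo \<gamma> v"] level_endpoints[OF v] by simp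
  moreover have "\<gamma> x \<noteq> v"
    using plateau_set_bounds[of x \<gamma> v] x level_endpoints[OF v] by (auto simp: plateau_set_def)
  ultimately show ?thesis by simp
qed

lemma level_above: 
  assumes \<gamma>: "\<gamma> \<in> parisi_densities" and v: "v \<in> levels \<gamma>" and x: "hi \<gamma> v < x" "x < 1"
  shows "v < \<gamma> x"
proof -
  have "\<gamma> (lo \<gamma> v) \<le> \<gamma> x"
    using x level_endpoints[OF v] by (intro parisi_densities_mono[OF \<gamma>]) auto
  moreover have "\<gamma> (lo \<gamma> v) = v" using level_value[OF \<gamma> v, of "lo \<gamma> v"] level_endpoints[OF v] by simp
  moreover have "\<gamma> x \<noteq> v"
    using plateau_set_bounds[of x \<gamma> v] x level_endpoints[OF v] by (auto simp: plateau_set_def)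
  ultimately show ?thesis by simp
qed

lemma level_order:
  assumes \<gamma>: "\<gamma> \<in> parisi_densities" and v: "v \<in> levels \<gamma>" "w \<in> levels \<gamma>" "v < w"
  shows "hi \<gamma> v \<le> lo \<gamma> w"
proof (rule ccontr)
  assume "\<not> ?thesis"
  then have l: "lo \<gamma> w < hi \<gamma> v" by simp
  have w: "\<gamma> (lo \<gamma> w) = w" using level_value[OF \<gamma> v(2), of "lo \<gamma> w"] level_endpoints[OF v(2)] by simp
  have "\<gamma> (lo \<gamma> w) \<le> v"
  proof (cases "lo \<gamma> v \<le> lo \<gamma> w")
    case True
    then show ?thesis using level_value[OF \<gamma> v(1), of "lo \<gamma> w"] l by simp
  next
    case False
    then show ?thesis using level_below[OF \<gamma> v(1), of "lo \<gamma> w"] level_endpoints[OF v(2)] by simp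
  qed
  then show False using w v by simp
qed

lemma level_nonneg:
  assumes \<gamma>: "\<gamma> \<in> parisi_densities" and v: "v \<in> levels \<gamma>"
  shows "0 \<le> v"
proof -
  have "0 \<le> \<gamma> (lo \<gamma> v)" using level_endpoints[OF v] by (intro parisi_densities_nonneg[OF \<gamma>]) auto
  then show ?thesis using level_value[OF \<gamma> v, of "lo \<gamma> v"] level_endpoints[OF v] by simp
qed

lemma lo_initial_level:
  assumes "\<gamma> 0 \<in> levels \<gamma>"
  shows "lo \<gamma> (\<gamma> 0) = 0"
  using level_endpoints(1)[OF assms] plateau_set_bounds(1)[of 0 \<gamma> "\<gamma> 0"]
  by (simp add: plateau_set_def)

lemma initial_level_le:
  assumes \<gamma>: "\<gamma> \<in> parisi_densities" and v: "v \<in> levels \<gamma>"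
  shows "\<gamma> 0 \<le> v"
proof -
  have "\<gamma> 0 \<le> \<gamma> (lo \<gamma> v)"
    using level_endpoints[OF v] by (intro parisi_densities_mono[OF \<gamma>]) auto
  then show ?thesis using level_value[OF \<gamma> v, of "lo \<gamma> v"] level_endpoints[OF v] by simp
qed

context parisi_minimizer begin

text \<open>A point at which \<open>\<gamma>\<close> first reaches a positive height belongs to the support of \<open>\<rho>\<close>; if this point
is \<open>0\<close>, then because \<open>\<rho>\<close> has mass \<open>\<gamma> 0 > 0\<close> there.\<close>

lemma growth_point_superlevel_Inf:
  assumes c: "0 < c" and z: "z \<in> {0..<1}" "c \<le> \<gamma> z"
  shows "growth_point (Inf {x\<in>{0..<1}. c \<le> \<gamma> x})"
proof -
  define S where "S = {x\<in>{0..<1}. c \<le> \<gamma> x}"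
  define u where "u = Inf S"
  have bdd: "bdd_below S" by (auto simp: S_def intro: bdd_belowI[of _ 0])
  have ne: "S \<noteq> {}" using z by (auto simp: S_def)
  have u: "0 \<le> u" unfolding u_def using ne by (intro cInf_greatest) (auto simp: S_def)
  have "u \<le> z" unfolding u_def using z bdd by (intro cInf_lower) (auto simp: S_def)
  then have u1: "u < 1" using z by simp
  have "growth_point u"
    unfolding growth_point_def
  proof (intro conjI allI impI)
    show "u \<in> {0..<1}" using u u1 by simp
    fix \<delta> :: real assume \<delta>: "0 < \<delta>"
    obtain y2 where y2: "y2 \<in> S" "y2 < u + \<delta>"
      using cInf_less_iff[OF ne bdd, of "u + \<delta>"] \<delta> by (auto simp: u_def)
    have y2u: "u \<le> y2" unfolding u_def using y2 bdd by (intro cInf_lower)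
    show "\<exists>y1 y2 c. 0 \<le> c \<and> 0 \<le> y1 \<and> y1 \<le> u \<and> u \<le> y2 \<and>
       u - \<delta> < y1 \<and> y2 < u + \<delta> \<and> y2 < 1 \<and> (\<forall>x\<in>{0..<y1}. \<gamma> x \<le> c) \<and> c < \<gamma> y2"
    proof (cases "u = 0")
      case True
      then show ?thesis using y2 y2u \<delta> c
        by (intro exI[of _ 0] exI[of _ y2]) (auto simp: S_def)
    next
      case False
      define y1 where "y1 = max 0 (u - \<delta> / 2)"
      have y1: "0 \<le> y1" "y1 < u" "u - \<delta> < y1" using False u \<delta> by (auto simp: y1_def)
      have "y1 \<notin> S"
      proof
        assume "y1 \<in> S"
        then have "u \<le> y1" unfolding u_def using bdd by (intro cInf_lower)
        then show False using y1 by simp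
      qed
      then have "\<gamma> y1 < \<gamma> y2" using y1 u1 y2 by (auto simp: S_def)
      moreover have "0 \<le> \<gamma> y1" using y1 u1 by (intro parisi_densities_nonneg[OF density]) auto
      moreover have "\<forall>x\<in>{0..<y1}. \<gamma> x \<le> \<gamma> y1"
        using y1 u1 by (auto intro!: parisi_densities_mono[OF density])
      ultimately show ?thesis using y1 y2 y2u
        by (intro exI[of _ y1] exI[of _ y2] exI[of _ "\<gamma> y1"]) (auto simp: S_def)
    qed
  qed
  then show ?thesis by (simp add: u_def S_def)
qed

lemma contact_lo:
  assumes v: "v \<in> levels \<gamma>" "0 < v"
  shows "contact (lo \<gamma> v)"
proof -
  note e = level_endpoints[OF v(1)]
  have lv: "\<gamma> (lo \<gamma> v) = v" using level_value[OF density v(1), of "lo \<gamma> v"] e by simp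
  have "Inf {x\<in>{0..<1}. v \<le> \<gamma> x} = lo \<gamma> v"
  proof (rule cInf_eq_minimum)
    show "lo \<gamma> v \<in> {x\<in>{0..<1}. v \<le> \<gamma> x}" using lv e by simp
    show "lo \<gamma> v \<le> x" if "x \<in> {x\<in>{0..<1}. v \<le> \<gamma> x}" for x
      using that level_below[OF density v(1), of x] by force
  qed
  then show ?thesis
    using growth_point_superlevel_Inf[OF v(2), of "lo \<gamma> v"] lv e growth_point_contact by simp
qed

lemma contact_hi:
  assumes v: "v \<in> levels \<gamma>"
  shows "contact (hi \<gamma> v)"
proof (cases "hi \<gamma> v = 1")
  case True
  then show ?thesis by (simp add: contact_1)
next
  case False
  note e = level_endpoints[OF v]
  have "growth_point (hi \<gamma> v)"
    unfolding growth_point_def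
  proof (intro conjI allI impI)
    show "hi \<gamma> v \<in> {0..<1}" using e False by auto
    fix \<delta> :: real assume \<delta>: "0 < \<delta>"
    define y2 where "y2 = min (hi \<gamma> v + \<delta> / 2) ((hi \<gamma> v + 1) / 2)"
    have y2: "hi \<gamma> v < y2" "y2 < hi \<gamma> v + \<delta>" "y2 < 1"
      using \<delta> e False by (auto simp: y2_def min_def)
    have "\<gamma> x \<le> v" if "x \<in> {0..<hi \<gamma> v}" for x
      using that level_value[OF density v, of x] level_below[OF density v, of x]
      by (cases "lo \<gamma> v \<le> x") auto
    then show "\<exists>y1 y2 c. 0 \<le> c \<and> 0 \<le> y1 \<and> y1 \<le> hi \<gamma> v \<and> hi \<gamma> v \<le> y2 \<and> hi \<gamma> v - \<delta> < y1 \<and>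
        y2 < hi \<gamma> v + \<delta> \<and> y2 < 1 \<and> (\<forall>x\<in>{0..<y1}. \<gamma> x \<le> c) \<and> c < \<gamma> y2"
      using y2 \<delta> e level_nonneg[OF density v] level_above[OF density v y2(1,3)]
      by (intro exI[of _ "hi \<gamma> v"] exI[of _ y2] exI[of _ v]) auto
  qed
  then show ?thesis by (rule growth_point_contact)
qed

text \<open>Near \<open>0\<close> the derivative \<open>g' = \<xi>'' - N\<^sup>-\<^sup>2\<close> is negative, as \<open>\<xi>''(0) = 0\<close>. Hence \<open>g < 0\<close> and \<open>G\<close>
increases from \<open>G 0 \<ge> 0\<close>.\<close>

lemma G_positive_near_0:
  obtains \<delta> where "0 < \<delta>" "\<delta> \<le> 1" "\<And>u. 0 < u \<Longrightarrow> u < \<delta> \<Longrightarrow> 0 < G u"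
proof -
  have "continuous_on {0..1} (\<lambda>x. poly X2 x - W x)" by (intro continuous_intros cont_W)
  then have "((\<lambda>x. poly X2 x - W x) \<longlongrightarrow> poly X2 0 - W 0) (at 0 within {0..1})"
    unfolding continuous_on_def by (rule bspec) simp
  moreover have "poly X2 0 - W 0 < 0" using N_pos[of 0] by simp
  ultimately have "\<forall>\<^sub>F x in at 0 within {0..1}. poly X2 x - W x < 0" by (rule order_tendstoD(2))
  then obtain d where d: "0 < d" "\<And>x. x \<in> {0..1} \<Longrightarrow> x \<noteq> 0 \<Longrightarrow> \<bar>x\<bar> < d \<Longrightarrow> poly X2 x - W x < 0"
    by (auto simp: eventually_at dist_real_def)
  have g: "g u < 0" if u: "0 < u" "u < min d 1" for u
  proof -
    have "\<not> 0 \<le> g u"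
    proof
      assume "0 \<le> g u"
      moreover obtain z where z: "0 < z" "z < u" "g u - g 0 = (u - 0) * (poly X2 z - W z)"
        using mean_value_g[of 0 u] u by auto
      moreover have "(u - 0) * (poly X2 z - W z) < 0" using d(2)[of z] z u by (intro mult_pos_neg) auto
      ultimately show False by simp
    qed
    then show ?thesis by simp
  qed
  have "0 < G u" if u: "0 < u" "u < min d 1" for u
  proof (rule ccontr)
    assume "\<not> 0 < G u"
    moreover obtain z where z: "0 < z" "z < u" "G u - G 0 = (u - 0) * - g z"
      using mean_value_G[of 0 u] u by auto
    moreover have "0 < (u - 0) * - g z" using g[of z] z u by (intro mult_pos_pos) auto
    ultimately show False using G_nonneg[of 0] by simp
  qed
  then show ?thesis using that[of "min d 1"] d by simp
qed

text \<open>The support of \<open>\<rho>\<close> does not meet the interval on which \<open>G > 0\<close>, so \<open>\<gamma>\<close> is constant there.\<close>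

lemma initial_level: "\<gamma> 0 \<in> levels \<gamma>"
proof -
  obtain \<delta> where \<delta>: "0 < \<delta>" "\<delta> \<le> 1" "\<And>u. 0 < u \<Longrightarrow> u < \<delta> \<Longrightarrow> 0 < G u"
    using G_positive_near_0 by blast
  define y where "y = \<delta> / 2"
  have y: "0 < y" "y < \<delta>" "y < 1" using \<delta> by (auto simp: y_def)
  have "\<gamma> y \<le> \<gamma> 0"
  proof (rule ccontr)
    assume "\<not> \<gamma> y \<le> \<gamma> 0"
    then have less: "\<gamma> 0 < \<gamma> y" by simp
    have "0 \<le> \<gamma> 0" by (intro parisi_densities_nonneg[OF density]) auto
    then have pos: "0 < \<gamma> y" using less by simp
    define u where "u = Inf {x\<in>{0..<1}. \<gamma> y \<le> \<gamma> x}"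
    have "growth_point u" unfolding u_def using pos y growth_point_superlevel_Inf[of "\<gamma> y" y] by auto
    then have "G u = 0" using growth_point_contact by (simp add: contact_def)
    moreover have "u \<le> y" unfolding u_def using y
      by (intro cInf_lower) (auto intro: bdd_belowI[of _ 0])
    moreover have "0 < u"
    proof -
      have "\<forall>\<^sub>F x in at_right 0. \<gamma> x < \<gamma> y"
        using parisi_densities_right_limit[OF density, of 0] less by (intro order_tendstoD(2)) auto
      then obtain e where e: "0 < e" "\<And>x. 0 < x \<Longrightarrow> x < e \<Longrightarrow> \<gamma> x < \<gamma> y"
        unfolding eventually_at_right[OF zero_less_one] by auto
      have "e \<le> u" unfolding u_def
      proof (rule cInf_greatest)
        show "{x\<in>{0..<1}. \<gamma> y \<le> \<gamma> x} \<noteq> {}" using y by (auto intro!: exI[of _ y])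
        show "e \<le> x" if "x \<in> {x\<in>{0..<1}. \<gamma> y \<le> \<gamma> x}" for x
          using that e(2)[of x] less by (cases "x = 0") force+
      qed
      then show ?thesis using e by simp
    qed
    ultimately show False using \<delta>(3)[of u] y by simp
  qed
  moreover have "\<gamma> 0 \<le> \<gamma> y" using y by (intro parisi_densities_mono[OF density]) auto
  ultimately have "0 \<in> plateau_set \<gamma> (\<gamma> 0)" "y \<in> plateau_set \<gamma> (\<gamma> 0)"
    using y by (auto simp: plateau_set_def)
  then show ?thesis using y(1) unfolding levels_def by blast
qed

lemma X2_mono:
  assumes "0 \<le> x" "x \<le> y"
  shows "poly X2 x \<le> poly X2 y"
  unfolding poly_altdef using assms coeff_X2_nonneg
  by (intro sum_mono mult_left_mono power_mono) auto

text \<open>If \<open>\<gamma>\<close> were \<open>0\<close> on a maximal interval \<open>[0,b)\<close>, then \<open>N\<close> would be constant on \<open>[0,b]\<close>, and \<open>g\<close> would be convex there with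
\<open>g 0 = g b = 0\<close>. Such a \<open>g\<close> is never positive, whereas \<open>G\<close> has to descend from positive values to \<open>G b = 0\<close>.\<close>

lemma initial_level_pos: "0 < \<gamma> 0"
proof (rule ccontr)
  assume "\<not> 0 < \<gamma> 0"
  moreover have "0 \<le> \<gamma> 0" by (intro parisi_densities_nonneg[OF density]) auto
  ultimately have g0: "\<gamma> 0 = 0" by simp
  define b where "b = hi \<gamma> 0"
  have v: "0 \<in> levels \<gamma>" using initial_level g0 by simp
  have lo: "lo \<gamma> 0 = 0" using lo_initial_level[OF initial_level] g0 by simp
  have b: "0 < b" "b \<le> 1" using level_endpoints[OF v] lo by (auto simp: b_def)
  have con: "G b = 0" "g b = 0" using contact_hi[OF v] by (auto simp: contact_def b_def)
  have flat: "\<gamma> y = 0" if "y \<in> {0..<b}" for y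
    using level_value[OF density v, of y] that lo by (simp add: b_def)
  have Nb: "N y = N b" if "y \<in> {0..b}" for y
    using N_on_plateau[of 0 b 0 y] flat b that by simp
  obtain \<delta> where \<delta>: "0 < \<delta>" "\<delta> \<le> 1" "\<And>u. 0 < u \<Longrightarrow> u < \<delta> \<Longrightarrow> 0 < G u"
    using G_positive_near_0 by blast
  define u where "u = min \<delta> b / 2"
  have u: "0 < u" "u < b" "0 < G u" using \<delta> b by (auto simp: u_def min_def)
  obtain c where c: "u < c" "c < b" "0 < g c"
    using G_decrease[of u b] u b con by auto
  obtain s where s: "0 < s" "s < c" "W s < poly X2 s"
    using g_increase[of 0 c] c u b by auto
  obtain t where t: "c < t" "t < b" "poly X2 t < W t"
    using g_decrease[of c b] c u b con by auto
  note s(3) t(3)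
  moreover have "W s = W t" using Nb[of s] Nb[of t] s t c by simp
  moreover have "poly X2 s \<le> poly X2 t" using s t by (intro X2_mono) auto
  ultimately show False by linarith
qed

lemma finite_levels_card: "finite (levels \<gamma>) \<and> card (levels \<gamma>) \<le> card (exponents X2)"
proof (rule finite_if_finite_subsets_card_bdd)
  show "card F \<le> card (exponents X2)" if F: "F \<subseteq> levels \<gamma>" "finite F" for F
  proof -
    define vs where "vs = sorted_list_of_set F"
    have vs: "set vs = F" "length vs = card F" "sorted_wrt (<) vs"
      using F by (simp_all add: vs_def strict_sorted_iff)
    have lev: "vs ! l \<in> levels \<gamma>" if "l < card F" for l
      using that vs F by (metis nth_mem subsetD)
    have pos: "0 < v" if "v \<in> levels \<gamma>" for v
      using initial_level_le[OF density that] initial_level_pos by simp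
    show ?thesis
    proof (rule plateau_count[of _ "\<lambda>l. lo \<gamma> (vs ! l)" "\<lambda>l. hi \<gamma> (vs ! l)" "\<lambda>l. vs ! l"])
      fix l assume l: "l < card F"
      show "0 \<le> lo \<gamma> (vs ! l) \<and> lo \<gamma> (vs ! l) < hi \<gamma> (vs ! l) \<and> hi \<gamma> (vs ! l) \<le> 1"
        using level_endpoints[OF lev[OF l]] by simp
      show "contact (lo \<gamma> (vs ! l)) \<and> contact (hi \<gamma> (vs ! l))"
        using contact_lo contact_hi lev[OF l] pos by blast
      show "\<gamma> x = vs ! l" if "x \<in> {lo \<gamma> (vs ! l)..<hi \<gamma> (vs ! l)}" for x
        using level_value[OF density lev[OF l]] that by simp
    next
      fix l assume l: "Suc l < card F"
      have "vs ! l < vs ! Suc l"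
        using vs l by (simp add: sorted_wrt_nth_less)
      then show "hi \<gamma> (vs ! l) \<le> lo \<gamma> (vs ! Suc l) \<and> vs ! l \<le> vs ! Suc l"
        using level_order[OF density lev lev, of l "Suc l"] l by simp
    qed
  qed
qed

end

section \<open>From plateaus to \<open>k\<close>-FRSB and isolated points\<close>

lemma nu_measure_cong:
  assumes "\<And>x. x \<in> {0..<1} \<Longrightarrow> \<gamma> x = \<gamma>' x"
  shows "nu_measure \<gamma> \<Delta> = nu_measure \<gamma>' \<Delta>"
proof -
  have "(\<lambda>x. ennreal (\<gamma> x) * indicator {0..<1} x) = (\<lambda>x. ennreal (\<gamma>' x) * indicator {0..<1} x)"
    using assms by (auto simp: indicator_def)
  then show ?thesis by (simp add: nu_measure_def)
qed

lemma sum_consecutive_blocks: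
  fixes F :: "nat \<Rightarrow> 'a::comm_monoid_add"
  assumes "w 0 = 0" "\<And>j. j < t \<Longrightarrow> w j \<le> w (Suc j)"
  shows "(\<Sum>j=1..t. \<Sum>l=w (j - 1) + 1..w j. F l) = (\<Sum>l=1..w t. F l)"
  using assms(2)
proof (induction t)
  case 0
  then show ?case using assms(1) by simp
next
  case (Suc t)
  have "(\<Sum>j=1..Suc t. \<Sum>l=w (j - 1) + 1..w j. F l) = (\<Sum>l=1..w t. F l) + (\<Sum>l=w t + 1..w (Suc t). F l)"
    using Suc by simp
  also have "\<dots> = (\<Sum>l=1..w (Suc t). F l)"
    using sum.ub_add_nat[of 1 "w t" F "w (Suc t) - w t"] Suc.prems[of t] by simp
  finally show ?case .
qed

text \<open>The plateaus \<open>[a l, b l)\<close> are cut into blocks after each \<open>l \<in> J\<close>, the indices for which a nonempty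
interval \<open>[b l, a (Suc l))\<close> follows, on which \<open>\<gamma>\<close> increases strictly. Hence \<open>w 1, w 2, \<dots>\<close> enumerate
\<open>J\<close>, followed by \<open>k\<close> for ever. If \<open>k \<in> J\<close>, then the last block consists of the single point \<open>1\<close>. The
points of a block \<open>j\<close> are the left end of its first plateau and the right ends of all its plateaus;
\<open>q j (w (j - 1)) = a (Suc (w (j - 1)))\<close> expresses this also for a block without plateaus, thanks to
\<open>a (Suc k) = 1\<close>. There are no more blocks than \<open>k + 1\<close>, since each \<open>l \<in> J\<close> ends only one block.\<close>

lemma k_FRSB_of_plateaus:
  fixes a b m :: "nat \<Rightarrow> real"
  assumes \<gamma>: "\<gamma> \<in> parisi_densities" and \<Delta>: "0 < \<Delta>" and k: "0 < k"
    and m: "0 < m 1" "strict_mono_on {1..k} m"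
    and ends: "a 1 = 0" "a (Suc k) = 1"
    and ab: "\<And>l. l \<in> {1..k} \<Longrightarrow> a l < b l" and ba: "\<And>l. l \<in> {1..k} \<Longrightarrow> b l \<le> a (Suc l)"
    and plateau: "\<And>l x. l \<in> {1..k} \<Longrightarrow> a l \<le> x \<Longrightarrow> x < b l \<Longrightarrow> \<gamma> x = m l"
    and strict: "strict_mono_on (\<Union>l\<in>{1..k}. {b l..<a (Suc l)}) \<gamma>"
  shows "k_FRSB k (nu_measure \<gamma> \<Delta>)"
proof -
  define J where "J = {l\<in>{1..k}. b l < a (Suc l)}"
  define js where "js = sorted_list_of_set J"
  define t where "t = Suc (card J)"
  have finJ: "finite J" by (simp add: J_def)
  have js: "set js = J" "length js = card J" "sorted_wrt (<) js"
    using finJ by (simp_all add: js_def strict_sorted_iff)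
  define w where "w j = (if j = 0 then 0 else if j < t then js ! (j - 1) else k)" for j
  define s where "s j = w j - w (j - 1)" for j
  define q where "q j l = (if l = w (j - 1) then a (Suc l) else b l)" for j l
  have w0: "w 0 = 0" by (simp add: w_def)
  have wt: "w t = k" by (simp add: w_def t_def)
  have wJ: "w j \<in> J" if "1 \<le> j" "j < t" for j
  proof -
    have "js ! (j - 1) \<in> set js" using that js(2) by (intro nth_mem) (simp add: t_def)
    then show ?thesis using that js(1) by (simp add: w_def)
  qed
  have wle: "w j \<le> k" for j
    using wJ[of j] by (cases "1 \<le> j \<and> j < t") (auto simp: J_def w_def)
  have wstrict: "w j < w (Suc j)" if "Suc j < t" for j
  proof (cases "j = 0")
    case True
    then show ?thesis using wJ[of 1] that w0 by (auto simp: J_def)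
  next
    case False
    then have "js ! (j - 1) < js ! j"
      using js that by (intro sorted_wrt_nth_less[OF js(3)]) (auto simp: t_def)
    then show ?thesis using False that by (simp add: w_def)
  qed
  have wmono1: "w j \<le> w (Suc j)" for j
    using wstrict[of j] wle[of j] by (cases "Suc j < t") (auto simp: w_def)
  have wmono: "w i \<le> w j" if "i \<le> j" for i j
    using lift_Suc_mono_le[of w i j] wmono1 that by blast
  have ws: "(\<Sum>i=1..j. s i) = w j" for j
  proof (induction j)
    case (Suc j)
    then show ?case using wmono1[of j] by (simp add: s_def)
  qed (simp add: w0)
  have Jw: "\<exists>j\<in>{1..<t}. w j = l" if "l \<in> J" for l
  proof -
    have "l \<in> set js" using that js(1) by simp
    then obtain i where "i < length js" "js ! i = l" unfolding in_set_conv_nth by blast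
    then show ?thesis using js(2) by (intro bexI[of _ "Suc i"]) (auto simp: w_def t_def)
  qed
  have "strict_mono_on {1..<t} w"
  proof (rule strict_mono_onI)
    fix i j assume ij: "i \<in> {1..<t}" "j \<in> {1..<t}" "i < j"
    have "w i < w (Suc i)" using ij by (intro wstrict) auto
    also have "\<dots> \<le> w j" using ij by (intro wmono) auto
    finally show "w i < w j" .
  qed
  then have winj: "inj_on w {1..<t}" by (rule strict_mono_on_imp_inj_on)
  have wimage: "w ` {1..<t} = J" using Jw wJ by (auto simp: image_iff)
  have no_J: "l \<notin> J" if j: "j \<in> {1..t}" and l: "w (j - 1) < l" "l < w j" for j l
  proof
    assume "l \<in> J"
    then obtain i where i: "i \<in> {1..<t}" "w i = l" using Jw by blast
    show False
    proof (cases "i \<le> j - 1")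
      case True then show ?thesis using wmono[OF True] i l by simp
    next
      case False
      then have "j \<le> i" by simp
      then show ?thesis using wmono[of j i] i l by simp
    qed
  qed
  have a_mono: "a l \<le> a l'" if "1 \<le> l" "l \<le> l'" "l' \<le> Suc k" for l l'
    using that(2,3)
  proof (induction l' rule: dec_induct)
    case (step n)
    then have "n \<in> {1..k}" using that(1) by simp
    from ab[OF this] ba[OF this] show ?case using step by simp
  qed simp
  have a01: "0 \<le> a l" "a l \<le> 1" if "l \<in> {1..Suc k}" for l
    using a_mono[of 1 l] a_mono[of l "Suc k"] that ends by auto
  have b01: "0 \<le> b l" "b l \<le> 1" if "l \<in> {1..k}" for l
    using a01[of l] a01[of "Suc l"] ab[OF that] ba[OF that] that by auto
  have b_a: "b l \<le> a l'" if "1 \<le> l" "l < l'" "l' \<le> Suc k" for l l'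
    using ba[of l] a_mono[of "Suc l" l'] that by auto
  have plateau_q: "q j (l - 1) = a l \<and> q j l = b l" if j: "j \<in> {1..t}" and l: "l \<in> {w (j - 1) + 1..w j}" for j l
  proof -
    have lk: "l \<in> {1..k}" using l wle[of j] by auto
    have "b (l - 1) = a l" if "l - 1 \<noteq> w (j - 1)"
    proof -
      have "l - 1 \<notin> J" using that l by (intro no_J[OF j]) auto
      moreover have "l - 1 \<in> {1..k}" using that l lk by auto
      ultimately show ?thesis using ba[of "l - 1"] lk by (auto simp: J_def)
    qed
    moreover have "a (Suc (l - 1)) = a l" using lk by simp
    moreover have "l \<noteq> w (j - 1)" using l by simp
    ultimately show ?thesis unfolding q_def by presburger
  qed
  have gap_q: "q j (w j) = b (w j) \<and> q (j + 1) (w j) = a (Suc (w j))" if "j \<in> {1..<t}" for j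
    using wstrict[of "j - 1"] that by (auto simp: q_def)
  have I: "(\<Union>j\<in>{1..<t}. {q j (w j)..<q (j + 1) (w j)}) = (\<Union>l\<in>{1..k}. {b l..<a (Suc l)})"
  proof -
    have "(\<Union>j\<in>{1..<t}. {q j (w j)..<q (j + 1) (w j)}) = (\<Union>j\<in>{1..<t}. {b (w j)..<a (Suc (w j))})"
      using gap_q by (intro SUP_cong) auto
    also have "\<dots> = (\<Union>l\<in>w ` {1..<t}. {b l..<a (Suc l)})" by simp
    also have "\<dots> = (\<Union>l\<in>{1..k}. {b l..<a (Suc l)})"
      unfolding wimage by (auto simp: J_def)
    finally show ?thesis .
  qed
  have density_eq: "\<gamma> x = (\<Sum>j=1..t. \<Sum>l=w (j - 1) + 1..w j. m l * indicator {q j (l - 1)..<q j l} x) +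
      (\<Sum>j=1..<t. \<gamma> x * indicator {q j (w j)..<q (j + 1) (w j)} x)" if x: "x \<in> {0..<1}" for x
  proof -
    have "(\<Sum>j=1..t. \<Sum>l=w (j - 1) + 1..w j. m l * indicator {q j (l - 1)..<q j l} x) =
        (\<Sum>j=1..t. \<Sum>l=w (j - 1) + 1..w j. \<gamma> x * indicator {a l..<b l} x)"
    proof (intro sum.cong refl)
      fix j l assume jl: "j \<in> {1..t}" "l \<in> {w (j - 1) + 1..w j}"
      then have "l \<in> {1..k}" using wle[of j] by auto
      then show "m l * indicator {q j (l - 1)..<q j l} x = \<gamma> x * indicator {a l..<b l} x"
        using plateau_q[OF jl] plateau[of l x] by (auto simp: indicator_def)
    qed
    also have "\<dots> = (\<Sum>l=1..k. \<gamma> x * indicator {a l..<b l} x)"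
      by (rule sum_consecutive_blocks[of w t, unfolded wt]) (rule w0 wmono1)+
    finally have 1: "(\<Sum>j=1..t. \<Sum>l=w (j - 1) + 1..w j. m l * indicator {q j (l - 1)..<q j l} x) =
      (\<Sum>l=1..k. \<gamma> x * indicator {a l..<b l} x)" .
    have "(\<Sum>j=1..<t. \<gamma> x * indicator {q j (w j)..<q (j + 1) (w j)} x) =
        (\<Sum>j=1..<t. \<gamma> x * indicator {b (w j)..<a (Suc (w j))} x)"
      using gap_q by (intro sum.cong) auto
    also have "\<dots> = (\<Sum>l\<in>J. \<gamma> x * indicator {b l..<a (Suc l)} x)"
      unfolding wimage[symmetric] sum.reindex[OF winj] o_def ..
    also have "\<dots> = (\<Sum>l=1..k. \<gamma> x * indicator {b l..<a (Suc l)} x)"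
      by (intro sum.mono_neutral_left) (auto simp: J_def indicator_def)
    finally have 2: "(\<Sum>j=1..<t. \<gamma> x * indicator {q j (w j)..<q (j + 1) (w j)} x) =
      (\<Sum>l=1..k. \<gamma> x * indicator {b l..<a (Suc l)} x)" .
    \<comment> \<open>The intervals \<open>[a l, b l)\<close> and \<open>[b l, a (Suc l))\<close> tile \<open>[0,1)\<close>.\<close>
    have "(\<Sum>l=1..k. indicator {a l..<b l} x + indicator {b l..<a (Suc l)} x) =
        (\<Sum>l=1..k. (if x < a (Suc l) then 1 else 0) - (if x < a l then 1 else 0 :: real))"
      using ab ba by (intro sum.cong refl) (force simp: indicator_def not_less)
    also have "\<dots> = (if x < a (Suc k) then 1 else 0) - (if x < a 1 then 1 else 0)"
      using sum_Suc_diff[of 1 k "\<lambda>l. if x < a l then 1 else 0 :: real"] k by simp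
    also have "\<dots> = 1" using ends x by simp
    finally have "\<gamma> x = \<gamma> x * (\<Sum>l=1..k. indicator {a l..<b l} x + indicator {b l..<a (Suc l)} x)" by simp
    then show ?thesis unfolding 1 2 by (simp add: sum_distrib_left distrib_left sum.distrib)
  qed
  show ?thesis
    unfolding k_FRSB_def
  proof (intro conjI exI)
    show "0 < k" by fact
    show "1 \<le> t" by (simp add: t_def)
    have "card J \<le> card {1..k}" by (intro card_mono) (auto simp: J_def)
    then show "t \<le> k + 1" by (simp add: t_def)
    show "(\<Sum>i=1..t. s i) = k" using ws wt by simp
    show "\<forall>j. w j = (\<Sum>i=1..j. s i)" using ws by simp
    show "\<forall>j\<in>{1..t}. \<forall>l\<in>{w (j - 1)..w j}. q j l \<in> {0..1}"
    proof (intro ballI)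
      fix j l assume jl: "j \<in> {1..t}" "l \<in> {w (j - 1)..w j}"
      then have "l \<le> k" using wle[of j] by simp
      then show "q j l \<in> {0..1}"
        using a01[of "Suc l"] b01[of l] jl by (auto simp: q_def)
    qed
    show "\<forall>j\<in>{1..t}. strict_mono_on {w (j - 1)..w j} (q j)"
    proof (intro ballI strict_mono_onI)
      fix j l l' assume j: "j \<in> {1..t}" and l: "l \<in> {w (j - 1)..w j}" "l' \<in> {w (j - 1)..w j}" "l < l'"
      have k': "l' \<in> {1..k}" using l wle[of j] by auto
      have q': "q j l' = b l'" using l by (simp add: q_def)
      show "q j l < q j l'"
      proof (cases "l = w (j - 1)")
        case True
        then show ?thesis using q' ab[OF k'] a_mono[of "Suc l" l'] l k' by (auto simp: q_def)
      next
        case False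
        then have "q j l = b l" "1 \<le> l" using l by (auto simp: q_def)
        then show ?thesis using q' ab[OF k'] b_a[of l l'] l k' by auto
      qed
    qed
    show "\<forall>j\<in>{2..t}. q (j - 1) (w (j - 1)) < q j (w (j - 1))"
    proof
      fix j assume j: "j \<in> {2..t}"
      then have "j - 1 \<in> {1..<t}" "Suc (j - 1) = j" by auto
      then show "q (j - 1) (w (j - 1)) < q j (w (j - 1))"
        using gap_q[of "j - 1"] wJ[of "j - 1"] by (auto simp: J_def)
    qed
    show "q 1 0 = 0" using w0 ends by (simp add: q_def)
    show "q t (w t) = 1"
    proof (cases "w (t - 1) = k")
      case True
      then show ?thesis using wt ends by (simp add: q_def)
    next
      case False
      have "k \<notin> J"
      proof
        assume "k \<in> J"
        then obtain i where "i \<in> {1..<t}" "w i = k" using Jw by blast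
        moreover have "i \<le> t - 1" using calculation by auto
        ultimately show False using wmono[of i "t - 1"] wle[of "t - 1"] False by simp
      qed
      then have "b k = 1" using ba[of k] ends b01[of k] k by (auto simp: J_def)
      then show ?thesis using wt False by (simp add: q_def)
    qed
    show "0 < m 1" "strict_mono_on {1..k} m" "0 < \<Delta>" by fact+
    show "(\<Union>l\<in>{1..k}. {b l..<a (Suc l)}) = (\<Union>j\<in>{1..<t}. {q j (w j)..<q (j + 1) (w j)})"
      using I by simp
    show "strict_mono_on (\<Union>l\<in>{1..k}. {b l..<a (Suc l)}) \<gamma>" by fact
    show "\<forall>x\<in>\<Union>l\<in>{1..k}. {b l..<a (Suc l)}. 0 \<le> \<gamma> x"
    proof
      fix x assume "x \<in> (\<Union>l\<in>{1..k}. {b l..<a (Suc l)})"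
      then obtain l where l: "l \<in> {1..k}" "b l \<le> x" "x < a (Suc l)" by auto
      then show "0 \<le> \<gamma> x"
        using b01[of l] a01[of "Suc l"] by (intro parisi_densities_nonneg[OF \<gamma>]) auto
    qed
    show "nu_measure \<gamma> \<Delta> = nu_measure (\<lambda>x. (\<Sum>j=1..t. \<Sum>l=w (j - 1) + 1..w j. m l * indicator {q j (l - 1)..<q j l} x) +
              (\<Sum>j=1..<t. \<gamma> x * indicator {q j (w j)..<q (j + 1) (w j)} x)) \<Delta>"
      by (rule nu_measure_cong) (rule density_eq)
  qed
qed

lemma k_FRSB_of_levels:
  assumes \<gamma>: "\<gamma> \<in> parisi_densities" and \<Delta>: "0 < \<Delta>" and fin: "finite (levels \<gamma>)"
    and init: "\<gamma> 0 \<in> levels \<gamma>" "0 < \<gamma> 0"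
  shows "k_FRSB (card (levels \<gamma>)) (nu_measure \<gamma> \<Delta>)"
proof -
  define k where "k = card (levels \<gamma>)"
  define vs where "vs = sorted_list_of_set (levels \<gamma>)"
  have vs: "set vs = levels \<gamma>" "length vs = k" "sorted_wrt (<) vs"
    using fin by (simp_all add: vs_def k_def strict_sorted_iff)
  have k: "0 < k" using init fin by (auto simp: k_def card_gt_0_iff)
  define m where "m l = vs ! (l - 1)" for l
  define a where "a l = (if l \<le> k then lo \<gamma> (m l) else 1)" for l
  define b where "b l = hi \<gamma> (m l)" for l
  have lev: "m l \<in> levels \<gamma>" if "l \<in> {1..k}" for l
  proof -
    have "vs ! (l - 1) \<in> set vs" using that vs(2) by (intro nth_mem) auto
    then show ?thesis unfolding m_def vs(1) .
  qed
  have m_mono: "strict_mono_on {1..k} m"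
  proof (rule strict_mono_onI)
    show "m l < m l'" if "l \<in> {1..k}" "l' \<in> {1..k}" "l < l'" for l l'
      unfolding m_def using that vs(2) by (intro sorted_wrt_nth_less[OF vs(3)]) auto
  qed
  have lev_m: "\<exists>l\<in>{1..k}. m l = v" if "v \<in> levels \<gamma>" for v
  proof -
    have "v \<in> set vs" using that vs(1) by simp
    then obtain i where "i < length vs" "vs ! i = v" unfolding in_set_conv_nth by blast
    then show ?thesis using vs(2) by (intro bexI[of _ "Suc i"]) (auto simp: m_def)
  qed
  have m1: "m 1 = \<gamma> 0"
  proof -
    obtain l where l: "l \<in> {1..k}" "m l = \<gamma> 0" using lev_m[OF init(1)] by blast
    have "m 1 \<le> m l"
      using l k strict_mono_onD[OF m_mono, of 1 l] by (cases "l = 1") auto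
    then show ?thesis using initial_level_le[OF \<gamma> lev[of 1]] l k by simp
  qed
  have ba: "b l \<le> a (Suc l)" if l: "l \<in> {1..k}" for l
  proof (cases "l = k")
    case True
    then show ?thesis using level_endpoints(3)[OF lev[OF l]] by (simp add: a_def b_def)
  next
    case False
    then have "Suc l \<in> {1..k}" using l by auto
    then show ?thesis
      using level_order[OF \<gamma> lev[OF l] lev[of "Suc l"]] m_mono l
      by (auto simp: a_def b_def strict_mono_on_def)
  qed
  have ab: "a l < b l" if "l \<in> {1..k}" for l
    using level_endpoints(2)[OF lev[OF that]] that by (simp add: a_def b_def)
  show ?thesis
    unfolding k_def[symmetric]
  proof (rule k_FRSB_of_plateaus[OF \<gamma> \<Delta> k, of m a b])
    show "0 < m 1" using m1 init by simp
    show "strict_mono_on {1..k} m" by (rule m_mono)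
    show "a 1 = 0" using m1 lo_initial_level[OF init(1)] k by (simp add: a_def)
    show "a (Suc k) = 1" by (simp add: a_def)
    show "a l < b l" "b l \<le> a (Suc l)" if "l \<in> {1..k}" for l using ab ba that by auto
    show "\<gamma> x = m l" if "l \<in> {1..k}" "a l \<le> x" "x < b l" for l x
      using level_value[OF \<gamma> lev[OF that(1)], of x] that by (simp add: a_def b_def)
    show "strict_mono_on (\<Union>l\<in>{1..k}. {b l..<a (Suc l)}) \<gamma>"
    proof (rule strict_mono_onI)
      fix x y assume x: "x \<in> (\<Union>l\<in>{1..k}. {b l..<a (Suc l)})" and y: "y \<in> (\<Union>l\<in>{1..k}. {b l..<a (Suc l)})"
        and xy: "x < y"
      have range: "0 \<le> z \<and> z < 1" if z: "z \<in> (\<Union>l\<in>{1..k}. {b l..<a (Suc l)})" for z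
      proof -
        obtain l where l: "l \<in> {1..k}" "b l \<le> z" "z < a (Suc l)" using z by auto
        have "a (Suc l) \<le> 1"
          using level_endpoints[OF lev[of "Suc l"]] l by (auto simp: a_def)
        then show ?thesis using level_endpoints[OF lev[OF l(1)]] l by (auto simp: b_def)
      qed
      have "\<gamma> x \<le> \<gamma> y" using range[OF x] range[OF y] xy by (intro parisi_densities_mono[OF \<gamma>]) auto
      moreover have "\<gamma> x \<noteq> \<gamma> y"
      proof
        assume eq: "\<gamma> x = \<gamma> y"
        define v where "v = \<gamma> x"
        have pl: "x \<in> plateau_set \<gamma> v" "y \<in> plateau_set \<gamma> v"
          using range[OF x] range[OF y] eq by (auto simp: plateau_set_def v_def)
        then have "v \<in> levels \<gamma>" using xy by (auto simp: levels_def)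
        then obtain l where l: "l \<in> {1..k}" "m l = v" using lev_m by blast
        then have xl: "a l \<le> x" "x < b l"
          using plateau_set_bounds[OF pl(1)] plateau_set_bounds[OF pl(2)] xy by (auto simp: a_def b_def)
        obtain l' where l': "l' \<in> {1..k}" "b l' \<le> x" "x < a (Suc l')" using x by auto
        consider "l' < l" | "l' = l" | "l < l'" by linarith
        then show False
        proof cases
          case 1
          have "a (Suc l') \<le> a l"
          proof (cases "Suc l' = l")
            case False
            then have "m (Suc l') < m l" using 1 l l' m_mono by (auto simp: strict_mono_on_def)
            then have "hi \<gamma> (m (Suc l')) \<le> lo \<gamma> (m l)"
              using 1 l l' by (intro level_order[OF \<gamma> lev lev]) auto
            then show ?thesis using ab[of "Suc l'"] 1 l by (auto simp: a_def b_def)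
          qed simp
          then show ?thesis using xl l' by simp
        next
          case 2
          then show ?thesis using xl l' by simp
        next
          case 3
          then have "m l < m l'" using l l' m_mono by (auto simp: strict_mono_on_def)
          then have "hi \<gamma> (m l) \<le> lo \<gamma> (m l')" by (intro level_order[OF \<gamma> lev lev] l l')
          then have "b l \<le> a l'" using l' by (simp add: a_def b_def)
          then show ?thesis using ab[OF l'(1)] xl l' by simp
        qed
      qed
      ultimately show "\<gamma> x < \<gamma> y" by simp
    qed
  qed
qed

text \<open>To the right of an isolated point \<open>x < 1\<close> of the support there is an interval without support
points, on which \<open>\<gamma>\<close> must be constant: between two arguments with different values of \<open>\<gamma>\<close>
lies the point at which the larger value is first reached, and it belongs to the support. So \<open>x\<close>
lies on a plateau, and not inside it, as the interior has \<open>\<rho>\<close>-measure \<open>0\<close>.\<close>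

lemma isolated_support_points:
  assumes \<gamma>: "\<gamma> \<in> parisi_densities" and \<Delta>: "0 < \<Delta>"
  shows "{x. x isolated_in parisi_support (nu_measure \<gamma> \<Delta>)} \<subseteq> insert 1 (lo \<gamma> ` levels \<gamma>)"
proof
  obtain \<rho> where \<rho>: "is_rho \<gamma> \<rho>" using is_rho_exists[OF \<gamma>] by blast
  have sets: "sets \<rho> = sets (restrict_space borel {0..<1})"
    and em: "\<And>x. x \<in> {0..<1} \<Longrightarrow> emeasure \<rho> {0..x} = ennreal (\<gamma> x)"
    using \<rho> by (auto simp: is_rho_def)
  have space: "space \<rho> = {0..<1}"
    using sets_eq_imp_space_eq[OF sets] by (simp add: space_restrict_space)
  have meas: "A \<in> sets \<rho>" if "A \<in> sets borel" "A \<subseteq> {0..<1}" for A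
    using that by (simp add: sets sets_restrict_space_iff)
  have null_iff: "emeasure \<rho> {p<..r} = 0 \<longleftrightarrow> \<gamma> p = \<gamma> r" if pr: "0 \<le> p" "p \<le> r" "r < 1" for p r
  proof -
    have "emeasure \<rho> {p<..r} = emeasure \<rho> ({0..r} - {0..p})"
      using pr by (intro arg_cong[of _ _ "emeasure \<rho>"]) auto
    also have "\<dots> = ennreal (\<gamma> r) - ennreal (\<gamma> p)"
      using pr em[of p] em[of r] by (subst emeasure_Diff) (auto intro!: meas)
    also have "\<dots> = ennreal (\<gamma> r - \<gamma> p)"
      using pr by (intro ennreal_minus parisi_densities_nonneg[OF \<gamma>]) auto
    finally show ?thesis
      using parisi_densities_mono[OF \<gamma>, of p r] pr by (auto simp: ennreal_eq_0_iff)
  qed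
  fix x assume "x \<in> {x. x isolated_in parisi_support (nu_measure \<gamma> \<Delta>)}"
  then obtain T where T: "open T" "T \<inter> (measure_support \<rho> \<union> {1}) = {x}"
    by (auto simp: isolated_in_def parisi_support_nu_measure[OF \<gamma> \<Delta> \<rho>])
  show "x \<in> insert 1 (lo \<gamma> ` levels \<gamma>)"
  proof (cases "x = 1")
    case False
    then have supp: "x \<in> measure_support \<rho>" using T by auto
    then have x: "0 \<le> x" "x < 1" by (auto simp: measure_support_def space)
    obtain e0 where e0: "0 < e0" "ball x e0 \<subseteq> T" using T open_contains_ball by blast
    define e where "e = min e0 (1 - x)"
    have e: "0 < e" "x + e \<le> 1" using e0 x by (auto simp: e_def)
    have eT: "z \<in> T" if "x < z" "z < x + e" for z
      using e0(2) that by (auto simp: e_def dist_real_def subset_iff)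
    have const: "\<gamma> y1 = \<gamma> y2" if y: "x < y1" "y1 < y2" "y2 < x + e" for y1 y2
    proof (rule ccontr)
      assume "\<gamma> y1 \<noteq> \<gamma> y2"
      then have less: "\<gamma> y1 < \<gamma> y2"
        using parisi_densities_mono[OF \<gamma>, of y1 y2] x y e by auto
      define S where "S = {z\<in>{0..<1}. \<gamma> y2 \<le> \<gamma> z}"
      define z where "z = Inf S"
      have bdd: "bdd_below S" by (auto simp: S_def intro: bdd_belowI[of _ 0])
      have y2S: "y2 \<in> S" using x y e by (auto simp: S_def)
      have z1: "y1 \<le> z"
        unfolding z_def
      proof (rule cInf_greatest)
        show "S \<noteq> {}" using y2S by auto
        fix s assume s: "s \<in> S"
        show "y1 \<le> s"
        proof (rule ccontr)
          assume "\<not> y1 \<le> s"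
          then have "\<gamma> s \<le> \<gamma> y1" using s x y e by (intro parisi_densities_mono[OF \<gamma>]) (auto simp: S_def)
          then show False using s less by (auto simp: S_def)
        qed
      qed
      have z2: "z \<le> y2" unfolding z_def using y2S bdd by (rule cInf_lower)
      have "z \<in> measure_support \<rho>"
        unfolding measure_support_def
      proof (intro CollectI conjI allI impI)
        show "z \<in> space \<rho>" using z1 z2 x y e by (auto simp: space)
        fix U :: "real set" assume U: "open U" "z \<in> U"
        obtain d where d: "0 < d" "ball z d \<subseteq> U" using U open_contains_ball by blast
        obtain r where r: "r \<in> S" "r < z + d"
          using cInf_less_iff[of S "z + d"] bdd y2S d by (auto simp: z_def)
        have zr: "z \<le> r" unfolding z_def using r(1) bdd by (rule cInf_lower)
        define p where "p = max 0 (z - d / 2)"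
        have p: "0 \<le> p" "p < z" "z - d < p" using z1 x y d by (auto simp: p_def)
        have "p \<notin> S"
        proof
          assume "p \<in> S"
          then have "z \<le> p" unfolding z_def using bdd by (rule cInf_lower)
          then show False using p by simp
        qed
        then have "\<gamma> p < \<gamma> y2" using p z2 x y e by (auto simp: S_def)
        then have "\<gamma> p \<noteq> \<gamma> r" using r by (auto simp: S_def)
        then have "emeasure \<rho> {p<..r} \<noteq> 0" using null_iff[of p r] p zr r by (auto simp: S_def)
        moreover have "emeasure \<rho> {p<..r} \<le> emeasure \<rho> (U \<inter> space \<rho>)"
        proof (rule emeasure_mono)
          show "{p<..r} \<subseteq> U \<inter> space \<rho>"
            using d p zr r by (auto simp: space S_def subset_iff dist_real_def)
          show "U \<inter> space \<rho> \<in> sets \<rho>" using U by (intro meas) (auto simp: space)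
        qed
        ultimately show "0 < emeasure \<rho> (U \<inter> space \<rho>)"
          by (metis less_le_trans zero_less_iff_neq_zero)
      qed
      moreover have "z \<in> T" using z1 z2 y by (intro eT) auto
      ultimately have "z = x" using T by auto
      then show False using z1 y by simp
    qed
    define v where "v = \<gamma> (x + e / 2)"
    have cv: "\<gamma> y = v" if "x < y" "y < x + e" for y
    proof (cases y "x + e / 2" rule: linorder_cases)
      case less
      then show ?thesis unfolding v_def using that e by (intro const) auto
    next
      case greater
      then show ?thesis unfolding v_def using that e by (intro const[symmetric]) auto
    qed (simp add: v_def)
    have xv: "\<gamma> x = v"
    proof -
      have "\<forall>\<^sub>F y in at_right x. \<gamma> y = v"
        using cv e by (auto simp: eventually_at_right[of x "x + e"] intro!: exI[of _ "x + e"])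
      then have "(\<gamma> \<longlongrightarrow> v) (at_right x)" by (rule tendsto_eventually)
      then show ?thesis
        using parisi_densities_right_limit[OF \<gamma> x]
          tendsto_unique[OF trivial_limit_at_right_real, of \<gamma> "\<gamma> x" x v] by blast
    qed
    have pl: "x \<in> plateau_set \<gamma> v" "x + e / 2 \<in> plateau_set \<gamma> v"
      using x e xv by (auto simp: plateau_set_def v_def)
    moreover have "x < x + e / 2" using e by simp
    ultimately have lev: "v \<in> levels \<gamma>" unfolding levels_def by blast
    have "lo \<gamma> v = x"
    proof (rule ccontr)
      assume "lo \<gamma> v \<noteq> x"
      then have lx: "lo \<gamma> v < x" using plateau_set_bounds(1)[OF pl(1)] by simp
      note le = level_endpoints[OF lev]
      have "\<gamma> (lo \<gamma> v) = \<gamma> (x + e / 2)" using level_value[OF \<gamma> lev, of "lo \<gamma> v"] le by (simp add: v_def)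
      then have n: "emeasure \<rho> {lo \<gamma> v<..x + e / 2} = 0"
        using null_iff[of "lo \<gamma> v" "x + e / 2"] le lx e by auto
      let ?U = "{lo \<gamma> v<..<x + e / 2}"
      have "emeasure \<rho> (?U \<inter> space \<rho>) \<le> emeasure \<rho> {lo \<gamma> v<..x + e / 2}"
        using le e by (intro emeasure_mono meas) auto
      moreover have "0 < emeasure \<rho> (?U \<inter> space \<rho>)"
        using supp lx e by (auto simp: measure_support_def)
      ultimately show False using n by simp
    qed
    then show ?thesis using lev by auto
  qed simp
qed

theorem theorem1:
  fixes n :: nat and p :: "nat \<Rightarrow> nat" and lam :: "nat \<Rightarrow> real"
    and \<xi> :: "real \<Rightarrow> real" and \<nu> :: "real measure"
  assumes "1 < n"
    and "2 < p 1" and "strict_mono_on {1..n} p"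
    and "\<And>i. i \<in> {1..n} \<Longrightarrow> lam i \<in> {0..1}" and "(\<Sum>i=1..n. lam i) = 1"
    and "\<And>x. \<xi> x = (\<Sum>i=1..n. lam i * x ^ p i)"
    and "is_parisi_measure \<xi> \<nu>"
  shows "(\<exists>k\<le>n. k_RSB k \<nu> \<or> k_FRSB k \<nu>) \<and>
    finite {x. x isolated_in parisi_support \<nu>} \<and>
    card {x. x isolated_in parisi_support \<nu>} \<le> n + 1"
proof -
  define X where "X = (\<Sum>i=1..n. monom (lam i) (p i))"
  have \<xi>: "\<xi> = poly X"
    using assms(6) by (auto simp: X_def poly_sum poly_monom)
  have coeff: "coeff X e = (\<Sum>i=1..n. if p i = e then lam i else 0)" for e
    by (simp add: X_def coeff_sum)
  have p3: "2 < p i" if "i \<in> {1..n}" for i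
    using strict_mono_onD[OF assms(3), of 1 i] assms(1,2) that by (cases "i = 1") auto
  have nn: "0 \<le> coeff X e" for e
    unfolding coeff using assms(4) by (intro sum_nonneg) auto
  have low: "coeff X e = 0" if "e \<le> 2" for e
    unfolding coeff using p3 that by (intro sum.neutral) force
  obtain i where i: "i \<in> {1..n}" "lam i \<noteq> 0"
    using assms(5) by (metis sum.neutral zero_neq_one)
  have "lam i \<le> coeff X (p i)"
    unfolding coeff using i(1) assms(4) 
    by (intro order_trans[OF _ member_le_sum[of i "{1..n}" "\<lambda>j. if p j = p i then lam j else 0"]]) auto
  then have "coeff X (p i) \<noteq> 0" using i assms(4)[OF i(1)] by auto
  then have deg: "2 < degree X" using p3[OF i(1)] le_degree[of X "p i"] by linarith
  have tX: "exponents X \<subseteq> p ` {1..n}"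
  proof
    fix e assume "e \<in> exponents X"
    then have "coeff X e \<noteq> 0" by (simp add: exponents_def)
    then obtain i where "i \<in> {1..n}" "(if p i = e then lam i else 0) \<noteq> 0"
      unfolding coeff by (rule sum.not_neutral_contains_not_neutral)
    then show "e \<in> p ` {1..n}" by (auto split: if_splits)
  qed
  have "card (exponents X) \<le> card (p ` {1..n})" by (intro card_mono tX) simp
  then have "card (exponents X) \<le> n" using card_image_le[of "{1..n}" p] by simp
  then have exponents: "card (exponents (pderiv (pderiv X))) \<le> n"
    using card_exponents_pderiv[of X] card_exponents_pderiv[of "pderiv X"] by linarith
  obtain \<gamma> \<Delta> where \<nu>: "\<nu> = nu_measure \<gamma> \<Delta>" "\<gamma> \<in> parisi_densities" "0 < \<Delta>"
    and min: "\<And>\<mu>. \<mu> \<in> parisi_class \<Longrightarrow> \<not> parisi_functional \<xi> \<mu> < parisi_functional \<xi> \<nu>"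
    using assms(7) unfolding is_parisi_measure_def is_arg_min_def parisi_class_def by blast
  interpret parisi_minimizer X \<gamma> \<Delta>
  proof
    show "parisi_functional (poly X) (nu_measure \<gamma> \<Delta>) \<le> parisi_functional (poly X) (nu_measure \<gamma>1 \<Delta>1)"
      if "\<gamma>1 \<in> parisi_densities" "0 < \<Delta>1" for \<gamma>1 \<Delta>1
      using min[of "nu_measure \<gamma>1 \<Delta>1"] that \<nu>(1) \<xi> by (auto simp: parisi_class_def not_less)
  qed (use nn low deg \<nu> in auto)
  have lev: "finite (levels \<gamma>)" "card (levels \<gamma>) \<le> n"
    using finite_levels_card exponents by auto
  have k: "\<exists>k\<le>n. k_FRSB k \<nu>"
    using k_FRSB_of_levels[OF \<nu>(2,3) lev(1) initial_level initial_level_pos] lev(2) \<nu>(1) by blast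
  let ?I = "{x. x isolated_in parisi_support \<nu>}"
  have sub: "?I \<subseteq> insert 1 (lo \<gamma> ` levels \<gamma>)"
    unfolding \<nu>(1) by (rule isolated_support_points[OF \<nu>(2,3)])
  have fin: "finite (insert 1 (lo \<gamma> ` levels \<gamma>))" using lev by simp
  have "card ?I \<le> card (insert 1 (lo \<gamma> ` levels \<gamma>))" by (rule card_mono[OF fin sub])
  also have "\<dots> \<le> Suc (card (lo \<gamma> ` levels \<gamma>))" by (rule card_insert_le_m1) auto
  also have "\<dots> \<le> n + 1" using card_image_le[OF lev(1), of "lo \<gamma>"] lev(2) by simp
  finally show ?thesis using k finite_subset[OF sub fin] by blast
qed

end
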